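(* Given $\epsilon>0$ and $0\le j<j_0$, for any real $R>1$, any real $M>0$ with $2M\le R^{5/8}$, and any $0<U\le (u_{j+1}-u_j)/4$ we have $$|S(u_{j+1}-2U,\,u_{j+1}-U,\,M)|+|S(u_j+U,\,u_j+2U,\,M)|\ll M^2R^{3/8+\epsilon},$$ where the implied constant does not depend on $R,M,U$.
   Context: Let $r_\infty>0$ and let $f_1,f_2$ be real functions on $[0,r_\infty]$ with $f_2\le f_1$ such that $\mathbb{E}=\{(x,y,z)\in\mathbb{R}^3: f_2(r)\le z\le f_1(r),\ 0\le r\le r_\infty\}$, $r=\sqrt{x^2+y^2}$, is a smooth convex body (compact, convex, non-empty interior, boundary a smooth surface with everywhere positive Gaussian curvature), with $f_1,f_2$ real analytic on $[0,r_\infty)$. Write $f=f_1$. The map $-f'$ is a strictly increasing bijection from $[0,r_\infty)$ onto $[0,\infty)$. Let $0=r_0<r_1<\dots<r_{j_0-1}$ be the (finitely many) zeros of $f'''$ in $[0,r_\infty)$, fix any $r_{j_0}$ with $r_{j_0-1}<r_{j_0}<r_\infty$, and set $u_j=(f'(r_j))^2$ for $0\le j\le j_0$. Let $g(\vec v)=\sup\{\vec x\cdot\vec v:\vec x\in\mathbb{E}\}$ be the support function of $\mathbb{E}$ and $h(n,m)=g(\sqrt n,0,m)$ for $n,m>0$. Let $e(t)=e^{2\pi i t}$ and let $r_2(n)$ be the number of pairs $(a,b)\in\mathbb{Z}^2$ with $a^2+b^2=n$. For real $U_1<U_2$, $M>0$ and $R>1$ define $$S(U_1,U_2,M)=\sum_{\substack{U_1\le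 n/m^2<U_2\\ M\le m<2M}} r_2(n)\,e(Rh(n,m)),$$ the sum running over positive integers $n,m$. The notation $A\ll B$ means $|A|\le C|B|$ with a constant $C$ that may depend on $\mathbb{E}$, the choice of $r_{j_0}$, $j$ and $\epsilon$ only. *)

theory Defs
  imports "HOL-Analysis.Analysis"
begin

text \<open>On an open set \<open>S\<close>, \<open>Ck_on k S f\<close> says that \<open>f\<close> is \<open>k\<close> times continuously
  differentiable, and \<open>smooth_on S f\<close> that it is \<open>C\<^sup>\<infinity>\<close>; both are meant for open \<open>S\<close> only.\<close>

definition dir_deriv :: "'a::real_normed_vector \<Rightarrow> ('a \<Rightarrow> 'b::real_normed_vector) \<Rightarrow> 'a \<Rightarrow> 'b" where
  "dir_deriv v f = (\<lambda>x. frechet_derivative f (at x) v)"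

primrec Ck_on :: "nat \<Rightarrow> 'a set \<Rightarrow> ('a::real_normed_vector \<Rightarrow> 'b::real_normed_vector) \<Rightarrow> bool" where
  "Ck_on 0 S f \<longleftrightarrow> continuous_on S f"
| "Ck_on (Suc k) S f \<longleftrightarrow> (\<forall>x\<in>S. f differentiable (at x)) \<and> (\<forall>v. Ck_on k S (dir_deriv v f))"

definition smooth_on :: "'a set \<Rightarrow> ('a::real_normed_vector \<Rightarrow> 'b::real_normed_vector) \<Rightarrow> bool" where
  "smooth_on S f \<longleftrightarrow> (\<forall>k. Ck_on k S f)"

abbreviation partial_u :: "(real \<times> real \<Rightarrow> 'b::real_normed_vector) \<Rightarrow> real \<times> real \<Rightarrow> 'b" where
  "partial_u \<equiv> dir_deriv (1, 0)"

abbreviation partial_v :: "(real \<times> real \<Rightarrow> 'b::real_normed_vector) \<Rightarrow> real \<times> real \<Rightarrow> 'b" where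
  "partial_v \<equiv> dir_deriv (0, 1)"

definition local_parametrization ::
    "(real^3) set \<Rightarrow> (real \<times> real) set \<Rightarrow> (real \<times> real \<Rightarrow> real^3) \<Rightarrow> bool" where
  "local_parametrization M W \<phi> \<longleftrightarrow>
     open W \<and> smooth_on W \<phi> \<and>
     openin (top_of_set M) (\<phi> ` W) \<and>
     (\<exists>\<psi>. homeomorphism W (\<phi> ` W) \<phi> \<psi>) \<and>
     (\<forall>q\<in>W. inj (frechet_derivative \<phi> (at q)))"

definition smooth_surface :: "(real^3) set \<Rightarrow> bool" where
  "smooth_surface M \<longleftrightarrow> (\<forall>p\<in>M. \<exists>W \<phi>. local_parametrization M W \<phi> \<and> p \<in> \<phi> ` W)"

text \<open>The quotient of the determinants of the second and the first fundamental form.\<close>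

definition gaussian_curvature :: "(real \<times> real \<Rightarrow> real^3) \<Rightarrow> real \<times> real \<Rightarrow> real" where
  "gaussian_curvature \<phi> q =
     (let a = partial_u \<phi> q; b = partial_v \<phi> q;
          N = cross3 a b /\<^sub>R norm (cross3 a b);
          E = a \<bullet> a; F = a \<bullet> b; G = b \<bullet> b;
          L = partial_u (partial_u \<phi>) q \<bullet> N;
          M = partial_u (partial_v \<phi>) q \<bullet> N;
          P = partial_v (partial_v \<phi>) q \<bullet> N
      in (L * P - M\<^sup>2) / (E * G - F\<^sup>2))"

text \<open>The curvature at a point of a surface does not depend on the parametrization, so that it is
  immaterial here that all parametrizations are considered.\<close>

definition positively_curved :: "(real^3) set \<Rightarrow> bool" where
  "positively_curved M \<longleftrightarrow>
     (\<forall>W \<phi>. local_parametrization M W \<phi> \<longrightarrow> (\<forall>q\<in>W. gaussian_curvature \<phi> q > 0))"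

definition smooth_convex_body :: "(real^3) set \<Rightarrow> bool" where
  "smooth_convex_body K \<longleftrightarrow>
     compact K \<and> convex K \<and> interior K \<noteq> {} \<and>
     smooth_surface (frontier K) \<and> positively_curved (frontier K)"

definition body_of_rotation :: "real \<Rightarrow> (real \<Rightarrow> real) \<Rightarrow> (real \<Rightarrow> real) \<Rightarrow> (real^3) set" where
  "body_of_rotation rinf f1 f2 =
     {p. let r = sqrt ((p $ 1)\<^sup>2 + (p $ 2)\<^sup>2) in r \<le> rinf \<and> f2 r \<le> p $ 3 \<and> p $ 3 \<le> f1 r}"

text \<open>Analyticity and derivatives are relative to \<open>S\<close>. For \<open>S = {0..<rinf}\<close> they are one-sided at
  \<open>0\<close>, and the values of \<open>f\<close> outside \<open>S\<close> are irrelevant.\<close>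

definition real_analytic_on :: "real set \<Rightarrow> (real \<Rightarrow> real) \<Rightarrow> bool" where
  "real_analytic_on S f \<longleftrightarrow>
     (\<forall>a\<in>S. \<exists>c. \<exists>\<rho>>0. \<forall>x\<in>S. \<bar>x - a\<bar> < \<rho> \<longrightarrow> (\<lambda>n. c n * (x - a) ^ n) sums f x)"

definition deriv_within :: "real set \<Rightarrow> (real \<Rightarrow> real) \<Rightarrow> real \<Rightarrow> real" where
  "deriv_within S f = (\<lambda>x. vector_derivative f (at x within S))"

definition support_function :: "(real^3) set \<Rightarrow> real^3 \<Rightarrow> real" where
  "support_function K v = (SUP x\<in>K. x \<bullet> v)"

definition h_fun :: "(real^3) set \<Rightarrow> real \<Rightarrow> real \<Rightarrow> real" where
  "h_fun K n m = support_function K (vector [sqrt n, 0, m])"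

definition e_fun :: "real \<Rightarrow> complex" where
  "e_fun t = exp (2 * of_real pi * \<i> * of_real t)"

definition r2 :: "nat \<Rightarrow> nat" where
  "r2 n = card {(a::int, b::int). a\<^sup>2 + b\<^sup>2 = int n}"

text \<open>The index set of the sum is finite, because \<open>m < 2 * M\<close> and \<open>n < U2 * m\<^sup>2\<close>.\<close>

definition exp_sum :: "(real^3) set \<Rightarrow> real \<Rightarrow> real \<Rightarrow> real \<Rightarrow> real \<Rightarrow> complex" where
  "exp_sum K R U1 U2 M =
     (\<Sum>(n, m) \<in> {(n::nat, m::nat). 0 < n \<and> 0 < m \<and>
           U1 \<le> real n / (real m)\<^sup>2 \<and> real n / (real m)\<^sup>2 < U2 \<and> M \<le> real m \<and> real m < 2 * M}.
        of_nat (r2 n) * e_fun (R * h_fun K (real n) (real m)))"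

end

theory Submission
  imports Defs "HOL-Computational_Algebra.Primes" "HOL-Library.Landau_Symbols"
begin

text \<open>Write \<open>h(n, m) = m H(n / m\<^sup>2)\<close>. Cauchy--Schwarz in \<open>n\<close>, with the mean square bound for
  \<open>r\<^sub>2\<close>, and van der Corput differencing in \<open>m\<close> with shifts \<open>d \<le> min(M, R\<^sup>1\<^sup>/\<^sup>2)\<close> reduce the claim to
  \<open>\<Sum>\<^sub>m \<bar>\<Sum>\<^sub>n e(R (h(n, m + d) - h(n, m)))\<bar> \<lesssim> M R\<^sup>3\<^sup>/\<^sup>4\<^sup>+\<^sup>\<epsilon>\<close> for each \<open>d\<close>. The second
  derivative of the phase in \<open>n\<close> has size \<open>R d \<bar>G'(u)\<bar> / M\<^sup>4\<close> with
  \<open>G = - 1 / (2 f'')\<close> and \<open>G' = f''' / (4 f' f''\<^sup>3)\<close>, which behaves like \<open>\<bar>u - u\<^sub>j\<bar>\<^sup>\<kappa>\<close> near \<open>u\<^sub>j\<close>. If it is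
  not small, the second derivative test suffices. Otherwise the phase is almost linear with slope
  close to \<open>- \<theta>\<close>, \<open>\<theta> = R G(u\<^sub>j) d / (m (m + d))\<close>. The Kuzmin--Landau inequality gives
  \<open>1 / \<parallel>\<theta>\<parallel>\<close>, and the \<open>m\<close> with \<open>\<theta>\<close> close to an integer \<open>\<nu>\<close> are counted by means of the
  integer \<open>\<nu> m (m + d)\<close>, which lies in a short interval around \<open>R G(u\<^sub>j) d\<close> and has
  \<open>\<lesssim> R\<^sup>\<epsilon>\<close> divisors.\<close>

section \<open>Divisors and sums of two squares\<close>

text \<open>The exponents come from one balance. Differencing bounds the mean square over
  \<open>n\<close> by about \<open>M * (M ^ 3 / D + M * R powr (3/4))\<close>, and the sum of the
  squares of \<open>r2\<close> is about \<open>M ^ 2\<close>. With \<open>D\<close> about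
  \<open>min M (sqrt R)\<close> the condition on \<open>M\<close> absorbs the diagonal term, and the
  root of the product is \<open>M ^ 2 * R powr (3/8)\<close>. The bound
  \<open>d \<le> sqrt R\<close> also keeps \<open>sqrt (R * d)\<close>, the main term of the second
  derivative test, below \<open>R powr (3/4)\<close>. The obstacle is uniformity in
  \<open>U\<close>. At distance \<open>U\<close> from \<open>u j\<close> the second derivative
  carries a factor \<open>V\<close> of size \<open>U powr \<kappa>\<close>. If
  \<open>\<kappa> < 0\<close> it may blow up, but \<open>U * sqrt V\<close> stays bounded because
  \<open>\<kappa> \<ge> -2\<close>. If \<open>\<kappa> > 0\<close>, then \<open>V\<close> may be so
  small that the term \<open>M ^ 2 / sqrt (V * R * d)\<close> of the test is too large for a single
  \<open>m\<close>. In that case \<open>f''\<close> is nonzero at the endpoint, so \<open>G\<close>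
  has a positive limit \<open>g\<close> with \<open>G - g\<close> of size \<open>U * V\<close>, and
  the saving comes from averaging over \<open>m\<close>. Divisors count the bad \<open>m\<close>
  well as long as \<open>U * sqrt V * M \<le> 1\<close>; beyond that the spacing of the values
  \<open>\<theta>\<close> is used instead.\<close>

lemma card_divisors_prime_power_mult_le:
  fixes p :: nat
  assumes "prime p" "m > 0" "\<not> p dvd m"
  shows "card {d. d dvd p ^ e * m} \<le> (e + 1) * card {d. d dvd m}"
proof -
  have sub: "{d. d dvd p ^ e * m} \<subseteq> (\<lambda>(i, d). p ^ i * d) ` ({..e} \<times> {d. d dvd m})"
  proof
    fix d assume "d \<in> {d. d dvd p ^ e * m}"
    then obtain a b where ab: "d = a * b" "a dvd p ^ e" "b dvd m"
      using division_decomp by blast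
    then obtain i where "i \<le> e" "a = p ^ i"
      using divides_primepow_nat[OF assms(1)] by blast
    then show "d \<in> (\<lambda>(i, d). p ^ i * d) ` ({..e} \<times> {d. d dvd m})"
      using ab by force
  qed
  have fin: "finite {d. d dvd m}" using assms by auto
  have "card {d. d dvd p ^ e * m} \<le> card ((\<lambda>(i, d). p ^ i * d) ` ({..e} \<times> {d. d dvd m}))"
    using fin by (intro card_mono sub) auto
  also have "\<dots> \<le> card ({..e} \<times> {d. d dvd m})"
    using fin by (intro card_image_le) auto
  finally show ?thesis by (simp add: card_cartesian_product)
qed

text \<open>Induction on \<open>n\<close>, splitting off the whole \<open>p\<close>-part for one
  prime divisor \<open>p\<close>. Only primes below \<open>Q\<close> cost a factor \<open>C\<close>,
  and each of them once, whatever its exponent.\<close>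

lemma divisor_bound_aux:
  fixes C Q \<epsilon> :: real
  assumes "\<epsilon> > 0" "C \<ge> 1"
    and small: "\<And>p e. prime p \<Longrightarrow> real e + 1 \<le> C * (real p powr \<epsilon>) ^ e"
    and large: "\<And>p e. prime p \<Longrightarrow> real p \<ge> Q \<Longrightarrow> real e + 1 \<le> (real p powr \<epsilon>) ^ e"
    and "n > 0"
  shows "real (card {d::nat. d dvd n}) \<le> C ^ card {p. prime p \<and> real p < Q \<and> p dvd n} * real n powr \<epsilon>"
  using \<open>n > 0\<close>
proof (induction n rule: less_induct)
  case (less n)
  show ?case
  proof (cases "n = 1")
    case True
    then show ?thesis using one_le_power[OF assms(2)] by simp
  next
    case False
    then obtain p where p: "prime p" "p dvd n" using prime_factor_nat by blast
    obtain m where m: "n = p ^ multiplicity p n * m" "\<not> p dvd m"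
      using multiplicity_decompose'[of n p] p less.prems by (metis neq0_conv not_prime_unit)
    define e where "e = multiplicity p n"
    have n: "n = p ^ e * m" using m e_def by simp
    have m0: "m > 0" using n less.prems by (cases m) auto
    have e0: "e > 0" using p less.prems unfolding e_def
      by (simp add: prime_multiplicity_gt_zero_iff prime_elem_multiplicity_eq_zero_iff)
    have "m < n" using n m0 e0 prime_gt_1_nat[OF p(1)]
      by (metis One_nat_def Suc_lessD mult.commute n_less_m_mult_n one_less_power)
    note IH = less.IH[OF this m0]
    let ?P = "\<lambda>n. {p. prime p \<and> real p < Q \<and> p dvd n}"
    have finP: "finite (?P n)" using less.prems
      by (rule_tac finite_subset[of _ "{d. d dvd n}"]) auto
    have finPm: "finite (?P m)" using m0
      by (rule_tac finite_subset[of _ "{d. d dvd m}"]) auto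
    have key: "(real e + 1) * C ^ card (?P m) \<le> C ^ card (?P n) * (real p powr \<epsilon>) ^ e"
    proof (cases "real p < Q")
      case True
      have "insert p (?P m) \<subseteq> ?P n" using True p n by auto
      then have "card (insert p (?P m)) \<le> card (?P n)" using finP by (rule card_mono[rotated])
      then have "Suc (card (?P m)) \<le> card (?P n)" using m(2) finPm by simp
      then have "C ^ Suc (card (?P m)) \<le> C ^ card (?P n)" using assms(2) by (rule power_increasing)
      then have "C * C ^ card (?P m) * (real p powr \<epsilon>) ^ e \<le> C ^ card (?P n) * (real p powr \<epsilon>) ^ e"
        by (intro mult_right_mono) auto
      moreover have "(real e + 1) * C ^ card (?P m) \<le> C * (real p powr \<epsilon>) ^ e * C ^ card (?P m)"
        using small[OF p(1), of e] assms(2) by (intro mult_right_mono) auto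
      ultimately show ?thesis by (simp add: mult_ac)
    next
      case False
      have "?P m \<subseteq> ?P n" using n by auto
      then have "C ^ card (?P m) \<le> C ^ card (?P n)" using assms(2) finP
        by (intro power_increasing card_mono) auto
      moreover have "real e + 1 \<le> (real p powr \<epsilon>) ^ e" using large p False by simp
      ultimately have "(real e + 1) * C ^ card (?P m) \<le> (real p powr \<epsilon>) ^ e * C ^ card (?P n)"
        using assms(2) by (intro mult_mono) auto
      then show ?thesis by (simp add: mult_ac)
    qed
    have "card {d. d dvd n} \<le> (e + 1) * card {d. d dvd m}"
      unfolding n by (rule card_divisors_prime_power_mult_le) (use p m0 m in auto)
    then have "real (card {d. d dvd n}) \<le> real ((e + 1) * card {d. d dvd m})"
      by (rule of_nat_mono)
    also have "\<dots> \<le> (real e + 1) * (C ^ card (?P m) * real m powr \<epsilon>)"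
      using mult_left_mono[OF IH, of "real e + 1"]
      by (simp only: of_nat_mult of_nat_add of_nat_1 mult_ac)
    also have "\<dots> \<le> C ^ card (?P n) * (real p powr \<epsilon>) ^ e * real m powr \<epsilon>"
      using mult_right_mono[OF key, of "real m powr \<epsilon>"] by (simp add: mult_ac)
    also have "\<dots> = C ^ card (?P n) * real n powr \<epsilon>"
      unfolding n using p(1) by (simp add: powr_mult powr_power[symmetric] prime_gt_0_nat
        powr_powr powr_realpow[symmetric] mult_ac)
    finally show ?thesis .
  qed
qed

lemma divisor_bound:
  fixes \<epsilon> :: real
  assumes "\<epsilon> > 0"
  obtains C where "C \<ge> 1" "\<And>n. n > 0 \<Longrightarrow> real (card {d::nat. d dvd n}) \<le> C * real n powr \<epsilon>"
proof -
  \<comment> \<open>Bernoulli gives growth in the exponent with slope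
    \<open>\<epsilon> * ln 2\<close>, which \<open>C\<close> raises to slope at least 1. For
    \<open>p \<ge> Q\<close> no such factor is needed, as
    \<open>p powr \<epsilon> \<ge> 2\<close>.\<close>
  define C where "C = max 1 (1 / (\<epsilon> * ln 2))"
  define Q :: real where "Q = 2 powr (1 / \<epsilon>)"
  have C1: "C \<ge> 1" unfolding C_def by simp
  have small: "real e + 1 \<le> C * (real p powr \<epsilon>) ^ e" if "prime p" for p e
  proof -
    have "1 + real e * (\<epsilon> * ln 2) \<le> (1 + \<epsilon> * ln 2) ^ e"
      by (rule Bernoulli_inequality) (use assms in \<open>auto intro: order_trans[of _ 0]\<close>)
    also have "\<dots> \<le> (2 powr \<epsilon>) ^ e"
      by (intro power_mono) (use assms in \<open>auto simp: powr_def intro: exp_ge_add_one_self\<close>)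
    also have "\<dots> \<le> (real p powr \<epsilon>) ^ e"
      using prime_ge_2_nat[OF that] assms by (intro power_mono powr_mono2) auto
    finally have *: "1 + real e * (\<epsilon> * ln 2) \<le> (real p powr \<epsilon>) ^ e" .
    have "1 \<le> C * (\<epsilon> * ln 2)"
      using assms by (auto simp: C_def max_def field_simps)
    then have "real e * 1 \<le> real e * (C * (\<epsilon> * ln 2))" by (intro mult_left_mono) auto
    then have "real e + 1 \<le> C * (1 + real e * (\<epsilon> * ln 2))" using C1 by (simp add: algebra_simps)
    also have "\<dots> \<le> C * (real p powr \<epsilon>) ^ e" using * C1 by (intro mult_left_mono) auto
    finally show ?thesis .
  qed
  have large: "real e + 1 \<le> (real p powr \<epsilon>) ^ e" if "prime p" "real p \<ge> Q" for p e
  proof -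
    have "2 = Q powr \<epsilon>" unfolding Q_def using assms by (simp add: powr_powr)
    also have "\<dots> \<le> real p powr \<epsilon>" using that assms by (intro powr_mono2) (auto simp: Q_def)
    finally have "2 ^ e \<le> (real p powr \<epsilon>) ^ e" by (intro power_mono) auto
    moreover have "real e + 1 \<le> 2 ^ e" using Bernoulli_inequality[of "1::real" e] by simp
    ultimately show ?thesis by linarith
  qed
  define K where "K = card {p::nat. real p < Q}"
  have fin: "finite {p::nat. real p < Q}"
    by (rule finite_subset[of _ "{..nat \<lceil>Q\<rceil>}"]) (auto, linarith)
  show ?thesis
  proof (rule that[of "C ^ K"])
    show "1 \<le> C ^ K" using C1 by (rule one_le_power)
    fix n :: nat assume "n > 0"
    have "real (card {d. d dvd n}) \<le> C ^ card {p. prime p \<and> real p < Q \<and> p dvd n} * real n powr \<epsilon>"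
      by (rule divisor_bound_aux[OF assms C1 small large \<open>n > 0\<close>])
    also have "\<dots> \<le> C ^ K * real n powr \<epsilon>"
      unfolding K_def using C1 by (intro mult_right_mono power_increasing card_mono fin) auto
    finally show "real (card {d. d dvd n}) \<le> C ^ K * real n powr \<epsilon>" .
  qed
qed

lemma card_int_divisors: 
  fixes k :: int assumes "k \<noteq> 0"
  shows "finite {d. d dvd k}" "card {d. d dvd k} \<le> 2 * card {d. d dvd nat \<bar>k\<bar>}"
proof -
  let ?A = "{d. d dvd nat \<bar>k\<bar>}"
  have fin: "finite ?A" using assms by (intro finite_divisors_nat) auto
  have sub: "{d. d dvd k} \<subseteq> int ` ?A \<union> (\<lambda>d. - int d) ` ?A"
  proof
    fix d assume "d \<in> {d. d dvd k}"
    then have "nat \<bar>d\<bar> \<in> ?A" by (simp add: nat_dvd_iff)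
    moreover have "d = int (nat \<bar>d\<bar>) \<or> d = - int (nat \<bar>d\<bar>)" by auto
    ultimately show "d \<in> int ` ?A \<union> (\<lambda>d. - int d) ` ?A" by blast
  qed
  show "finite {d. d dvd k}" by (rule finite_subset[OF sub]) (use fin in auto)
  have "card {d. d dvd k} \<le> card (int ` ?A \<union> (\<lambda>d. - int d) ` ?A)"
    using fin by (intro card_mono sub) auto
  also have "\<dots> \<le> card (int ` ?A) + card ((\<lambda>d. - int d) ` ?A)" by (rule card_Un_le)
  also have "\<dots> \<le> card ?A + card ?A" using fin by (intro add_mono card_image_le)
  finally show "card {d. d dvd k} \<le> 2 * card ?A" by simp
qed

section \<open>The second moment of the number of representations as a sum of two squares\<close>

lemma finite_two_squares: "finite {(a::int, b::int). a\<^sup>2 + b\<^sup>2 = int n}"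
proof (rule finite_subset)
  have *: "\<bar>a\<bar> \<le> int n" if "a\<^sup>2 + b\<^sup>2 = int n" for a b :: int
  proof -
    have "\<bar>a\<bar> \<le> \<bar>a\<bar>\<^sup>2"
      using mult_right_mono[of 1 "\<bar>a\<bar>" "\<bar>a\<bar>"] by (cases "a = 0") (auto simp: power2_eq_square)
    also have "\<dots> = a\<^sup>2" by simp
    also have "\<dots> \<le> int n" using that zero_le_power2[of b] by linarith
    finally show ?thesis .
  qed
  show "{(a, b). a\<^sup>2 + b\<^sup>2 = int n} \<subseteq> {- int n..int n} \<times> {- int n..int n}"
  proof clarify
    fix a b :: int assume "a\<^sup>2 + b\<^sup>2 = int n"
    then have "\<bar>a\<bar> \<le> int n" "\<bar>b\<bar> \<le> int n" using *[of a b] *[of b a] by auto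
    then show "a \<in> {- int n..int n} \<and> b \<in> {- int n..int n}" by auto
  qed
qed auto

lemma sum_r2_square_eq:
  "(\<Sum>n\<le>N. (r2 n)\<^sup>2) = card {((a::int, b::int), (c::int, d::int)). a\<^sup>2 + b\<^sup>2 = c\<^sup>2 + d\<^sup>2 \<and> a\<^sup>2 + b\<^sup>2 \<le> int N}"
proof -
  let ?R = "\<lambda>n. {(a::int, b::int). a\<^sup>2 + b\<^sup>2 = int n}"
  have "(\<Sum>n\<le>N. (r2 n)\<^sup>2) = (\<Sum>n\<le>N. card (?R n \<times> ?R n))"
    by (simp add: r2_def card_cartesian_product power2_eq_square)
  also have "\<dots> = card (\<Union>n\<le>N. ?R n \<times> ?R n)"
  proof (rule card_UN_disjoint[symmetric])
    show "\<forall>n\<in>{..N}. finite (?R n \<times> ?R n)" using finite_two_squares by (intro ballI finite_cartesian_product)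
  qed auto
  also have "(\<Union>n\<le>N. ?R n \<times> ?R n) = {((a, b), (c, d)). a\<^sup>2 + b\<^sup>2 = c\<^sup>2 + d\<^sup>2 \<and> a\<^sup>2 + b\<^sup>2 \<le> int N}"
  proof -
    have "\<exists>n\<in>{..N}. c\<^sup>2 + d\<^sup>2 = int n" if "c\<^sup>2 + d\<^sup>2 \<le> int N" for c d :: int
      using that by (intro bexI[of _ "nat (c\<^sup>2 + d\<^sup>2)"]) auto
    then show ?thesis by auto
  qed
  finally show ?thesis .
qed

text \<open>The divisor \<open>d - b\<close> of \<open>k\<close> determines the pair: as
  \<open>k\<close> is nonzero, it also fixes the cofactor \<open>d + b\<close>. The factor 2
  accounts for negative divisors.\<close>

lemma card_difference_of_squares_le:
  fixes k :: int
  assumes "k \<noteq> 0"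
  shows "finite {(b::int, d). d\<^sup>2 - b\<^sup>2 = k}" "card {(b::int, d). d\<^sup>2 - b\<^sup>2 = k} \<le> 2 * card {d. d dvd nat \<bar>k\<bar>}"
proof -
  let ?S = "{(b::int, d). d\<^sup>2 - b\<^sup>2 = k}"
  let ?f = "\<lambda>(b::int, d). d - b"
  have img: "?f ` ?S \<subseteq> {d. d dvd k}"
    by (auto simp: power2_eq_square square_diff_square_factored)
  have inj: "inj_on ?f ?S"
  proof (rule inj_onI, clarify)
    fix b d b' d' :: int
    assume *: "k = d\<^sup>2 - b\<^sup>2" "d'\<^sup>2 - b'\<^sup>2 = d\<^sup>2 - b\<^sup>2" "d - b = d' - b'"
    have "(d - b) * (d + b) = (d - b) * (d' + b')"
    proof -
      have "(d - b) * (d + b) = d\<^sup>2 - b\<^sup>2" "(d' - b') * (d' + b') = d'\<^sup>2 - b'\<^sup>2"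
        by (simp_all add: power2_eq_square algebra_simps)
      then show ?thesis using * by simp
    qed
    moreover have "d - b \<noteq> 0" using * assms by auto
    ultimately have "d + b = d' + b'" by simp
    then show "b = b' \<and> d = d'" using *(3) by auto
  qed
  show "finite ?S" using inj img card_int_divisors(1)[OF assms] by (metis finite_imageD finite_subset)
  have "card ?S \<le> card {d. d dvd k}"
    by (rule card_inj_on_le[OF inj img card_int_divisors(1)[OF assms]])
  also have "\<dots> \<le> 2 * card {d. d dvd nat \<bar>k\<bar>}" by (rule card_int_divisors(2)[OF assms])
  finally show "card ?S \<le> 2 * card {d. d dvd nat \<bar>k\<bar>}" .
qed

text \<open>The equation \<open>a^2 + b^2 = c^2 + d^2\<close> is read as
  \<open>d^2 - b^2 = a^2 - c^2\<close>. For \<open>a^2 \<noteq> c^2\<close> the divisor bound limits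
  the pairs \<open>(b, d)\<close>. The case \<open>a^2 = c^2\<close> has only about
  \<open>sqrt N\<close> pairs \<open>(a, c)\<close>, each with about \<open>sqrt N\<close> pairs
  \<open>(b, d)\<close>.\<close>

lemma r2_mean_square:
  fixes \<epsilon> :: real
  assumes "\<epsilon> > 0"
  obtains C where "C \<ge> 1" "\<And>N. N \<ge> 1 \<Longrightarrow> (\<Sum>n\<le>N. (real (r2 n))\<^sup>2) \<le> C * real N powr (1 + \<epsilon>)"
proof -
  obtain C0 where C0: "C0 \<ge> 1" "\<And>n. n > 0 \<Longrightarrow> real (card {d::nat. d dvd n}) \<le> C0 * real n powr \<epsilon>"
    using divisor_bound[OF assms] by blast
  show ?thesis
  proof (rule that[of "54 * C0"])
    \<comment> \<open>\<open>54 = 9 * 6\<close>: the coordinates range over \<open>I\<close> with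
      squared size at most \<open>9 * N\<close>, and \<open>6 = 4 + 2\<close> collects the diagonal
      and the off-diagonal pairs.\<close>
    show "54 * C0 \<ge> 1" using C0 by simp
    fix N :: nat assume N: "N \<ge> 1"
    define s where "s = \<lfloor>sqrt (real N)\<rfloor>"
    define I where "I = {-s..s}"
    have s1: "s \<ge> 1" using N unfolding s_def by (simp add: le_floor_iff)
    have inI: "x \<in> I" if "x\<^sup>2 \<le> int N" for x
    proof -
      have "\<bar>real_of_int x\<bar> \<le> sqrt (real N)"
        using that by (metis of_int_le_iff of_int_of_nat_eq of_int_power real_le_rsqrt real_sqrt_abs real_sqrt_le_iff)
      then show ?thesis unfolding I_def s_def by (simp add: abs_le_iff le_floor_iff) linarith
    qed
    have cardI: "card I = nat (2 * s + 1)" "finite I" unfolding I_def using s1 by auto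
    have sN: "(real_of_int s)\<^sup>2 \<le> real N"
    proof -
      have "real_of_int s \<le> sqrt (real N)" unfolding s_def by simp
      then have "(real_of_int s)\<^sup>2 \<le> (sqrt (real N))\<^sup>2" using s1 by (intro power_mono) auto
      then show ?thesis by simp
    qed
    have I9: "(real (card I))\<^sup>2 \<le> 9 * real N"
    proof -
      have "real (card I) \<le> 3 * real_of_int s" using s1 unfolding cardI by simp
      then have "(real (card I))\<^sup>2 \<le> (3 * real_of_int s)\<^sup>2" by (intro power_mono) auto
      then show ?thesis using sN by (simp add: power_mult_distrib)
    qed
    let ?Q = "{((a::int, b::int), (c::int, d::int)). a\<^sup>2 + b\<^sup>2 = c\<^sup>2 + d\<^sup>2 \<and> a\<^sup>2 + b\<^sup>2 \<le> int N}"
    let ?B = "\<lambda>(a::int, c::int). {(b, d). d\<^sup>2 - b\<^sup>2 = a\<^sup>2 - c\<^sup>2} \<inter> I \<times> I"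
    let ?g = "\<lambda>((a::int, c::int), (b::int, d::int)). ((a, b), (c, d))"
    have sub: "?Q \<subseteq> ?g ` (Sigma (I \<times> I) ?B)"
    proof clarify
      fix a b c d :: int assume *: "a\<^sup>2 + b\<^sup>2 = c\<^sup>2 + d\<^sup>2" "a\<^sup>2 + b\<^sup>2 \<le> int N"
      have "a\<^sup>2 \<ge> 0" "b\<^sup>2 \<ge> 0" "c\<^sup>2 \<ge> 0" "d\<^sup>2 \<ge> 0" by auto
      then have "a\<^sup>2 \<le> int N" "b\<^sup>2 \<le> int N" "c\<^sup>2 \<le> int N" "d\<^sup>2 \<le> int N" using * by linarith+
      then have "a \<in> I" "b \<in> I" "c \<in> I" "d \<in> I" by (auto intro!: inI)
      then have "((a, c), (b, d)) \<in> Sigma (I \<times> I) ?B" using * by auto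
      then show "((a, b), c, d) \<in> ?g ` (Sigma (I \<times> I) ?B)" by force
    qed
    have fS: "finite (Sigma (I \<times> I) ?B)" using cardI by (intro finite_SigmaI) auto
    have "card ?Q \<le> card (Sigma (I \<times> I) ?B)"
      using card_mono[OF finite_imageI[OF fS] sub] card_image_le[OF fS, of ?g] by linarith
    also have "\<dots> = (\<Sum>x\<in>I \<times> I. card (?B x))"
      using cardI by (intro card_SigmaI) auto
    finally have "real (card ?Q) \<le> real (\<Sum>x\<in>I \<times> I. card (?B x))" by (rule of_nat_mono)
    then have *: "real (card ?Q) \<le> (\<Sum>x\<in>I \<times> I. real (card (?B x)))" by (simp only: of_nat_sum)
    let ?Diag = "{(a, c) \<in> I \<times> I. a\<^sup>2 = c\<^sup>2}"
    have sq_eq: "{(b::int, d) \<in> I \<times> I. b\<^sup>2 = d\<^sup>2} \<subseteq> (\<lambda>b. (b, b)) ` I \<union> (\<lambda>b. (b, -b)) ` I"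
      by (auto simp: power2_eq_iff)
    have card_diag: "card {(b::int, d) \<in> I \<times> I. b\<^sup>2 = d\<^sup>2} \<le> 2 * card I"
    proof -
      have "card {(b::int, d) \<in> I \<times> I. b\<^sup>2 = d\<^sup>2} \<le> card ((\<lambda>b. (b, b)) ` I \<union> (\<lambda>b. (b, -b)) ` I)"
        using cardI by (intro card_mono sq_eq) auto
      also have "\<dots> \<le> card ((\<lambda>b. (b, b)) ` I) + card ((\<lambda>b. (b, -b)) ` I)" by (rule card_Un_le)
      also have "\<dots> \<le> card I + card I" using cardI by (intro add_mono card_image_le) auto
      finally show ?thesis by simp
    qed
    have d0: "real (card (?B x)) \<le> 2 * real (card I)" if "x \<in> ?Diag" for x
    proof -
      have "?B x = {(b::int, d) \<in> I \<times> I. b\<^sup>2 = d\<^sup>2}" using that by auto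
      then have "card (?B x) \<le> 2 * card I" using card_diag by simp
      from of_nat_mono[OF this, where 'a = real] show ?thesis by (simp only: of_nat_mult of_nat_numeral)
    qed
    have d1: "real (card (?B x)) \<le> 2 * (C0 * real N powr \<epsilon>)" if "x \<in> I \<times> I - ?Diag" for x
    proof -
      obtain a c where ac: "x = (a, c)" by (cases x)
      then have x: "x = (a, c)" "a\<^sup>2 \<noteq> c\<^sup>2" "a \<in> I" "c \<in> I" using that by auto
      let ?k = "a\<^sup>2 - c\<^sup>2"
      have k: "?k \<noteq> 0" using x by simp
      have "s\<^sup>2 \<le> int N" using sN by (metis of_int_le_iff of_int_of_nat_eq of_int_power)
      moreover have "a\<^sup>2 \<le> s\<^sup>2" "c\<^sup>2 \<le> s\<^sup>2" using x s1 unfolding I_def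
        by (auto intro!: abs_le_square_iff[THEN iffD1])
      moreover have "a\<^sup>2 \<ge> 0" "c\<^sup>2 \<ge> 0" by auto
      ultimately have kN: "\<bar>?k\<bar> \<le> int N" by linarith
      have "card (?B x) \<le> card {(b::int, d). d\<^sup>2 - b\<^sup>2 = ?k}"
        unfolding x using card_difference_of_squares_le(1)[OF k] by (intro card_mono) auto
      also have "\<dots> \<le> 2 * card {d. d dvd nat \<bar>?k\<bar>}" by (rule card_difference_of_squares_le(2)[OF k])
      finally have "card (?B x) \<le> 2 * card {d. d dvd nat \<bar>?k\<bar>}" .
      from of_nat_mono[OF this, where 'a = real]
      have "real (card (?B x)) \<le> 2 * real (card {d. d dvd nat \<bar>?k\<bar>})" by (simp only: of_nat_mult of_nat_numeral)
      also have "\<dots> \<le> 2 * (C0 * real (nat \<bar>?k\<bar>) powr \<epsilon>)"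
        using k by (intro mult_left_mono C0(2)) auto
      also have "\<dots> \<le> 2 * (C0 * real N powr \<epsilon>)"
      proof -
        have "real (nat \<bar>?k\<bar>) \<le> real N" using kN by (intro of_nat_mono) linarith
        then show ?thesis using C0(1) assms by (intro mult_left_mono powr_mono2) auto
      qed
      finally show ?thesis .
    qed
    have N1: "real N powr \<epsilon> \<ge> 1" using N assms by (simp add: ge_one_powr_ge_zero)
    have "(\<Sum>x\<in>I \<times> I. real (card (?B x))) = (\<Sum>x\<in>?Diag. real (card (?B x))) + (\<Sum>x\<in>I \<times> I - ?Diag. real (card (?B x)))"
      using cardI by (subst sum.subset_diff[of ?Diag]) auto
    also have "\<dots> \<le> real (card ?Diag) * (2 * real (card I)) + real (card (I \<times> I - ?Diag)) * (2 * (C0 * real N powr \<epsilon>))"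
      by (intro add_mono sum_bounded_above d0 d1)
    also have "\<dots> \<le> (2 * real (card I)) * (2 * real (card I)) + real (card (I \<times> I)) * (2 * (C0 * real N powr \<epsilon>))"
      using cardI card_diag C0(1) by (intro add_mono mult_right_mono of_nat_mono card_mono) auto
    also have "\<dots> = (real (card I))\<^sup>2 * (4 + 2 * (C0 * real N powr \<epsilon>))"
      by (simp add: card_cartesian_product power2_eq_square algebra_simps)
    also have "\<dots> \<le> (9 * real N) * (4 + 2 * (C0 * real N powr \<epsilon>))"
      using I9 C0(1) by (intro mult_right_mono) auto
    also have "\<dots> \<le> (9 * real N) * (6 * (C0 * real N powr \<epsilon>))"
      using mult_mono[of 1 C0 1 "real N powr \<epsilon>"] C0(1) N1 by (intro mult_left_mono) auto
    also have "\<dots> = 54 * C0 * real N powr (1 + \<epsilon>)" using N by (simp add: powr_add)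
    finally have "(\<Sum>x\<in>I \<times> I. real (card (?B x))) \<le> 54 * C0 * real N powr (1 + \<epsilon>)" .
    moreover have "(\<Sum>n\<le>N. (real (r2 n))\<^sup>2) = real (card ?Q)"
      by (simp only: sum_r2_square_eq[symmetric] of_nat_sum of_nat_power)
    ultimately show "(\<Sum>n\<le>N. (real (r2 n))\<^sup>2) \<le> 54 * C0 * real N powr (1 + \<epsilon>)" using * by linarith
  qed
qed

section \<open>One-dimensional exponential sums\<close>

lemma e_fun_eq_cis: "e_fun t = cis (2 * pi * t)"
  unfolding e_fun_def cis_conv_exp by (simp add: mult_ac)

lemma norm_e_fun [simp]: "norm (e_fun t) = 1"
  by (simp add: e_fun_eq_cis)

lemma e_fun_add: "e_fun (s + t) = e_fun s * e_fun t"
  by (simp add: e_fun_eq_cis cis_mult distrib_left)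

lemma e_fun_minus: "e_fun (- t) = cnj (e_fun t)"
  by (simp add: e_fun_eq_cis cis_cnj)

lemma e_fun_diff: "e_fun (s - t) = e_fun s * cnj (e_fun t)"
  using e_fun_add[of s "- t"] by (simp add: e_fun_minus)

lemma e_fun_of_int: "e_fun (of_int k) = 1"
  unfolding e_fun_eq_cis by (simp add: complex_eq_iff cos_int_2pin sin_int_2pin)

lemma norm_sum_e_fun_le: "norm (\<Sum>n\<in>A. e_fun (F n)) \<le> real (card A)"
  using norm_sum[of "\<lambda>n. e_fun (F n)" A] by simp

text \<open>The real part does not depend on \<open>t\<close>, so only the cotangent contributes to
  the variation of these numbers.\<close>

lemma inverse_one_minus_e_fun:
  assumes "sin (pi * t) \<noteq> 0"
  shows "inverse (1 - e_fun t) = Complex (1/2) (cot (pi * t) / 2)"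
proof -
  have "(1 - e_fun t) * Complex (1/2) (cot (pi * t) / 2) = 1"
  proof -
    have c: "cos (2 * pi * t) = 1 - 2 * (sin (pi * t))\<^sup>2" "sin (2 * pi * t) = 2 * sin (pi * t) * cos (pi * t)"
      using cos_double_sin[of "pi * t"] sin_double[of "pi * t"] by (simp_all add: mult_ac)
    have k: "cot (pi * t) * sin (pi * t) = cos (pi * t)" using assms by (simp add: cot_def)
    have "(sin (pi * t))\<^sup>2 + sin (pi * t) * cos (pi * t) * cot (pi * t) = (sin (pi * t))\<^sup>2 + (cos (pi * t))\<^sup>2"
      using k by (simp add: power2_eq_square mult_ac)
    then have 1: "(sin (pi * t))\<^sup>2 + sin (pi * t) * cos (pi * t) * cot (pi * t) = 1" by simp
    have 2: "(sin (pi * t))\<^sup>2 * cot (pi * t) = sin (pi * t) * cos (pi * t)"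
      using k by (simp add: power2_eq_square mult_ac)
    have r: "Re (e_fun t) = 1 - 2 * (sin (pi * t))\<^sup>2" "Im (e_fun t) = 2 * sin (pi * t) * cos (pi * t)"
      using c by (simp_all add: e_fun_eq_cis)
    show ?thesis unfolding complex_eq_iff times_complex.sel minus_complex.sel complex.sel r
      using 1 2 by (simp add: algebra_simps)
  qed
  then show ?thesis by (rule inverse_unique)
qed

text \<open>Jordan's inequality: concavity puts the sine above its chord from 0 to
  \<open>pi / 2\<close>.\<close>

lemma sin_pi_ge:
  assumes "0 \<le> x" "x \<le> 1/2"
  shows "sin (pi * x) \<ge> 2 * x"
proof -
  have "concave_on {0..pi} sin"
    using sin_gt_zero
    by (intro f''_le0_imp_concave[where f' = cos and f'' = "\<lambda>x. - sin x"])
       (auto intro!: derivative_eq_intros simp: sin_ge_zero)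
  then have "sin ((1 - 2 * x) *\<^sub>R 0 + (2 * x) *\<^sub>R (pi / 2)) \<ge> (1 - 2 * x) * sin 0 + 2 * x * sin (pi / 2)"
    using assms by (intro concave_onD) auto
  then show ?thesis by (simp add: mult_ac)
qed

text \<open>Partial summation with the weights \<open>inverse (1 - e_fun (F (n + 1) - F n))\<close>, whose variation
  telescopes because the cotangent is monotone.\<close>

lemma kuzmin_landau_aux:
  fixes F :: "nat \<Rightarrow> real" and k :: int
  assumes "l \<le> h" and \<delta>: "0 < \<delta>" "\<delta> \<le> 1/2"
    and range: "\<And>n. l \<le> n \<Longrightarrow> n < h \<Longrightarrow> real_of_int k + \<delta> \<le> F (Suc n) - F n \<and> F (Suc n) - F n \<le> real_of_int k + 1 - \<delta>"
    and mono: "\<And>n. l \<le> n \<Longrightarrow> Suc n < h \<Longrightarrow> F (Suc n) - F n \<le> F (Suc (Suc n)) - F (Suc n)"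
  shows "norm (\<Sum>n=l..h. e_fun (F n)) \<le> 2 / \<delta>"
proof (cases "l = h")
  case True
  then show ?thesis using \<delta> by (simp add: field_simps)
next
  case False
  then have "l < h" using assms by simp
  define z where "z n = F (Suc n) - F n - real_of_int k" for n
  define c where "c n = inverse (1 - e_fun (z n))" for n
  define ct where "ct n = cot (pi * z n)" for n
  have z: "\<delta> \<le> z n" "z n \<le> 1 - \<delta>" if "l \<le> n" "n < h" for n using range[OF that] by (auto simp: z_def)
  have zm: "z n \<le> z (Suc n)" if "l \<le> n" "Suc n < h" for n using mono[OF that] by (simp add: z_def)
  have sin_ge: "sin (pi * z n) \<ge> 2 * \<delta>" if "l \<le> n" "n < h" for n
  proof (cases "z n \<le> 1/2")
    case True
    then show ?thesis using sin_pi_ge[of "z n"] z[OF that] \<delta> by linarith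
  next
    case False
    have "sin (pi * (1 - z n)) = sin (pi * z n)" by (simp add: right_diff_distrib sin_diff)
    moreover have "2 * (1 - z n) \<le> sin (pi * (1 - z n))"
      using z[OF that] \<delta> False by (intro sin_pi_ge) auto
    ultimately have "2 * (1 - z n) \<le> sin (pi * z n)" by (simp only:)
    moreover have "2 * \<delta> \<le> 2 * (1 - z n)" using z[OF that] by simp
    ultimately show ?thesis by (rule order_trans[rotated])
  qed
  have sin0: "sin (pi * z n) \<noteq> 0" if "l \<le> n" "n < h" for n using sin_ge[OF that] \<delta> by linarith
  have c_eq: "c n = Complex (1/2) (ct n / 2)" if "l \<le> n" "n < h" for n
    unfolding c_def ct_def by (rule inverse_one_minus_e_fun[OF sin0[OF that]])
  have ct_le: "\<bar>ct n\<bar> \<le> 1 / (2 * \<delta>)" if "l \<le> n" "n < h" for n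
  proof -
    have "\<bar>ct n\<bar> = \<bar>cos (pi * z n)\<bar> / sin (pi * z n)" unfolding ct_def cot_def
      using sin_ge[OF that] \<delta> by simp
    also have "\<dots> \<le> 1 / (2 * \<delta>)" using sin_ge[OF that] \<delta> by (intro frac_le) auto
    finally show ?thesis .
  qed
  have c_le: "norm (c n) \<le> 1/2 + 1 / (4 * \<delta>)" if "l \<le> n" "n < h" for n
    using cmod_le[of "c n"] c_eq[OF that] ct_le[OF that] by (simp add: field_simps)
  have ct_mono: "ct (Suc n) \<le> ct n" if "l \<le> n" "Suc n < h" for n
  proof -
    have a: "l \<le> n" "n < h" "l \<le> Suc n" using that by auto
    have s: "sin (pi * z n) > 0" "sin (pi * z (Suc n)) > 0"
      using sin_ge[OF a(1,2)] sin_ge[OF a(3) that(2)] \<delta> by linarith+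
    have "pi * (z (Suc n) - z n) \<le> pi * 1"
      using z[OF a(1,2)] z[OF a(3) that(2)] \<delta> by (intro mult_left_mono) auto
    then have "sin (pi * z (Suc n) - pi * z n) \<ge> 0"
      using zm[OF that] by (intro sin_ge_zero) (auto simp: right_diff_distrib)
    then have "sin (pi * z (Suc n)) * cos (pi * z n) \<ge> cos (pi * z (Suc n)) * sin (pi * z n)"
      by (simp add: sin_diff)
    then show ?thesis unfolding ct_def cot_def using s by (simp add: divide_le_eq le_divide_eq mult_ac)
  qed
  have step: "e_fun (F n) = c n * (e_fun (F n) - e_fun (F (Suc n)))" if "l \<le> n" "n < h" for n
  proof -
    have "F (Suc n) = F n + (z n + of_int k)" by (simp add: z_def)
    then have "e_fun (F (Suc n)) = e_fun (F n) * e_fun (z n)" by (simp add: e_fun_add e_fun_of_int)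
    moreover have "1 - e_fun (z n) \<noteq> 0"
    proof
      assume "1 - e_fun (z n) = 0"
      then have "c n = 0" by (simp add: c_def)
      then show False using c_eq[OF that] by (simp add: complex_eq_iff)
    qed
    ultimately show ?thesis by (simp add: c_def field_simps)
  qed
  \<comment> \<open>With the boundary term kept inside the norm, each new summand changes the
    expression only by \<open>(c (Suc m) - c m) * e_fun (F (Suc m))\<close>. Its norm is the
    decrement of \<open>ct / 2\<close>, so these norms telescope.\<close>
  have ind: "norm ((\<Sum>n=l..h'. e_fun (F n)) + c h' * e_fun (F (Suc h'))) \<le> 1/2 + 1 / (4 * \<delta>) + (ct l - ct h') / 2"
    if "l \<le> h'" "h' < h" for h'
    using that
  proof (induction h' rule: dec_induct)
    case base
    have "e_fun (F l) + c l * e_fun (F (Suc l)) = c l * e_fun (F l)"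
      using step[of l] base by (simp add: algebra_simps)
    then show ?case using c_le[of l] base by (simp add: norm_mult)
  next
    case (step m)
    have m: "l \<le> m" "m < h" "l \<le> Suc m" "Suc m < h" using step by auto
    have "(\<Sum>n=l..Suc m. e_fun (F n)) + c (Suc m) * e_fun (F (Suc (Suc m)))
        = (\<Sum>n=l..m. e_fun (F n)) + c m * e_fun (F (Suc m)) + (c (Suc m) - c m) * e_fun (F (Suc m))"
      using \<open>\<And>n. l \<le> n \<Longrightarrow> n < h \<Longrightarrow> e_fun (F n) = c n * (e_fun (F n) - e_fun (F (Suc n)))\<close>[OF m(3,4)] m
      by (simp add: algebra_simps)
    also have "norm \<dots> \<le> norm ((\<Sum>n=l..m. e_fun (F n)) + c m * e_fun (F (Suc m))) + norm (c (Suc m) - c m)"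
      by (rule norm_triangle_le) (simp add: norm_mult)
    also have "norm (c (Suc m) - c m) = (ct m - ct (Suc m)) / 2"
    proof -
      have "c (Suc m) - c m = Complex 0 ((ct (Suc m) - ct m) / 2)"
        using c_eq[OF m(1,2)] c_eq[OF m(3,4)] by (simp add: complex_eq_iff diff_divide_distrib)
      then show ?thesis using ct_mono[OF m(1,4)] by (simp add: cmod_def)
    qed
    finally show ?case using step.IH m by (simp add: diff_divide_distrib)
  qed
  obtain h' where h': "h = Suc h'" "l \<le> h'" using \<open>l < h\<close> by (cases h) auto
  \<comment> \<open>The last summand has no successor to be paired with. Its coefficient
    \<open>1 - c h'\<close> is the conjugate of \<open>c h'\<close>, because the real part is 1/2,
    and so it obeys the same bound.\<close>
  have "(\<Sum>n=l..h. e_fun (F n)) = ((\<Sum>n=l..h'. e_fun (F n)) + c h' * e_fun (F (Suc h'))) + (1 - c h') * e_fun (F h)"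
    using h' by (simp add: algebra_simps)
  also have "norm \<dots> \<le> (1/2 + 1 / (4 * \<delta>) + (ct l - ct h') / 2) + norm (1 - c h')"
    by (rule norm_triangle_le, rule add_mono[OF ind]) (use h' in \<open>auto simp: norm_mult\<close>)
  also have "norm (1 - c h') \<le> 1/2 + 1 / (4 * \<delta>)"
    using cmod_le[of "1 - c h'"] c_eq[of h'] ct_le[of h'] h' by (simp add: field_simps)
  also have "(ct l - ct h') / 2 \<le> 1 / (2 * \<delta>)"
    using ct_le[of l] ct_le[of h'] h' by (simp add: abs_le_iff field_simps)
  also have "1/2 + 1 / (4 * \<delta>) + 1 / (2 * \<delta>) + (1/2 + 1 / (4 * \<delta>)) \<le> 2 / \<delta>"
    using \<delta> by (simp add: field_simps)
  finally show ?thesis by simp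
qed

text \<open>By the mean value theorem each difference \<open>F (n + 1) - F n\<close> is a value of
  \<open>F'\<close> between \<open>n\<close> and \<open>n + 1\<close>, so monotonicity and range
  pass to the differences.\<close>

lemma kuzmin_landau:
  fixes F F' :: "real \<Rightarrow> real" and k :: int and l h :: nat
  assumes "0 < \<delta>" and "l \<le> h"
    and F: "\<And>x. real l \<le> x \<Longrightarrow> x \<le> real h \<Longrightarrow> (F has_real_derivative F' x) (at x)"
    and mono: "\<And>x y. real l \<le> x \<Longrightarrow> x \<le> y \<Longrightarrow> y \<le> real h \<Longrightarrow> F' x \<le> F' y"
    and lo: "real_of_int k + \<delta> \<le> F' (real l)" and hi: "F' (real h) \<le> real_of_int k + 1 - \<delta>"
  shows "norm (\<Sum>n=l..h. e_fun (F (real n))) \<le> 2 / \<delta>"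
proof (rule kuzmin_landau_aux[OF \<open>l \<le> h\<close> \<open>0 < \<delta>\<close>])
  have "F' (real l) \<le> F' (real h)" using mono \<open>l \<le> h\<close> by simp
  then show "\<delta> \<le> 1/2" using lo hi by linarith
  have mvt: "\<exists>x. real n < x \<and> x < real (Suc n) \<and> F (real (Suc n)) - F (real n) = F' x" if "l \<le> n" "n < h" for n
    using MVT2[of "real n" "real (Suc n)" F F'] F that by force
  fix n assume n: "l \<le> n"
  {
    assume "n < h"
    then obtain x where x: "real n < x" "x < real (Suc n)" "F (real (Suc n)) - F (real n) = F' x" using mvt n by blast
    then have "F' (real l) \<le> F' x" "F' x \<le> F' (real h)" using mono n \<open>n < h\<close> by auto
    then show "real_of_int k + \<delta> \<le> F (real (Suc n)) - F (real n) \<and> F (real (Suc n)) - F (real n) \<le> real_of_int k + 1 - \<delta>"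
      using lo hi x by linarith
  }
  assume "Suc n < h"
  then obtain x where x: "real n < x" "x < real (Suc n)" "F (real (Suc n)) - F (real n) = F' x" using mvt n Suc_lessD by blast
  obtain y where y: "real (Suc n) < y" "y < real (Suc (Suc n))" "F (real (Suc (Suc n))) - F (real (Suc n)) = F' y"
    using mvt[of "Suc n"] n \<open>Suc n < h\<close> by force
  have "F' x \<le> F' y" using x y n \<open>Suc n < h\<close> by (intro mono) auto
  then show "F (real (Suc n)) - F (real n) \<le> F (real (Suc (Suc n))) - F (real (Suc n))" using x y by simp
qed

text \<open>Only the least and the greatest element are compared: their images differ by at most
  \<open>w\<close>, which limits the length of \<open>A\<close>. It is applied to slopes near an
  integer, to the values \<open>\<theta>\<close>, and with \<open>g = real\<close> to integers in an
  interval.\<close>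

lemma card_le_of_separated:
  fixes A :: "nat set" and g :: "nat \<Rightarrow> real"
  assumes "finite A" "\<mu> > 0" "w \<ge> 0"
    and sep: "\<And>m n. m \<in> A \<Longrightarrow> n \<in> A \<Longrightarrow> m \<le> n \<Longrightarrow> \<mu> * (real n - real m) \<le> \<bar>g n - g m\<bar>"
    and range: "\<And>n. n \<in> A \<Longrightarrow> a \<le> g n \<and> g n \<le> a + w"
  shows "real (card A) \<le> w / \<mu> + 1"
proof (cases "A = {}")
  case False
  have "A \<subseteq> {Min A..Max A}" using assms(1) by auto
  then have "card A \<le> Suc (Max A) - Min A" using card_mono[of "{Min A..Max A}" A] by simp
  moreover have "Min A \<le> Max A" using False assms(1) by simp
  ultimately have "real (card A) \<le> real (Max A) - real (Min A) + 1" by linarith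
  moreover have "\<mu> * (real (Max A) - real (Min A)) \<le> \<bar>g (Max A) - g (Min A)\<bar>"
    using False assms(1) by (intro sep) auto
  moreover have "\<bar>g (Max A) - g (Min A)\<bar> \<le> w"
    using range[of "Max A"] range[of "Min A"] False assms(1) by (auto simp: abs_le_iff)
  ultimately have "\<mu> * (real (Max A) - real (Min A)) \<le> w" "real (card A) \<le> real (Max A) - real (Min A) + 1" by linarith+
  moreover have "real (Max A) - real (Min A) \<le> w / \<mu>"
    using \<open>\<mu> * (real (Max A) - real (Min A)) \<le> w\<close> assms(2) by (simp add: field_simps)
  ultimately show ?thesis by linarith
qed (use assms in auto)


text \<open>Van der Corput's argument: group the \<open>n\<close> by the integer part of
  \<open>F'\<close>. In a group, few \<open>n\<close> have \<open>F'\<close> within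
  \<open>\<delta>\<close> of an integer, since \<open>F'\<close> grows at rate at least
  \<open>\<mu>\<close>; the others form a block of consecutive \<open>n\<close> to which
  Kuzmin--Landau applies. The number of groups is governed by the total growth \<open>W\<close> of
  \<open>F'\<close>.\<close>

lemma second_derivative_test_aux:
  fixes F F' F'' :: "real \<Rightarrow> real" and l h :: nat
  assumes "0 < \<mu>" "\<mu> < 1/4" "l \<le> h"
    and F: "\<And>x. real l \<le> x \<Longrightarrow> x \<le> real h \<Longrightarrow> (F has_real_derivative F' x) (at x)"
    and F': "\<And>x. real l \<le> x \<Longrightarrow> x \<le> real h \<Longrightarrow> (F' has_real_derivative F'' x) (at x)"
    and bounds: "\<And>x. real l \<le> x \<Longrightarrow> x \<le> real h \<Longrightarrow> \<mu> \<le> F'' x \<and> F'' x \<le> \<alpha> * \<mu>"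
  shows "norm (\<Sum>n=l..h. e_fun (F (real n))) \<le> 5 * \<alpha> * sqrt \<mu> * (real h - real l) + 10 / sqrt \<mu>"
proof -
  \<comment> \<open>This choice balances the number \<open>\<delta> / \<mu>\<close> of points near
    an integer against the bound \<open>2 / \<delta>\<close> for the rest.\<close>
  define \<delta> where "\<delta> = sqrt \<mu>"
  have \<delta>: "0 < \<delta>" "\<delta> < 1/2" "\<delta>\<^sup>2 = \<mu>"
    using assms(1,2) real_sqrt_less_mono[of \<mu> "1/4"] by (auto simp: \<delta>_def real_sqrt_divide)
  have diff: "\<mu> * (y - x) \<le> F' y - F' x \<and> F' y - F' x \<le> \<alpha> * \<mu> * (y - x)"
    if "real l \<le> x" "x \<le> y" "y \<le> real h" for x y
  proof (cases "x = y")
    case False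
    then have "x < y" using that by simp
    then have "\<exists>z. x < z \<and> z < y \<and> F' y - F' x = (y - x) * F'' z"
      by (rule MVT2) (use that in \<open>auto intro!: F'\<close>)
    then obtain z where z: "x < z" "z < y" "F' y - F' x = (y - x) * F'' z" by blast
    then have "\<mu> \<le> F'' z" "F'' z \<le> \<alpha> * \<mu>" using bounds[of z] that by auto
    then show ?thesis using z mult_right_mono[of \<mu> "F'' z" "y - x"] mult_right_mono[of "F'' z" "\<alpha> * \<mu>" "y - x"]
      by (simp add: mult_ac)
  qed simp
  have mono: "F' x \<le> F' y" if "real l \<le> x" "x \<le> y" "y \<le> real h" for x y
  proof -
    have "0 \<le> \<mu> * (y - x)" using that assms(1) by simp
    then show ?thesis using diff[OF that] by linarith
  qed
  define W where "W = F' (real h) - F' (real l)"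
  have W: "0 \<le> W" "W \<le> \<alpha> * \<mu> * (real h - real l)"
    using mono[of "real l" "real h"] diff[of "real l" "real h"] \<open>l \<le> h\<close> by (auto simp: W_def)
  define K where "K = {\<lfloor>F' (real l)\<rfloor>..\<lfloor>F' (real h)\<rfloor>}"
  define A where "A k = {n \<in> {l..h}. \<lfloor>F' (real n)\<rfloor> = k}" for k
  have cardK: "real (card K) \<le> W + 2"
  proof -
    have "\<lfloor>F' (real l)\<rfloor> \<le> \<lfloor>F' (real h)\<rfloor>" using W(1) by (intro floor_mono) (simp add: W_def)
    then have "real (card K) = real_of_int \<lfloor>F' (real h)\<rfloor> - real_of_int \<lfloor>F' (real l)\<rfloor> + 1" unfolding K_def by simp
    also have "\<dots> \<le> W + 2" unfolding W_def by linarith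
    finally show ?thesis .
  qed
  have sep: "\<mu> * (real n - real m) \<le> \<bar>F' (real n) - F' (real m)\<bar>" if "m \<in> {l..h}" "n \<in> {l..h}" "m \<le> n" for m n
    using diff[of "real m" "real n"] that by auto
  have part: "norm (\<Sum>n\<in>A k. e_fun (F (real n))) \<le> 5 / \<delta>" for k
  proof -
    define B where "B = {n \<in> A k. real_of_int k + \<delta> \<le> F' (real n) \<and> F' (real n) \<le> real_of_int k + 1 - \<delta>}"
    define B1 where "B1 = {n \<in> A k. F' (real n) < real_of_int k + \<delta>}"
    define B2 where "B2 = {n \<in> A k. real_of_int k + 1 - \<delta> < F' (real n)}"
    have AB: "A k = B \<union> (B1 \<union> B2)" "B \<inter> (B1 \<union> B2) = {}" unfolding B_def B1_def B2_def by auto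
    have fin: "finite B" "finite B1" "finite B2" unfolding B_def B1_def B2_def A_def by auto
    have fl: "real_of_int k \<le> F' (real n)" "F' (real n) \<le> real_of_int k + 1" "n \<in> {l..h}" if "n \<in> A k" for n
      using that unfolding A_def by auto
    have "real (card B1) \<le> \<delta> / \<mu> + 1"
      by (rule card_le_of_separated[OF fin(2) assms(1), of _ "\<lambda>n. F' (real n)" "real_of_int k"])
         (use \<delta> fl sep in \<open>auto simp: B1_def intro: less_imp_le\<close>)
    moreover have "real (card B2) \<le> \<delta> / \<mu> + 1"
    proof (rule card_le_of_separated[OF fin(3) assms(1), of _ "\<lambda>n. F' (real n)" "real_of_int k + 1 - \<delta>"])
      show "real_of_int k + 1 - \<delta> \<le> F' (real n) \<and> F' (real n) \<le> real_of_int k + 1 - \<delta> + \<delta>" if "n \<in> B2" for n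
        using that fl[of n] by (auto simp: B2_def)
    qed (use \<delta> fl sep in \<open>auto simp: B2_def\<close>)
    moreover have "\<delta> / \<mu> = 1 / \<delta>" unfolding \<delta>(3)[symmetric] using \<delta>(1) by (simp add: power2_eq_square)
    ultimately have "norm (\<Sum>n\<in>B1 \<union> B2. e_fun (F (real n))) \<le> 2 / \<delta> + 2"
      using norm_sum_e_fun_le[of "\<lambda>n. F (real n)" "B1 \<union> B2"] card_Un_le[of B1 B2] by (simp add: field_simps)
    moreover have "norm (\<Sum>n\<in>B. e_fun (F (real n))) \<le> 2 / \<delta>"
    proof (cases "B = {}")
      case False
      define a b where "a = Min B" and "b = Max B"
      have ab: "a \<in> B" "b \<in> B" "a \<le> b" using False fin by (auto simp: a_def b_def)
      have lh: "l \<le> a" "b \<le> h" using ab by (auto simp: B_def A_def)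
      have Beq: "B = {a..b}"
      proof
        show "B \<subseteq> {a..b}" using fin by (auto simp: a_def b_def)
        show "{a..b} \<subseteq> B"
        proof
          fix n assume n: "n \<in> {a..b}"
          then have "F' (real a) \<le> F' (real n)" "F' (real n) \<le> F' (real b)" using lh by (auto intro!: mono)
          then have "real_of_int k + \<delta> \<le> F' (real n) \<and> F' (real n) \<le> real_of_int k + 1 - \<delta>"
            using ab by (auto simp: B_def)
          then show "n \<in> B" using n lh \<delta> by (auto simp: B_def A_def floor_eq_iff)
        qed
      qed
      have "norm (\<Sum>n=a..b. e_fun (F (real n))) \<le> 2 / \<delta>"
        by (rule kuzmin_landau[OF \<delta>(1) ab(3), of F F' k]) (use lh ab F mono in \<open>auto simp: B_def\<close>)
      then show ?thesis using Beq by simp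
    qed (use \<delta> in simp)
    ultimately have "norm (\<Sum>n\<in>A k. e_fun (F (real n))) \<le> 2 / \<delta> + (2 / \<delta> + 2)"
      unfolding AB(1) using fin AB(2) by (subst sum.union_disjoint) (auto intro!: norm_triangle_le)
    also have "\<dots> \<le> 5 / \<delta>" using \<delta> by (simp add: field_simps)
    finally show ?thesis .
  qed
  have "{l..h} = (\<Union>k\<in>K. A k)"
  proof -
    have "\<lfloor>F' (real n)\<rfloor> \<in> K" if "n \<in> {l..h}" for n
      unfolding K_def using that by (auto intro!: floor_mono mono)
    then show ?thesis unfolding A_def by auto
  qed
  then have "(\<Sum>n=l..h. e_fun (F (real n))) = (\<Sum>n\<in>(\<Union>k\<in>K. A k). e_fun (F (real n)))" by simp
  also have "\<dots> = (\<Sum>k\<in>K. \<Sum>n\<in>A k. e_fun (F (real n)))"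
    by (rule sum.UNION_disjoint) (auto simp: K_def A_def)
  also have "norm \<dots> \<le> real (card K) * (5 / \<delta>)" by (rule order_trans[OF norm_sum sum_bounded_above[OF part]])
  also have "\<dots> \<le> (\<alpha> * \<mu> * (real h - real l) + 2) * (5 / \<delta>)"
    using cardK W \<delta> by (intro mult_right_mono) auto
  also have "\<dots> = 5 * \<alpha> * \<delta> * (real h - real l) + 10 / \<delta>"
    unfolding \<delta>(3)[symmetric] using \<delta>(1) by (simp add: field_simps power2_eq_square)
  finally show ?thesis by (simp add: \<delta>_def)
qed

text \<open>Conjugation reduces a concave phase to a convex one. For \<open>\<mu> \<ge> 1/4\<close>
  the first term already exceeds \<open>h - l\<close>, and with the additive 1 the trivial bound
  suffices.\<close>

lemma second_derivative_test:
  fixes F F' F'' :: "real \<Rightarrow> real" and l h :: nat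
  assumes "0 < \<mu>" "1 \<le> \<alpha>" "l \<le> h"
    and F: "\<And>x. real l \<le> x \<Longrightarrow> x \<le> real h \<Longrightarrow> (F has_real_derivative F' x) (at x)"
    and F': "\<And>x. real l \<le> x \<Longrightarrow> x \<le> real h \<Longrightarrow> (F' has_real_derivative F'' x) (at x)"
    and bounds: "(\<forall>x\<in>{real l..real h}. \<mu> \<le> F'' x \<and> F'' x \<le> \<alpha> * \<mu>) \<or>
      (\<forall>x\<in>{real l..real h}. \<mu> \<le> - F'' x \<and> - F'' x \<le> \<alpha> * \<mu>)"
  shows "norm (\<Sum>n=l..h. e_fun (F (real n))) \<le> 5 * \<alpha> * sqrt \<mu> * (real h - real l) + 10 / sqrt \<mu> + 1"
proof (cases "\<mu> < 1/4")
  case True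
  from bounds show ?thesis
  proof
    assume "\<forall>x\<in>{real l..real h}. \<mu> \<le> F'' x \<and> F'' x \<le> \<alpha> * \<mu>"
    then have "norm (\<Sum>n=l..h. e_fun (F (real n))) \<le> 5 * \<alpha> * sqrt \<mu> * (real h - real l) + 10 / sqrt \<mu>"
      by (intro second_derivative_test_aux[OF assms(1) True assms(3) F F']) auto
    then show ?thesis by simp
  next
    assume *: "\<forall>x\<in>{real l..real h}. \<mu> \<le> - F'' x \<and> - F'' x \<le> \<alpha> * \<mu>"
    have "norm (\<Sum>n=l..h. e_fun (- F (real n))) \<le> 5 * \<alpha> * sqrt \<mu> * (real h - real l) + 10 / sqrt \<mu>"
      using * by (intro second_derivative_test_aux[OF assms(1) True assms(3) DERIV_minus[OF F] DERIV_minus[OF F']]) auto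
    moreover have "(\<Sum>n=l..h. e_fun (- F (real n))) = cnj (\<Sum>n=l..h. e_fun (F (real n)))"
      by (simp add: e_fun_minus)
    ultimately have "norm (\<Sum>n=l..h. e_fun (F (real n))) \<le> 5 * \<alpha> * sqrt \<mu> * (real h - real l) + 10 / sqrt \<mu>"
      by (simp only: complex_mod_cnj)
    then show ?thesis by linarith
  qed
next
  case False
  then have "sqrt \<mu> \<ge> 1/2" using real_sqrt_le_mono[of "1/4" \<mu>] by (simp add: real_sqrt_divide)
  then have "1 * (1/2) \<le> \<alpha> * sqrt \<mu>" using assms(2) by (intro mult_mono) auto
  then have "real h - real l \<le> 5 * \<alpha> * sqrt \<mu> * (real h - real l)"
    using assms(3) mult_right_mono[of 1 "5 * \<alpha> * sqrt \<mu>" "real h - real l"] by simp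
  moreover have "10 / sqrt \<mu> \<ge> 0" using assms(1) by simp
  moreover have "norm (\<Sum>n=l..h. e_fun (F (real n))) \<le> real h - real l + 1"
    using norm_sum_e_fun_le[of "\<lambda>n. F (real n)" "{l..h}"] assms(3) by (simp add: of_nat_diff)
  ultimately show ?thesis by linarith
qed

text \<open>Shift the inner sum by \<open>i < D\<close>, average and apply
  the Cauchy--Schwarz inequality to the outer index.\<close>

lemma van_der_Corput_differencing:
  fixes z :: "'a \<Rightarrow> int \<Rightarrow> complex" and a b :: int and D :: nat
  assumes "finite N" "D \<ge> 1" "a \<le> b + 1"
    and supp: "\<And>n m. n \<in> N \<Longrightarrow> m \<notin> {a..b} \<Longrightarrow> z n m = 0"
    and diag: "(\<Sum>n\<in>N. \<Sum>m\<in>{a..b}. (norm (z n m))\<^sup>2) \<le> B0"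
    and off: "\<And>d. 1 \<le> d \<Longrightarrow> d < int D \<Longrightarrow> norm (\<Sum>n\<in>N. \<Sum>m\<in>{a..b}. z n (m + d) * cnj (z n m)) \<le> B1"
    and "B1 \<ge> 0"
  shows "(\<Sum>n\<in>N. (norm (\<Sum>m\<in>{a..b}. z n m))\<^sup>2) \<le> (real_of_int (b - a) + 1 + real D) * (B0 / real D + B1)"
proof -
  \<comment> \<open>\<open>K\<close> contains \<open>m - i\<close> for all \<open>m\<close> in
    \<open>{a..b}\<close> and \<open>i < D\<close>, so every shifted sum over \<open>K\<close> is
    still the full sum.\<close>
  define K where "K = {a - int D..b}"
  define I where "I = {..<D}"
  have finK: "finite K" by (simp add: K_def)
  have cardK: "real (card K) = real_of_int (b - a) + 1 + real D"
    using assms(3) by (simp add: K_def)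
  have shift: "(\<Sum>k\<in>K. w (k + int i)) = (\<Sum>m\<in>{a..b}. w m)" if "i \<in> I" "\<And>m. m \<notin> {a..b} \<Longrightarrow> w m = 0"
    for i and w :: "int \<Rightarrow> complex"
  proof -
    have "(\<Sum>k\<in>K. w (k + int i)) = (\<Sum>m\<in>(\<lambda>k. k + int i) ` K. w m)"
      by (subst sum.reindex) (auto simp: inj_on_def)
    also have "\<dots> = (\<Sum>m\<in>{a..b}. w m)"
    proof (rule sum.mono_neutral_right)
      show "{a..b} \<subseteq> (\<lambda>k. k + int i) ` K"
      proof
        fix m assume "m \<in> {a..b}"
        then have "m - int i \<in> K" using that(1) by (auto simp: K_def I_def)
        then show "m \<in> (\<lambda>k. k + int i) ` K" by force
      qed
    qed (use finK that in auto)
    finally show ?thesis .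
  qed
  have CS: "(real D)\<^sup>2 * (norm (\<Sum>m\<in>{a..b}. z n m))\<^sup>2 \<le> real (card K) * (\<Sum>k\<in>K. (norm (\<Sum>i\<in>I. z n (k + int i)))\<^sup>2)"
    if "n \<in> N" for n
  proof -
    have "(\<Sum>i\<in>I. \<Sum>k\<in>K. z n (k + int i)) = (\<Sum>i\<in>I. \<Sum>m\<in>{a..b}. z n m)"
      by (intro sum.cong refl shift supp[OF that]) auto
    then have "of_nat D * (\<Sum>m\<in>{a..b}. z n m) = (\<Sum>i\<in>I. \<Sum>k\<in>K. z n (k + int i))"
      by (simp add: I_def)
    also have "\<dots> = (\<Sum>k\<in>K. \<Sum>i\<in>I. z n (k + int i))" by (rule sum.swap)
    finally have "real D * norm (\<Sum>m\<in>{a..b}. z n m) = norm (\<Sum>k\<in>K. \<Sum>i\<in>I. z n (k + int i))"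
      by (metis norm_mult norm_of_nat)
    also have "\<dots> \<le> (\<Sum>k\<in>K. 1 * norm (\<Sum>i\<in>I. z n (k + int i)))" by (simp add: norm_sum)
    finally have "(real D * norm (\<Sum>m\<in>{a..b}. z n m))\<^sup>2 \<le> (\<Sum>k\<in>K. 1 * norm (\<Sum>i\<in>I. z n (k + int i)))\<^sup>2"
      by (intro power_mono) auto
    also have "\<dots> \<le> (\<Sum>k\<in>K. 1\<^sup>2) * (\<Sum>k\<in>K. (norm (\<Sum>i\<in>I. z n (k + int i)))\<^sup>2)"
      by (rule Cauchy_Schwarz_ineq_sum)
    finally show ?thesis by (simp add: power_mult_distrib)
  qed
  define T where "T i j = (\<Sum>n\<in>N. \<Sum>k\<in>K. z n (k + int i) * cnj (z n (k + int j)))" for i j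
  have T_eq: "T i j = (\<Sum>n\<in>N. \<Sum>m\<in>{a..b}. z n (m + (int i - int j)) * cnj (z n m))" if "j \<in> I" for i j
  proof -
    have "(\<Sum>k\<in>K. z n (k + int i) * cnj (z n (k + int j))) = (\<Sum>m\<in>{a..b}. z n (m + (int i - int j)) * cnj (z n m))"
      if "n \<in> N" for n
      using shift[OF \<open>j \<in> I\<close>, of "\<lambda>m. z n (m + (int i - int j)) * cnj (z n m)"] supp[OF that] by simp
    then show ?thesis unfolding T_def by (rule sum.cong[OF refl])
  qed
  \<comment> \<open>A negative difference of shifts is the conjugate of a positive one. Diagonal
    entries are also charged \<open>B1\<close>, so that the double sum is simply
    \<open>D * B0 + D^2 * B1\<close>.\<close>
  have T_le: "norm (T i j) \<le> (if i = j then B0 else 0) + B1" if "i \<in> I" "j \<in> I" for i j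
  proof (cases i j rule: linorder_cases)
    case equal
    have "norm (T i j) \<le> (\<Sum>n\<in>N. \<Sum>m\<in>{a..b}. (norm (z n m))\<^sup>2)"
      unfolding T_eq[OF that(2)] equal
      by (rule order_trans[OF norm_sum], rule sum_mono, rule order_trans[OF norm_sum])
         (simp add: norm_mult power2_eq_square)
    then show ?thesis using diag equal \<open>B1 \<ge> 0\<close> by simp
  next
    case greater
    then show ?thesis using that off[of "int i - int j"] by (simp add: T_eq I_def)
  next
    case less
    have "T i j = cnj (T j i)" unfolding T_def by (simp add: mult.commute)
    then have "norm (T i j) = norm (T j i)" by (simp only: complex_mod_cnj)
    then show ?thesis using less that off[of "int j - int i"] by (simp add: T_eq I_def)
  qed
  have "complex_of_real (\<Sum>n\<in>N. \<Sum>k\<in>K. (norm (\<Sum>i\<in>I. z n (k + int i)))\<^sup>2) = (\<Sum>i\<in>I. \<Sum>j\<in>I. T i j)"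
  proof -
    have "complex_of_real (\<Sum>n\<in>N. \<Sum>k\<in>K. (norm (\<Sum>i\<in>I. z n (k + int i)))\<^sup>2)
        = (\<Sum>n\<in>N. \<Sum>k\<in>K. \<Sum>i\<in>I. \<Sum>j\<in>I. z n (k + int i) * cnj (z n (k + int j)))"
      by (simp only: of_real_sum complex_norm_square cnj_sum sum_product)
    also have "\<dots> = (\<Sum>n\<in>N. \<Sum>i\<in>I. \<Sum>k\<in>K. \<Sum>j\<in>I. z n (k + int i) * cnj (z n (k + int j)))"
      by (intro sum.cong refl sum.swap)
    also have "\<dots> = (\<Sum>n\<in>N. \<Sum>i\<in>I. \<Sum>j\<in>I. \<Sum>k\<in>K. z n (k + int i) * cnj (z n (k + int j)))"
      by (intro sum.cong refl sum.swap)
    also have "\<dots> = (\<Sum>i\<in>I. \<Sum>n\<in>N. \<Sum>j\<in>I. \<Sum>k\<in>K. z n (k + int i) * cnj (z n (k + int j)))"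
      by (rule sum.swap)
    also have "\<dots> = (\<Sum>i\<in>I. \<Sum>j\<in>I. T i j)"
      unfolding T_def by (intro sum.cong refl sum.swap)
    finally show ?thesis .
  qed
  then have "(\<Sum>n\<in>N. \<Sum>k\<in>K. (norm (\<Sum>i\<in>I. z n (k + int i)))\<^sup>2) = Re (\<Sum>i\<in>I. \<Sum>j\<in>I. T i j)"
    by (metis Re_complex_of_real)
  also have "\<dots> \<le> norm (\<Sum>i\<in>I. \<Sum>j\<in>I. T i j)" by (rule complex_Re_le_cmod)
  also have "\<dots> \<le> (\<Sum>i\<in>I. \<Sum>j\<in>I. norm (T i j))"
    by (rule order_trans[OF norm_sum sum_mono[OF norm_sum]])
  also have "\<dots> \<le> (\<Sum>i\<in>I. \<Sum>j\<in>I. (if i = j then B0 else 0) + B1)"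
    by (intro sum_mono T_le)
  also have "\<dots> = real D * B0 + (real D)\<^sup>2 * B1"
    by (simp add: sum.distrib I_def power2_eq_square algebra_simps)
  finally have main: "(\<Sum>n\<in>N. \<Sum>k\<in>K. (norm (\<Sum>i\<in>I. z n (k + int i)))\<^sup>2) \<le> real D * B0 + (real D)\<^sup>2 * B1" .
  have "(real D)\<^sup>2 * (\<Sum>n\<in>N. (norm (\<Sum>m\<in>{a..b}. z n m))\<^sup>2)
      \<le> (\<Sum>n\<in>N. real (card K) * (\<Sum>k\<in>K. (norm (\<Sum>i\<in>I. z n (k + int i)))\<^sup>2))"
    unfolding sum_distrib_left by (intro sum_mono order_trans[OF CS]) (auto simp: sum_distrib_left)
  also have "\<dots> \<le> real (card K) * (real D * B0 + (real D)\<^sup>2 * B1)"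
    unfolding sum_distrib_left[symmetric] by (intro mult_left_mono main) auto
  also have "\<dots> = (real D)\<^sup>2 * (real (card K) * (B0 / real D + B1))"
    using assms(2) by (simp add: field_simps power2_eq_square)
  finally show ?thesis using assms(2) unfolding cardK by (simp add: mult_le_cancel_left_pos)
qed

section \<open>The differenced phase\<close>

lemma kuzmin_landau':
  fixes F F' :: "real \<Rightarrow> real" and k :: int and l h :: nat
  assumes "0 < \<delta>" and "l \<le> h"
    and F: "\<And>x. real l \<le> x \<Longrightarrow> x \<le> real h \<Longrightarrow> (F has_real_derivative F' x) (at x)"
    and mono: "mono_on {real l..real h} F' \<or> antimono_on {real l..real h} F'"
    and range: "\<And>x. real l \<le> x \<Longrightarrow> x \<le> real h \<Longrightarrow> real_of_int k + \<delta> \<le> F' x \<and> F' x \<le> real_of_int k + 1 - \<delta>"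
  shows "norm (\<Sum>n=l..h. e_fun (F (real n))) \<le> 2 / \<delta>"
  using mono
proof
  assume "mono_on {real l..real h} F'"
  then show ?thesis
    by (intro kuzmin_landau[OF assms(1,2) F, of k]) (use range assms(2) in \<open>auto simp: monotone_on_def\<close>)
next
  assume *: "antimono_on {real l..real h} F'"
  have "norm (\<Sum>n=l..h. e_fun (- F (real n))) \<le> 2 / \<delta>"
  \<comment> \<open>Negation maps the unit interval starting at \<open>k\<close> to the one starting
    at \<open>- k - 1\<close>.\<close>
  proof (rule kuzmin_landau[OF assms(1,2) DERIV_minus[OF F], of "- k - 1"])
    show "- F' x \<le> - F' y" if "real l \<le> x" "x \<le> y" "y \<le> real h" for x y
      using * that by (auto simp: monotone_on_def)
  qed (use range[of "real l"] range[of "real h"] assms(2) in auto)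
  moreover have "(\<Sum>n=l..h. e_fun (- F (real n))) = cnj (\<Sum>n=l..h. e_fun (F (real n)))"
    by (simp add: e_fun_minus)
  ultimately show ?thesis by (simp only: complex_mod_cnj)
qed

text \<open>In the application \<open>h(n, m) = m H(n / m\<^sup>2)\<close>, \<open>\<phi> = H'\<close> and \<open>G = \<phi> + 2 u \<phi>'\<close>, so that
  \<open>- G(n / m\<^sup>2) / m\<^sup>2\<close> is the mixed second derivative of \<open>h\<close>.\<close>

locale phase_window =
  fixes H \<phi> G G1 :: "real \<Rightarrow> real" and a b U1 U2 :: real
  assumes window: "0 \<le> a" "a < U1" "U1 < U2" "U2 < b"
    and deriv_H: "\<And>u. a < u \<Longrightarrow> u < b \<Longrightarrow> (H has_real_derivative \<phi> u) (at u)"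
    and deriv_\<phi>: "\<And>u. a < u \<Longrightarrow> u < b \<Longrightarrow> (\<phi> has_real_derivative (G u - \<phi> u) / (2 * u)) (at u)"
    and deriv_G: "\<And>u. a < u \<Longrightarrow> u < b \<Longrightarrow> (G has_real_derivative G1 u) (at u)"
begin

definition F :: "real \<Rightarrow> real \<Rightarrow> real \<Rightarrow> real" where
  "F m m' x = m' * H (x / m'\<^sup>2) - m * H (x / m\<^sup>2)"

definition F' :: "real \<Rightarrow> real \<Rightarrow> real \<Rightarrow> real" where
  "F' m m' x = \<phi> (x / m'\<^sup>2) / m' - \<phi> (x / m\<^sup>2) / m"

text \<open>Since \<open>\<phi>' = (G - \<phi>) / (2 * u)\<close>, differentiating
  \<open>\<phi> (x / t^2) / t\<close> in \<open>x\<close> gives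
  \<open>(G - \<phi>) / (2 * x * t)\<close>.\<close>

definition F'' :: "real \<Rightarrow> real \<Rightarrow> real \<Rightarrow> real" where
  "F'' m m' x = (G (x / m'\<^sup>2) - \<phi> (x / m'\<^sup>2)) / (2 * x * m') - (G (x / m\<^sup>2) - \<phi> (x / m\<^sup>2)) / (2 * x * m)"

lemma U1_pos: "0 < U1" and U2_pos: "0 < U2" using window by auto

context
  fixes m m' x :: real
  assumes m: "0 < m" "m < m'" and lo: "U1 * m'\<^sup>2 \<le> x" and hi: "x \<le> U2 * m\<^sup>2"
begin

text \<open>\<open>x / t^2\<close> decreases in \<open>t\<close>, so the conditions at
  \<open>m\<close> and \<open>m'\<close> control all intermediate \<open>t\<close>. This allows the
  mean value theorem in the variable \<open>t\<close>, with \<open>x\<close> fixed.\<close>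

lemma ratio_in_window:
  assumes "m \<le> t" "t \<le> m'"
  shows "U1 \<le> x / t\<^sup>2" "x / t\<^sup>2 \<le> U2" "a < x / t\<^sup>2" "x / t\<^sup>2 < b"
proof -
  have t: "0 < t" "t\<^sup>2 \<le> m'\<^sup>2" "m\<^sup>2 \<le> t\<^sup>2" using assms m by (auto intro!: power_mono)
  have "U1 * t\<^sup>2 \<le> U1 * m'\<^sup>2" "U2 * m\<^sup>2 \<le> U2 * t\<^sup>2" using t U1_pos U2_pos by (auto intro!: mult_left_mono)
  then have "U1 * t\<^sup>2 \<le> x" "x \<le> U2 * t\<^sup>2" using lo hi by linarith+
  then show "U1 \<le> x / t\<^sup>2" "x / t\<^sup>2 \<le> U2" using t by (auto simp: field_simps)
  then show "a < x / t\<^sup>2" "x / t\<^sup>2 < b" using window by linarith+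
qed

lemma x_pos: "0 < x"
proof -
  have "0 < U1 * m'\<^sup>2" using U1_pos m by simp
  then show ?thesis using lo by simp
qed

lemma deriv_F: "(F m m' has_real_derivative F' m m' x) (at x)"
proof -
  have "((\<lambda>x. t * H (x / t\<^sup>2)) has_real_derivative \<phi> (x / t\<^sup>2) / t) (at x)" if "m \<le> t" "t \<le> m'" for t
  proof -
    have "((\<lambda>x. t * H (x / t\<^sup>2)) has_real_derivative t * (\<phi> (x / t\<^sup>2) * (1 / t\<^sup>2))) (at x)"
      by (intro DERIV_cmult DERIV_chain'[where f = "\<lambda>x. x / t\<^sup>2" and g = H, OF _ deriv_H] DERIV_cdivide DERIV_ident ratio_in_window that)
    then show ?thesis using that m by (simp add: power2_eq_square)
  qed
  from DERIV_diff[OF this[of m'] this[of m]] show ?thesis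
    unfolding F_def F'_def using m by simp
qed

lemma deriv_F': "(F' m m' has_real_derivative F'' m m' x) (at x)"
proof -
  have "((\<lambda>x. \<phi> (x / t\<^sup>2) / t) has_real_derivative (G (x / t\<^sup>2) - \<phi> (x / t\<^sup>2)) / (2 * x * t)) (at x)"
    if "m \<le> t" "t \<le> m'" for t
  proof -
    have "((\<lambda>x. \<phi> (x / t\<^sup>2) / t) has_real_derivative
        ((G (x / t\<^sup>2) - \<phi> (x / t\<^sup>2)) / (2 * (x / t\<^sup>2)) * (1 / t\<^sup>2)) / t) (at x)"
      by (intro DERIV_cdivide DERIV_chain'[where f = "\<lambda>x. x / t\<^sup>2" and g = \<phi>, OF _ deriv_\<phi>] DERIV_ident ratio_in_window that)
    then show ?thesis using that m by simp
  qed
  from DERIV_diff[OF this[of m'] this[of m]] show ?thesis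
    unfolding F'_def F''_def using m by simp
qed

lemma deriv_ratio:
  assumes "0 < t"
  shows "((\<lambda>t. x / t\<^sup>2) has_real_derivative - 2 * (x / t\<^sup>2) / t) (at t)"
  using assms by (auto intro!: derivative_eq_intros simp: power2_eq_square field_simps)

text \<open>Mean value theorem in \<open>t\<close> for \<open>\<phi> (x / t^2) / t - g / t\<close>,
  whose derivative is \<open>- (G - g) / t^2\<close> because
  \<open>G = \<phi> + 2 * u * \<phi>'\<close>. Subtracting \<open>g / t\<close> isolates a slope
  that does not depend on \<open>x\<close>; after scaling by \<open>R\<close> it becomes
  \<open>- \<theta>\<close>.\<close>

lemma F'_mvt:
  obtains t where "m < t" "t < m'" "F' m m' x + g * (m' - m) / (m * m') = - ((m' - m) * (G (x / t\<^sup>2) - g) / t\<^sup>2)"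
proof -
  define \<psi> where "\<psi> t = \<phi> (x / t\<^sup>2) / t - g / t" for t
  have "(\<psi> has_real_derivative - ((G (x / t\<^sup>2) - g) / t\<^sup>2)) (at t)" if "m \<le> t" "t \<le> m'" for t
  proof -
    have t: "0 < t" using that m by simp
    have 1: "((\<lambda>t. \<phi> (x / t\<^sup>2)) has_real_derivative
        (G (x / t\<^sup>2) - \<phi> (x / t\<^sup>2)) / (2 * (x / t\<^sup>2)) * (- 2 * (x / t\<^sup>2) / t)) (at t)"
      by (intro DERIV_chain'[where f = "\<lambda>t. x / t\<^sup>2" and g = \<phi>, OF deriv_ratio[OF t] deriv_\<phi>] ratio_in_window that)
    have 2: "(G (x / t\<^sup>2) - \<phi> (x / t\<^sup>2)) / (2 * (x / t\<^sup>2)) * (- 2 * (x / t\<^sup>2) / t) = - (G (x / t\<^sup>2) - \<phi> (x / t\<^sup>2)) / t"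
      using t x_pos by (simp add: field_simps)
    have "(\<psi> has_real_derivative (- (G (x / t\<^sup>2) - \<phi> (x / t\<^sup>2)) / t * t - \<phi> (x / t\<^sup>2) * 1) / (t * t)
        - (0 * t - g * 1) / (t * t)) (at t)"
      unfolding \<psi>_def using t by (intro DERIV_divide DERIV_diff 1[unfolded 2] DERIV_ident DERIV_const) auto
    also have "(- (G (x / t\<^sup>2) - \<phi> (x / t\<^sup>2)) / t * t - \<phi> (x / t\<^sup>2) * 1) / (t * t) - (0 * t - g * 1) / (t * t)
        = - ((G (x / t\<^sup>2) - g) / t\<^sup>2)"
      using t by (simp add: field_simps power2_eq_square)
    finally show ?thesis .
  qed
  then have "\<exists>t. m < t \<and> t < m' \<and> \<psi> m' - \<psi> m = (m' - m) * - ((G (x / t\<^sup>2) - g) / t\<^sup>2)"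
    using m by (intro MVT2) auto
  then obtain t where t: "m < t" "t < m'" "\<psi> m' - \<psi> m = (m' - m) * - ((G (x / t\<^sup>2) - g) / t\<^sup>2)" by blast
  have "\<psi> m' - \<psi> m = F' m m' x + g * (m' - m) / (m * m')"
    unfolding \<psi>_def F'_def using m by (simp add: field_simps)
  then show ?thesis using t by (intro that[of t]) auto
qed

text \<open>Again the mean value theorem in \<open>t\<close>: the terms with \<open>\<phi>\<close>
  and with \<open>G\<close> itself cancel in the derivative, and only \<open>G1\<close> remains.
  Hence the size of the second derivative is the size of \<open>G1\<close> on the window.\<close>

lemma F''_mvt:
  obtains t where "m < t" "t < m'" "F'' m m' x = - ((m' - m) * G1 (x / t\<^sup>2) / t ^ 4)"
proof -
  define \<psi> where "\<psi> t = (G (x / t\<^sup>2) - \<phi> (x / t\<^sup>2)) / (2 * x * t)" for t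
  have "(\<psi> has_real_derivative - (G1 (x / t\<^sup>2) / t ^ 4)) (at t)" if "m \<le> t" "t \<le> m'" for t
  proof -
    have t: "0 < t" using that m by simp
    let ?u = "x / t\<^sup>2"
    have 1: "((\<lambda>t. \<phi> (x / t\<^sup>2)) has_real_derivative (G ?u - \<phi> ?u) / (2 * ?u) * (- 2 * ?u / t)) (at t)"
      by (intro DERIV_chain'[where f = "\<lambda>t. x / t\<^sup>2" and g = \<phi>, OF deriv_ratio[OF t] deriv_\<phi>] ratio_in_window that)
    have 2: "(G ?u - \<phi> ?u) / (2 * ?u) * (- 2 * ?u / t) = - (G ?u - \<phi> ?u) / t"
      using t x_pos by (simp add: field_simps)
    have 3: "((\<lambda>t. G (x / t\<^sup>2)) has_real_derivative G1 ?u * (- 2 * ?u / t)) (at t)"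
      by (intro DERIV_chain'[where f = "\<lambda>t. x / t\<^sup>2" and g = G, OF deriv_ratio[OF t] deriv_G] ratio_in_window that)
    have "(\<psi> has_real_derivative ((G1 ?u * (- 2 * ?u / t) - (- (G ?u - \<phi> ?u) / t)) * (2 * x * t)
        - (G ?u - \<phi> ?u) * (2 * x * 1)) / ((2 * x * t) * (2 * x * t))) (at t)"
      unfolding \<psi>_def using t x_pos
      by (intro DERIV_divide DERIV_diff 1[unfolded 2] 3 DERIV_cmult DERIV_ident) auto
    also have "((G1 ?u * (- 2 * ?u / t) - (- (G ?u - \<phi> ?u) / t)) * (2 * x * t)
        - (G ?u - \<phi> ?u) * (2 * x * 1)) / ((2 * x * t) * (2 * x * t)) = - (G1 ?u / t ^ 4)"
      using t x_pos by (simp add: field_simps eval_nat_numeral)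
    finally show ?thesis .
  qed
  then have "\<exists>t. m < t \<and> t < m' \<and> \<psi> m' - \<psi> m = (m' - m) * - (G1 (x / t\<^sup>2) / t ^ 4)"
    using m by (intro MVT2) auto
  then show ?thesis using that unfolding \<psi>_def F''_def by auto
qed

end

section \<open>Exponential sums in \<open>n\<close> for a fixed pair \<open>m\<close>,
  \<open>m'\<close>\<close>

definition window_set :: "nat \<Rightarrow> nat \<Rightarrow> nat set" where
  "window_set m m' = {n. 0 < n \<and> U1 \<le> real n / (real m)\<^sup>2 \<and> real n / (real m)\<^sup>2 < U2
     \<and> U1 \<le> real n / (real m')\<^sup>2 \<and> real n / (real m')\<^sup>2 < U2}"

definition T :: "real \<Rightarrow> nat \<Rightarrow> nat \<Rightarrow> complex" where
  "T R m m' = (\<Sum>n\<in>window_set m m'. e_fun (R * F (real m) (real m') (real n)))"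

lemma window_setD:
  assumes "n \<in> window_set m m'" "0 < m" "m < m'"
  shows "U1 * (real m')\<^sup>2 \<le> real n" "real n \<le> U2 * (real m)\<^sup>2"
  using assms by (auto simp: window_set_def field_simps)

text \<open>The defining conditions are order-convex in \<open>n\<close>, so the summation runs over
  consecutive integers and the one-dimensional estimates apply.\<close>

lemma window_set_cases:
  assumes "0 < m" "m < m'"
  obtains "window_set m m' = {}"
  | l h where "window_set m m' = {l..h}" "l \<le> h" "U1 * (real m')\<^sup>2 \<le> real l" "real h \<le> U2 * (real m)\<^sup>2"
proof (cases "window_set m m' = {}")
  case False
  have "window_set m m' \<subseteq> {..nat \<lfloor>U2 * (real m)\<^sup>2\<rfloor>}"
  proof
    fix n assume "n \<in> window_set m m'"
    from window_setD(2)[OF this assms] show "n \<in> {..nat \<lfloor>U2 * (real m)\<^sup>2\<rfloor>}"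
      by (simp add: le_nat_floor)
  qed
  then have fin: "finite (window_set m m')" by (rule finite_subset) auto
  define l h where "l = Min (window_set m m')" and "h = Max (window_set m m')"
  have lh: "l \<in> window_set m m'" "h \<in> window_set m m'" "l \<le> h"
    using False fin by (auto simp: l_def h_def)
  have "{l..h} \<subseteq> window_set m m'"
  proof
    fix n assume n: "n \<in> {l..h}"
    have "U1 \<le> real n / t\<^sup>2 \<and> real n / t\<^sup>2 < U2" if "U1 \<le> real l / t\<^sup>2" "real h / t\<^sup>2 < U2" for t
      using that divide_right_mono[of "real l" "real n" "t\<^sup>2"] divide_right_mono[of "real n" "real h" "t\<^sup>2"] n by auto
    then show "n \<in> window_set m m'" using lh n by (auto simp: window_set_def)
  qed
  moreover have "window_set m m' \<subseteq> {l..h}" using fin by (auto simp: l_def h_def)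
  ultimately show ?thesis using that(2)[of l h] lh window_setD[OF lh(1) assms] window_setD[OF lh(2) assms] by blast
qed (rule that(1))

context
  fixes m m' :: nat and M :: real
  assumes m: "0 < M" "M \<le> real m" "m < m'" "real m' < 2 * M"
begin

lemma m_pos: "0 < m" using m by (cases m) auto

lemma window_length:
  assumes "U1 * (real m')\<^sup>2 \<le> l" "h \<le> U2 * (real m)\<^sup>2"
  shows "h - l \<le> 4 * (U2 - U1) * M\<^sup>2"
proof -
  have "(real m)\<^sup>2 \<le> (real m')\<^sup>2" "(real m)\<^sup>2 \<le> (2 * M)\<^sup>2" by (rule power_mono; use m in simp)+
  then have "U1 * (real m)\<^sup>2 \<le> U1 * (real m')\<^sup>2" "(U2 - U1) * (real m)\<^sup>2 \<le> (U2 - U1) * (2 * M)\<^sup>2"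
    using U1_pos window by (auto intro!: mult_left_mono)
  then show ?thesis using assms by (simp add: left_diff_distrib power_mult_distrib)
qed

lemma T_trivial: "norm (T R m m') \<le> 4 * (U2 - U1) * M\<^sup>2 + 1"
proof (cases rule: window_set_cases[OF m_pos m(3)])
  case 1
  then show ?thesis using window by (simp add: T_def)
next
  case (2 l h)
  have "norm (T R m m') \<le> real (card (window_set m m'))" unfolding T_def by (rule norm_sum_e_fun_le)
  also have "\<dots> = real h - real l + 1" using 2 by (simp add: of_nat_diff)
  finally show ?thesis using window_length[OF 2(3,4)] by simp
qed

text \<open>The intermediate point of the mean value theorem lies between \<open>M\<close> and
  \<open>2 * M\<close>, whence the factor \<open>16 = 2 ^ 4\<close> between the two bounds.\<close>

lemma F''_bounds:
  assumes c: "0 < c" "c \<le> C" "0 < V"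
    and G1: "\<And>u. U1 \<le> u \<Longrightarrow> u \<le> U2 \<Longrightarrow> c * V \<le> s * G1 u \<and> s * G1 u \<le> C * V"
    and x: "U1 * (real m')\<^sup>2 \<le> x" "x \<le> U2 * (real m)\<^sup>2"
  shows "c * V * (real m' - real m) / (16 * M ^ 4) \<le> - s * F'' m m' x"
    "- s * F'' m m' x \<le> C * V * (real m' - real m) / M ^ 4"
proof -
  have mm: "0 < real m" "real m < real m'" using m m_pos by auto
  obtain t where t: "real m < t" "t < real m'" "F'' m m' x = - ((real m' - real m) * G1 (x / t\<^sup>2) / t ^ 4)"
    using F''_mvt[OF mm x] by blast
  define g where "g = s * G1 (x / t\<^sup>2)"
  have g: "c * V \<le> g" "g \<le> C * V" unfolding g_def using G1 ratio_in_window[OF mm x, of t] t by auto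
  have cV: "0 < c * V" using c by simp
  have t4: "M ^ 4 \<le> t ^ 4" "t ^ 4 \<le> (2 * M) ^ 4" by (rule power_mono; use t m in simp)+
  have M4: "0 < M ^ 4" using m by simp
  have eq: "- s * F'' m m' x = g * (real m' - real m) / t ^ 4" unfolding t(3) g_def by simp
  have "c * V * (real m' - real m) / (2 * M) ^ 4 \<le> g * (real m' - real m) / t ^ 4"
    using g cV t4 M4 mm by (intro frac_le mult_right_mono) auto
  then show "c * V * (real m' - real m) / (16 * M ^ 4) \<le> - s * F'' m m' x"
    unfolding eq by (simp add: power_mult_distrib)
  show "- s * F'' m m' x \<le> C * V * (real m' - real m) / M ^ 4"
    unfolding eq using g cV t4 M4 mm by (intro frac_le mult_right_mono) auto
qed

text \<open>\<open>\<mu>\<close> is the lower bound for the scaled second derivative and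
  \<open>16 * C / c\<close> the ratio of the bounds. The constant is
  \<open>320 = 5 * 16 * 4\<close>, with 4 from the length of the summation interval.\<close>

lemma T_second_derivative:
  assumes c: "0 < c" "c \<le> C" "0 < V" "0 < R" and s: "s \<in> {1, -1}"
    and G1: "\<And>u. U1 \<le> u \<Longrightarrow> u \<le> U2 \<Longrightarrow> c * V \<le> s * G1 u \<and> s * G1 u \<le> C * V"
  defines "\<mu> \<equiv> c * V * R * (real m' - real m) / (16 * M ^ 4)"
  shows "norm (T R m m') \<le> 320 * C / c * (U2 - U1) * M\<^sup>2 * sqrt \<mu> + 10 / sqrt \<mu> + 1"
proof (cases rule: window_set_cases[OF m_pos m(3)])
  case 1
  have "0 \<le> \<mu>" unfolding \<mu>_def using c m by simp
  then show ?thesis using 1 window c by (simp add: T_def)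
next
  case (2 l h)
  have mm: "0 < real m" "real m < real m'" using m m_pos by auto
  have \<mu>: "0 < \<mu>" unfolding \<mu>_def using c m by simp
  have \<alpha>: "1 \<le> 16 * C / c" using c by (simp add: field_simps)
  have x: "U1 * (real m')\<^sup>2 \<le> x" "x \<le> U2 * (real m)\<^sup>2" if "real l \<le> x" "x \<le> real h" for x
    using 2 that by auto
  have b: "\<mu> \<le> - s * (R * F'' m m' x)" "- s * (R * F'' m m' x) \<le> 16 * C / c * \<mu>" if "real l \<le> x" "x \<le> real h" for x
  proof -
    note B = F''_bounds[OF c(1-3) G1 x[OF that]]
    show "\<mu> \<le> - s * (R * F'' m m' x)"
      using mult_left_mono[OF B(1), of R] c(4) by (simp add: \<mu>_def mult_ac)
    have "16 * C / c * \<mu> = R * (C * V * (real m' - real m) / M ^ 4)"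
      unfolding \<mu>_def using c m by (simp add: field_simps)
    then show "- s * (R * F'' m m' x) \<le> 16 * C / c * \<mu>"
      using mult_left_mono[OF B(2), of R] c(4) by (simp add: mult_ac)
  qed
  have "norm (\<Sum>n=l..h. e_fun (R * F m m' (real n)))
      \<le> 5 * (16 * C / c) * sqrt \<mu> * (real h - real l) + 10 / sqrt \<mu> + 1"
  proof (rule second_derivative_test[OF \<mu> \<alpha> 2(2), where F' = "\<lambda>x. R * F' m m' x" and F'' = "\<lambda>x. R * F'' m m' x"])
    show "((\<lambda>x. R * F m m' x) has_real_derivative R * F' m m' x) (at x)" if "real l \<le> x" "x \<le> real h" for x
      by (intro DERIV_cmult deriv_F[OF mm x[OF that]])
    show "((\<lambda>x. R * F' m m' x) has_real_derivative R * F'' m m' x) (at x)" if "real l \<le> x" "x \<le> real h" for x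
      by (intro DERIV_cmult deriv_F'[OF mm x[OF that]])
  qed (use b s in auto)
  also have "5 * (16 * C / c) * sqrt \<mu> * (real h - real l) \<le> 5 * (16 * C / c) * sqrt \<mu> * (4 * (U2 - U1) * M\<^sup>2)"
    using window_length[OF 2(3,4)] c \<mu> by (intro mult_left_mono) auto
  finally show ?thesis using 2(1) by (simp add: T_def mult_ac)
qed

text \<open>The slope \<open>R * F'\<close> stays within \<open>W\<close> of
  \<open>- \<theta>\<close>. If \<open>\<theta>\<close> has distance
  \<open>\<eta> \<ge> 2 * W\<close> from its nearest integer, the slope keeps distance
  \<open>\<eta> / 2\<close> from all integers.\<close>

lemma T_kuzmin_landau:
  fixes \<nu> :: int and R g K :: real
  assumes "0 < R" and s: "s \<in> {1, -1}" and G1: "\<And>u. U1 \<le> u \<Longrightarrow> u \<le> U2 \<Longrightarrow> 0 \<le> s * G1 u"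
    and G: "\<And>u. U1 \<le> u \<Longrightarrow> u \<le> U2 \<Longrightarrow> \<bar>G u - g\<bar> \<le> K"
  defines "W \<equiv> K * R * (real m' - real m) / M\<^sup>2" and "\<theta> \<equiv> g * R * (real m' - real m) / (real m * real m')"
  assumes \<eta>: "2 * W \<le> \<bar>\<theta> - real_of_int \<nu>\<bar>" "\<bar>\<theta> - real_of_int \<nu>\<bar> \<le> 1/2" "\<theta> \<noteq> real_of_int \<nu>"
  shows "norm (T R m m') \<le> 4 / \<bar>\<theta> - real_of_int \<nu>\<bar>"
proof (cases rule: window_set_cases[OF m_pos m(3)])
  case 1
  then show ?thesis by (simp add: T_def)
next
  case (2 l h)
  define \<eta> where "\<eta> = \<bar>\<theta> - real_of_int \<nu>\<bar>"
  have \<eta>': "0 < \<eta>" "\<eta> \<le> 1/2" "2 * W \<le> \<eta>" using \<eta> by (auto simp: \<eta>_def)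
  have mm: "0 < real m" "real m < real m'" using m m_pos by auto
  have x: "U1 * (real m')\<^sup>2 \<le> x" "x \<le> U2 * (real m)\<^sup>2" if "real l \<le> x" "x \<le> real h" for x
    using 2 that by auto
  have near: "\<bar>R * F' m m' x + \<theta>\<bar> \<le> W" if "real l \<le> x" "x \<le> real h" for x
  proof -
    note x = x[OF that]
    obtain t where t: "real m < t" "t < real m'"
      "F' m m' x + g * (real m' - real m) / (real m * real m') = - ((real m' - real m) * (G (x / t\<^sup>2) - g) / t\<^sup>2)"
      using F'_mvt[OF mm x, of g] by blast
    have tM: "M\<^sup>2 \<le> t\<^sup>2" "0 < M\<^sup>2" using t m by (auto intro!: power_mono)
    have "R * F' m m' x + \<theta> = R * (F' m m' x + g * (real m' - real m) / (real m * real m'))"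
      by (simp add: \<theta>_def distrib_left mult_ac)
    also have "\<dots> = - (R * (real m' - real m) * (G (x / t\<^sup>2) - g) / t\<^sup>2)" unfolding t(3) by simp
    finally have "\<bar>R * F' m m' x + \<theta>\<bar> = R * (real m' - real m) * \<bar>G (x / t\<^sup>2) - g\<bar> / t\<^sup>2"
      using assms(1) mm by (simp add: abs_mult)
    also have "\<dots> \<le> R * (real m' - real m) * K / M\<^sup>2"
      using tM assms(1) mm G[OF ratio_in_window(1,2)[OF mm x, of t]] t
      by (intro frac_le mult_left_mono mult_nonneg_nonneg) auto
    finally show ?thesis by (simp add: W_def mult_ac)
  qed
  \<comment> \<open>The slope is close to \<open>- \<theta>\<close>: it lies just below
    \<open>- \<nu>\<close> if \<open>\<theta>\<close> exceeds \<open>\<nu>\<close>, and just above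
    otherwise. This selects the unit interval.\<close>
  define k where "k = (if \<theta> \<ge> real_of_int \<nu> then - \<nu> - 1 else - \<nu>)"
  have "norm (\<Sum>n=l..h. e_fun (R * F m m' (real n))) \<le> 2 / (\<eta> / 2)"
  proof (rule kuzmin_landau'[where F' = "\<lambda>x. R * F' m m' x" and k = k])
    show "((\<lambda>x. R * F m m' x) has_real_derivative R * F' m m' x) (at x)" if "real l \<le> x" "x \<le> real h" for x
      by (intro DERIV_cmult deriv_F[OF mm x[OF that]])
    show "real_of_int k + \<eta> / 2 \<le> R * F' m m' x \<and> R * F' m m' x \<le> real_of_int k + 1 - \<eta> / 2"
      if "real l \<le> x" "x \<le> real h" for x
    proof -
      define y \<delta> where "y = R * F' m m' x" and "\<delta> = \<eta> / 2"
      have *: "- W \<le> y + \<theta>" "y + \<theta> \<le> W" "2 * W \<le> 2 * \<delta>" "4 * \<delta> \<le> 1"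
        using near[OF that] \<eta>' by (auto simp: y_def \<delta>_def abs_le_iff)
      have "real_of_int k + \<delta> \<le> y \<and> y \<le> real_of_int k + 1 - \<delta>"
      proof (cases "\<theta> \<ge> real_of_int \<nu>")
        case True
        then have "\<theta> - real_of_int \<nu> = 2 * \<delta>" "real_of_int k = - real_of_int \<nu> - 1"
          by (auto simp: \<delta>_def \<eta>_def k_def)
        then show ?thesis using * by linarith
      next
        case False
        then have "real_of_int \<nu> - \<theta> = 2 * \<delta>" "real_of_int k = - real_of_int \<nu>"
          by (auto simp: \<delta>_def \<eta>_def k_def)
        then show ?thesis using * by linarith
      qed
      then show ?thesis by (simp add: y_def \<delta>_def)
    qed
    have d: "((\<lambda>x. R * F' m m' x) has_real_derivative R * F'' m m' x) (at x)" if "real l \<le> x" "x \<le> real h" for x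
      by (intro DERIV_cmult deriv_F'[OF mm x[OF that]])
    \<comment> \<open>The constant sign of \<open>G1\<close> passes to \<open>F''\<close> and makes
      the slope monotone.\<close>
    have sgn: "s * F'' m m' x \<le> 0" if "real l \<le> x" "x \<le> real h" for x
    proof -
      note x = x[OF that]
      obtain t where t: "real m < t" "t < real m'" "F'' m m' x = - ((real m' - real m) * G1 (x / t\<^sup>2) / t ^ 4)"
        using F''_mvt[OF mm x] by blast
      have "s * F'' m m' x = - ((real m' - real m) * (s * G1 (x / t\<^sup>2)) / t ^ 4)" unfolding t(3) by simp
      moreover have "0 \<le> s * G1 (x / t\<^sup>2)" using G1 ratio_in_window(1,2)[OF mm x, of t] t by auto
      ultimately show ?thesis using mm by simp
    qed
    show "mono_on {real l..real h} (\<lambda>x. R * F' m m' x) \<or> antimono_on {real l..real h} (\<lambda>x. R * F' m m' x)"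
    proof (cases "s = 1")
      case True
      have "R * F' m m' y \<le> R * F' m m' x" if "real l \<le> x" "x \<le> y" "y \<le> real h" for x y
      proof (rule DERIV_nonpos_imp_nonincreasing[OF that(2)])
        fix z assume "x \<le> z" "z \<le> y"
        then have "real l \<le> z" "z \<le> real h" using that by auto
        then show "\<exists>D. ((\<lambda>x. R * F' m m' x) has_real_derivative D) (at z) \<and> D \<le> 0"
          using d sgn True assms(1) by (intro exI[of _ "R * F'' m m' z"]) (auto intro: mult_nonneg_nonpos)
      qed
      then show ?thesis by (auto simp: monotone_on_def)
    next
      case False
      then have "s = -1" using s by auto
      have "R * F' m m' x \<le> R * F' m m' y" if "real l \<le> x" "x \<le> y" "y \<le> real h" for x y
      proof (rule DERIV_nonneg_imp_nondecreasing[OF that(2)])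
        fix z assume "x \<le> z" "z \<le> y"
        then have "real l \<le> z" "z \<le> real h" using that by auto
        then show "\<exists>D. ((\<lambda>x. R * F' m m' x) has_real_derivative D) (at z) \<and> 0 \<le> D"
          using d sgn \<open>s = -1\<close> assms(1) by (intro exI[of _ "R * F'' m m' z"]) auto
      qed
      then show ?thesis by (auto simp: monotone_on_def)
    qed
  qed (use \<eta>' 2 in auto)
  then show ?thesis using 2(1) by (simp add: T_def \<eta>_def)
qed

end

end

section \<open>Values close to integers\<close>

lemma harm_Suc_le: "harm (Suc n) \<le> ln (real (Suc n)) + 1"
  using decseqD[OF decseq_harm_diff_ln, of 0 n] by (simp add: harm_expand harm_Suc)

text \<open>Splitting at \<open>k\<close>, the integer part of \<open>A\<close>, leaves a harmonic
  sum on each side: \<open>1 + \<bar>A - n\<bar>\<close> is at least \<open>k - n + 1\<close> to the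
  left and at least \<open>n - k\<close> to the right.\<close>

lemma sum_inverse_distance_le:
  assumes "finite Q" "Q \<subseteq> {..N}" "0 \<le> A" "A \<le> real N"
  shows "(\<Sum>n\<in>Q. 1 / (1 + \<bar>A - real n\<bar>)) \<le> 2 * (1 + ln (real N + 1))"
proof -
  define k where "k = nat \<lfloor>A\<rfloor>"
  have k: "real k \<le> A" "A < real k + 1" "k \<le> N" unfolding k_def using assms(3,4) by linarith+
  have "(\<Sum>n\<in>Q. 1 / (1 + \<bar>A - real n\<bar>)) \<le> (\<Sum>n\<in>{..N}. 1 / (1 + \<bar>A - real n\<bar>))"
    using assms(2) by (intro sum_mono2) auto
  also have "{..N} = {..k} \<union> {k<..N}" using k by auto
  also have "(\<Sum>n\<in>\<dots>. 1 / (1 + \<bar>A - real n\<bar>)) = (\<Sum>n\<in>{..k}. 1 / (1 + \<bar>A - real n\<bar>)) + (\<Sum>n\<in>{k<..N}. 1 / (1 + \<bar>A - real n\<bar>))"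
    by (rule sum.union_disjoint) auto
  also have "(\<Sum>n\<in>{..k}. 1 / (1 + \<bar>A - real n\<bar>)) \<le> (\<Sum>n\<in>{..k}. 1 / real (Suc (k - n)))"
    using k by (intro sum_mono frac_le) (auto simp: of_nat_diff)
  also have "\<dots> = (\<Sum>i\<in>{1..Suc k}. 1 / real i)"
    by (rule sum.reindex_bij_witness[where i = "\<lambda>i. Suc k - i" and j = "\<lambda>n. Suc k - n"]) (auto simp: Suc_diff_le)
  also have "\<dots> = harm (Suc k)" by (simp add: harm_def inverse_eq_divide)
  also have "\<dots> \<le> ln (real (Suc k)) + 1" by (rule harm_Suc_le)
  also have "\<dots> \<le> ln (real N + 1) + 1" using k by simp
  also have "(\<Sum>n\<in>{k<..N}. 1 / (1 + \<bar>A - real n\<bar>)) \<le> (\<Sum>n\<in>{k<..N}. 1 / real (n - k))"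
    using k by (intro sum_mono frac_le) (auto simp: of_nat_diff)
  also have "\<dots> = (\<Sum>i\<in>{1..N-k}. 1 / real i)"
    by (rule sum.reindex_bij_witness[where i = "\<lambda>i. k + i" and j = "\<lambda>n. n - k"]) auto
  also have "\<dots> = harm (N - k)" by (simp add: harm_def inverse_eq_divide)
  also have "\<dots> \<le> harm (Suc N)" unfolding harm_def by (intro sum_mono2) auto
  also have "\<dots> \<le> ln (real N + 1) + 1" using harm_Suc_le[of N] by (simp add: add.commute)
  finally show ?thesis by (simp add: algebra_simps)
qed

text \<open>For fixed \<open>d\<close> the points \<open>m\<close> at which \<open>A / (m (m + d))\<close> is close to an integer \<open>\<nu> \<ge> 1\<close> are
  counted through the integer \<open>\<nu> m (m + d)\<close> near \<open>A\<close>, which has few divisors \<open>m\<close>.\<close>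

locale near_integers =
  fixes A M :: real and d :: nat and S :: "nat set"
  assumes A: "0 < A" and M: "1/2 \<le> M" and d: "1 \<le> d"
    and S: "S = {m. M \<le> real m \<and> real (m + d) < 2 * M}"
begin

definition \<theta> :: "nat \<Rightarrow> real" where "\<theta> m = A / (real m * real (m + d))"
definition \<nu> :: "nat \<Rightarrow> int" where "\<nu> m = round (\<theta> m)"
definition \<eta> :: "nat \<Rightarrow> real" where "\<eta> m = \<bar>\<theta> m - real_of_int (\<nu> m)\<bar>"
definition P :: "nat \<Rightarrow> nat" where "P m = nat (\<nu> m) * (m * (m + d))"

lemma finite_S: "finite S"
  unfolding S by (rule finite_subset[of _ "{..nat \<lceil>2 * M\<rceil>}"]) (auto, linarith)

lemma S_pos: "m \<in> S \<Longrightarrow> 0 < m" using M by (cases m) (auto simp: S)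

lemma \<theta>_pos: "m \<in> S \<Longrightarrow> 0 < \<theta> m"
  using S_pos[of m] A by (simp add: \<theta>_def)

lemma product_bounds:
  assumes "m \<in> S"
  shows "M\<^sup>2 \<le> real m * real (m + d)" "real m * real (m + d) \<le> 4 * M\<^sup>2"
proof -
  have m: "M \<le> real m" "M \<le> real (m + d)" "real m \<le> 2 * M" "real (m + d) \<le> 2 * M" "0 < M"
    using assms M by (auto simp: S)
  show "M\<^sup>2 \<le> real m * real (m + d)" using m unfolding power2_eq_square by (intro mult_mono) auto
  have "real m * real (m + d) \<le> (2 * M) * (2 * M)" using m by (intro mult_mono) auto
  then show "real m * real (m + d) \<le> 4 * M\<^sup>2" by (simp add: power2_eq_square)
qed

lemma \<theta>_bounds:
  assumes "m \<in> S"
  shows "A / (4 * M\<^sup>2) \<le> \<theta> m" "\<theta> m \<le> A / M\<^sup>2"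
  using product_bounds[OF assms] A M S_pos[OF assms] unfolding \<theta>_def by (auto intro!: frac_le)

lemma \<eta>_le: "\<eta> m \<le> 1/2"
  unfolding \<eta>_def \<nu>_def using of_int_round_abs_le[of "\<theta> m"] by (simp add: abs_minus_commute)

lemma \<nu>_nonneg: "m \<in> S \<Longrightarrow> 0 \<le> \<nu> m"
  using \<theta>_pos[of m] unfolding \<nu>_def round_def by simp

text \<open>As \<open>A = \<theta> m * (m * (m + d))\<close>, multiplication by
  \<open>m * (m + d)\<close> turns the distance of \<open>\<theta> m\<close> to
  \<open>\<nu> m\<close> into that of \<open>P m\<close> to \<open>A\<close>.\<close>

lemma P_near:
  assumes "m \<in> S"
  shows "\<bar>A - real (P m)\<bar> = \<eta> m * (real m * real (m + d))"
proof -
  have p: "0 < real m * real (m + d)" using S_pos[OF assms] by simp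
  have "real (P m) = real_of_int (\<nu> m) * (real m * real (m + d))"
    using \<nu>_nonneg[OF assms] by (simp add: P_def)
  moreover have "A = \<theta> m * (real m * real (m + d))" using p unfolding \<theta>_def by (metis less_irrefl nonzero_divide_eq_eq)
  ultimately have "A - real (P m) = (\<theta> m - real_of_int (\<nu> m)) * (real m * real (m + d))"
    by (simp add: left_diff_distrib)
  then show ?thesis unfolding \<eta>_def using p by (simp add: abs_mult)
qed

lemma P_near':
  assumes "m \<in> S"
  shows "\<bar>A - real (P m)\<bar> \<le> \<eta> m * (4 * M\<^sup>2)"
  unfolding P_near[OF assms] using product_bounds[OF assms] by (intro mult_left_mono) (auto simp: \<eta>_def)

lemma P_le: "m \<in> S \<Longrightarrow> real (P m) \<le> A + 2 * M\<^sup>2"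
proof -
  assume m: "m \<in> S"
  have "\<eta> m * (4 * M\<^sup>2) \<le> 1/2 * (4 * M\<^sup>2)" using \<eta>_le by (intro mult_right_mono) auto
  then show ?thesis using P_near'[OF m] by (simp add: abs_le_iff)
qed

text \<open>Every \<open>m\<close> divides \<open>P m\<close>, so a fibre of \<open>P\<close> has at
  most as many elements as \<open>P m\<close> has divisors. The condition
  \<open>\<nu> m \<ge> 1\<close> excludes \<open>P m = 0\<close>, which every \<open>m\<close>
  divides.\<close>

lemma sum_over_P:
  fixes f :: "nat \<Rightarrow> real" and K :: real
  assumes Y: "Y \<subseteq> S" "\<And>m. m \<in> Y \<Longrightarrow> 1 \<le> \<nu> m" and f: "\<And>n. 0 \<le> f n"
    and K: "\<And>n. 0 < n \<Longrightarrow> real n \<le> A + 2 * M\<^sup>2 \<Longrightarrow> real (card {e. e dvd n}) \<le> K"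
  shows "(\<Sum>m\<in>Y. f (P m)) \<le> K * (\<Sum>n\<in>P ` Y. f n)"
proof -
  have finY: "finite Y" using Y(1) finite_S by (rule finite_subset)
  have pos: "0 < P m" if "m \<in> Y" for m
    using Y(2)[OF that] S_pos[of m] Y(1) that by (auto simp: P_def)
  have "(\<Sum>m\<in>Y. f (P m)) = (\<Sum>n\<in>P ` Y. \<Sum>m\<in>{m\<in>Y. P m = n}. f (P m))"
    by (rule sum.image_gen[OF finY])
  also have "\<dots> \<le> (\<Sum>n\<in>P ` Y. K * f n)"
  proof (rule sum_mono)
    fix n assume n: "n \<in> P ` Y"
    then have n0: "0 < n" "real n \<le> A + 2 * M\<^sup>2" using pos P_le Y(1) by auto
    have "{m\<in>Y. P m = n} \<subseteq> {e. e dvd n}" unfolding P_def by auto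
    then have "card {m\<in>Y. P m = n} \<le> card {e. e dvd n}" using n0 by (intro card_mono finite_divisors_nat) auto
    then have "real (card {m\<in>Y. P m = n}) \<le> K" using K[OF n0] by linarith
    then have "real (card {m\<in>Y. P m = n}) * f n \<le> K * f n" using f by (intro mult_right_mono) auto
    then show "(\<Sum>m\<in>{m\<in>Y. P m = n}. f (P m)) \<le> K * f n" by simp
  qed
  finally show ?thesis by (simp add: sum_distrib_left)
qed

text \<open>Since \<open>\<bar>A - P m\<bar> \<le> 4 * \<eta> m * M^2\<close>, the two bounds on
  \<open>f\<close> combine to a multiple of \<open>M^2 / (1 + \<bar>A - P m\<bar>)\<close>. Over
  distinct integers \<open>P m\<close> this sums to a logarithm.\<close>

lemma sum_le_of_near:
  fixes K B :: real
  assumes Y: "Y \<subseteq> S" "\<And>m. m \<in> Y \<Longrightarrow> 1 \<le> \<nu> m" "\<And>m. m \<in> Y \<Longrightarrow> 0 < \<eta> m"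
    and f: "\<And>m. m \<in> Y \<Longrightarrow> f m \<le> 4 / \<eta> m" "\<And>m. m \<in> Y \<Longrightarrow> f m \<le> B * M\<^sup>2" and "0 \<le> B"
    and K: "\<And>n. 0 < n \<Longrightarrow> real n \<le> A + 2 * M\<^sup>2 \<Longrightarrow> real (card {e. e dvd n}) \<le> K" "0 \<le> K"
    and N: "A + 2 * M\<^sup>2 \<le> real N"
  shows "(\<Sum>m\<in>Y. f m) \<le> (16 + B) * M\<^sup>2 * K * (2 * (1 + ln (real N + 1)))"
proof -
  have le: "f m \<le> (16 + B) * M\<^sup>2 * (1 / (1 + \<bar>A - real (P m)\<bar>))" if "m \<in> Y" for m
  proof -
    let ?x = "\<bar>A - real (P m)\<bar>"
    have mS: "m \<in> S" using that Y(1) by blast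
    have x: "?x \<le> \<eta> m * (4 * M\<^sup>2)" by (rule P_near'[OF mS])
    have "f m * ?x \<le> 16 * M\<^sup>2"
    proof (cases "f m \<le> 0")
      case True
      then have "f m * ?x \<le> 0" by (intro mult_nonpos_nonneg) auto
      then show ?thesis by (rule order_trans) simp
    next
      case False
      then have "f m * ?x \<le> (4 / \<eta> m) * (\<eta> m * (4 * M\<^sup>2))" using f(1)[OF that] x Y(3)[OF that]
        by (intro mult_mono) auto
      then show ?thesis using Y(3)[OF that] by simp
    qed
    then have "f m * (1 + ?x) \<le> (16 + B) * M\<^sup>2" using f(2)[OF that] by (simp add: algebra_simps)
    then show ?thesis by (simp add: pos_le_divide_eq)
  qed
  have "(\<Sum>m\<in>Y. f m) \<le> (\<Sum>m\<in>Y. (16 + B) * M\<^sup>2 * (1 / (1 + \<bar>A - real (P m)\<bar>)))"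
    by (intro sum_mono le)
  also have "\<dots> = (16 + B) * M\<^sup>2 * (\<Sum>m\<in>Y. 1 / (1 + \<bar>A - real (P m)\<bar>))"
    by (simp only: sum_distrib_left)
  also have "\<dots> \<le> (16 + B) * M\<^sup>2 * (K * (\<Sum>n\<in>P ` Y. 1 / (1 + \<bar>A - real n\<bar>)))"
    using assms by (intro mult_left_mono sum_over_P[of Y "\<lambda>n. 1 / (1 + \<bar>A - real n\<bar>)"]) auto
  also have "\<dots> \<le> (16 + B) * M\<^sup>2 * (K * (2 * (1 + ln (real N + 1))))"
  proof (intro mult_left_mono sum_inverse_distance_le)
    have "P m \<le> N" if "m \<in> Y" for m
    proof -
      have "real (P m) \<le> real N" using P_le[of m] Y(1) that N by auto
      then show ?thesis by simp
    qed
    then show "P ` Y \<subseteq> {..N}" by auto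
    have "0 \<le> 2 * M\<^sup>2" by simp
    then show "A \<le> real N" using N by linarith
  qed (use assms A finite_subset[OF Y(1) finite_S] in auto)
  finally show ?thesis by (simp add: mult_ac)
qed

text \<open>The integers \<open>P m\<close> lie in an interval of length
  \<open>8 * \<omega> * M^2\<close> around \<open>A\<close>, and each arises from at most
  \<open>K\<close> values \<open>m\<close>.\<close>

lemma card_near_by_divisors:
  assumes Y: "Y \<subseteq> S" "\<And>m. m \<in> Y \<Longrightarrow> 1 \<le> \<nu> m" "\<And>m. m \<in> Y \<Longrightarrow> \<eta> m \<le> \<omega>" "0 \<le> \<omega>"
    and K: "\<And>n. 0 < n \<Longrightarrow> real n \<le> A + 2 * M\<^sup>2 \<Longrightarrow> real (card {e. e dvd n}) \<le> K" "0 \<le> K"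
  shows "real (card Y) \<le> K * (8 * \<omega> * M\<^sup>2 + 1)"
proof -
  have finY: "finite Y" using Y(1) finite_S by (rule finite_subset)
  have "real (card Y) = (\<Sum>m\<in>Y. (\<lambda>_. 1) (P m))" by simp
  also have "\<dots> \<le> K * (\<Sum>n\<in>P ` Y. (\<lambda>_. 1) n)"
    by (rule sum_over_P[OF Y(1,2) _ K(1)]) auto
  also have "\<dots> = K * real (card (P ` Y))" by simp
  also have "\<dots> \<le> K * ((8 * \<omega> * M\<^sup>2) / 1 + 1)"
  proof (intro mult_left_mono card_le_of_separated[where g = real and a = "A - 4 * \<omega> * M\<^sup>2"])
    fix n assume "n \<in> P ` Y"
    then obtain m where m: "m \<in> Y" "n = P m" by blast
    have "\<bar>A - real n\<bar> \<le> \<eta> m * (4 * M\<^sup>2)" unfolding m(2) using P_near' Y(1) m by blast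
    also have "\<dots> \<le> \<omega> * (4 * M\<^sup>2)" using Y(3)[OF m(1)] by (intro mult_right_mono) auto
    finally show "A - 4 * \<omega> * M\<^sup>2 \<le> real n \<and> real n \<le> A - 4 * \<omega> * M\<^sup>2 + 8 * \<omega> * M\<^sup>2"
      by (simp add: abs_le_iff mult_ac)
  qed (use finY Y(4) K in auto)
  finally show ?thesis by simp
qed

text \<open>\<open>\<theta> m - \<theta> n = A * (q - p) / (p * q)\<close> with
  \<open>q - p \<ge> 2 * M * (n - m)\<close> and \<open>p\<close>, \<open>q\<close> at most
  \<open>4 * M^2\<close>; the constant is \<open>2 / 16\<close>.\<close>

lemma \<theta>_separated:
  assumes "m \<in> S" "n \<in> S" "m \<le> n"
  shows "A / (8 * M ^ 3) * (real n - real m) \<le> \<bar>\<theta> n - \<theta> m\<bar>"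
proof -
  define p q x where "p = real m * real (m + d)" and "q = real n * real (n + d)" and "x = real n - real m"
  have pos: "0 < p" "0 < q" using S_pos[OF assms(1)] S_pos[OF assms(2)] by (auto simp: p_def q_def)
  have M0: "0 < M" using M by simp
  have x: "0 \<le> x" using assms by (simp add: x_def)
  have b: "p \<le> 4 * M\<^sup>2" "q \<le> 4 * M\<^sup>2" using product_bounds assms unfolding p_def q_def by auto
  have "q - p = x * (real n + real m + real d)" by (simp add: p_def q_def x_def algebra_simps)
  moreover have "x * (2 * M) \<le> x * (real n + real m + real d)"
    using assms x by (intro mult_left_mono) (auto simp: S)
  ultimately have qp: "x * (2 * M) \<le> q - p" by linarith
  have qp0: "0 \<le> q - p" using qp x M0 by (rule_tac order_trans[of _ "x * (2 * M)"]) auto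
  have "A * (x * (2 * M)) / ((4 * M\<^sup>2) * (4 * M\<^sup>2)) \<le> A * (q - p) / (p * q)"
    using A M0 by (intro frac_le mult_left_mono qp mult_mono b mult_nonneg_nonneg qp0 mult_pos_pos pos less_imp_le[OF pos(2)]) auto
  also have "\<dots> = A / p - A / q" using pos by (simp add: field_simps)
  also have "\<dots> = \<theta> m - \<theta> n" by (simp add: \<theta>_def p_def q_def)
  finally have "A * (x * (2 * M)) / ((4 * M\<^sup>2) * (4 * M\<^sup>2)) \<le> \<bar>\<theta> n - \<theta> m\<bar>" by linarith
  moreover have "A * (x * (2 * M)) / ((4 * M\<^sup>2) * (4 * M\<^sup>2)) = A / (8 * M ^ 3) * x"
    using M0 by (simp add: field_simps eval_nat_numeral)
  ultimately show ?thesis by (simp add: x_def)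
qed

text \<open>For each integer the separation of \<open>\<theta>\<close> limits the \<open>m\<close>
  with \<open>\<theta> m\<close> close to it, and about \<open>A / M^2\<close> integers occur.
  Compared with the divisor count, the term in \<open>\<omega>\<close> is smaller by a factor
  \<open>M\<close>, at the price of \<open>A / M^2\<close>.\<close>

lemma card_near_by_spacing:
  assumes Y: "Y \<subseteq> S" "\<And>m. m \<in> Y \<Longrightarrow> 1 \<le> \<nu> m" "\<And>m. m \<in> Y \<Longrightarrow> \<eta> m \<le> \<omega>" "0 \<le> \<omega>"
  shows "real (card Y) \<le> 48 * \<omega> * M + 3 * A / M\<^sup>2"
proof (cases "Y = {}")
  case False
  have M0: "0 < M" using M by simp
  have finY: "finite Y" using Y(1) finite_S by (rule finite_subset)
  have \<nu>_le: "real_of_int (\<nu> m) \<le> A / M\<^sup>2 + 1/2" if "m \<in> Y" for m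
    using \<theta>_bounds(2)[of m] of_int_round_le[of "\<theta> m"] Y(1) that unfolding \<nu>_def by auto
  obtain m0 where "m0 \<in> Y" using False by blast
  \<comment> \<open>As some \<open>\<nu> m \<ge> 1\<close> occurs, \<open>A / M^2\<close> is bounded
    below; this absorbs the additive 1/2 in the number of integers.\<close>
  then have AM: "1/2 \<le> A / M\<^sup>2" using \<nu>_le[of m0] Y(2)[of m0] by linarith
  have fib: "real (card {m\<in>Y. \<nu> m = k}) \<le> (2 * \<omega>) / (A / (8 * M ^ 3)) + 1" for k
  proof (rule card_le_of_separated[where g = \<theta> and a = "real_of_int k - \<omega>"])
    show "real_of_int k - \<omega> \<le> \<theta> m \<and> \<theta> m \<le> real_of_int k - \<omega> + 2 * \<omega>" if "m \<in> {m\<in>Y. \<nu> m = k}" for m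
      using Y(3)[of m] that unfolding \<eta>_def by (auto simp: abs_le_iff)
    show "A / (8 * M ^ 3) * (real n - real m) \<le> \<bar>\<theta> n - \<theta> m\<bar>"
      if "m \<in> {m\<in>Y. \<nu> m = k}" "n \<in> {m\<in>Y. \<nu> m = k}" "m \<le> n" for m n
      using that Y(1) by (intro \<theta>_separated) auto
  qed (use finY A M0 Y(4) in auto)
  have "card Y = (\<Sum>k\<in>\<nu> ` Y. card {m\<in>Y. \<nu> m = k})"
    using sum.image_gen[OF finY, of "\<lambda>_. 1::nat" \<nu>] by simp
  then have "real (card Y) = (\<Sum>k\<in>\<nu> ` Y. real (card {m\<in>Y. \<nu> m = k}))" by simp
  also have "\<dots> \<le> real (card (\<nu> ` Y)) * ((2 * \<omega>) / (A / (8 * M ^ 3)) + 1)"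
    by (intro sum_bounded_above fib)
  also have "\<dots> \<le> (3 * A / M\<^sup>2) * ((2 * \<omega>) / (A / (8 * M ^ 3)) + 1)"
  proof (rule mult_right_mono)
    have "\<nu> ` Y \<subseteq> {1..\<lfloor>A / M\<^sup>2 + 1/2\<rfloor>}" using Y(2) \<nu>_le by (auto simp: le_floor_iff)
    then have "card (\<nu> ` Y) \<le> nat \<lfloor>A / M\<^sup>2 + 1/2\<rfloor>" using card_mono[of "{1..\<lfloor>A / M\<^sup>2 + 1/2\<rfloor>}"] by simp
    moreover have "real (nat \<lfloor>A / M\<^sup>2 + 1/2\<rfloor>) \<le> A / M\<^sup>2 + 1/2" using AM by (intro of_nat_floor) linarith
    ultimately have "real (card (\<nu> ` Y)) \<le> A / M\<^sup>2 + 1/2" by linarith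
    then show "real (card (\<nu> ` Y)) \<le> 3 * A / M\<^sup>2" using AM by simp
  qed (use A M0 Y(4) in auto)
  also have "\<dots> = 48 * \<omega> * M + 3 * A / M\<^sup>2" using A M0 by (simp add: field_simps eval_nat_numeral)
  finally show ?thesis .
qed (use A M Y(4) in simp)

end

section \<open>Correlation sums\<close>

text \<open>\<open>V\<close> is the size of \<open>G1\<close> on the window, while \<open>c\<close>,
  \<open>C\<close> and \<open>B\<close> are to be uniform over all windows, so the final bounds must
  depend on the window only through these. The bound on \<open>(U2 - U1) * sqrt V\<close> controls
  the main term of the second derivative test even when \<open>V\<close> is large.\<close>

locale differenced_sum = phase_window +
  fixes c C B V R M s :: real and d :: nat
  assumes c: "0 < c" "c \<le> C" and V: "0 < V" and s: "s \<in> {1, -1}"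
    and G1: "\<And>u. U1 \<le> u \<Longrightarrow> u \<le> U2 \<Longrightarrow> c * V \<le> s * G1 u \<and> s * G1 u \<le> C * V"
    and B: "U2 - U1 \<le> B" "(U2 - U1) * sqrt V \<le> B"
    and R: "1 \<le> R" and M: "1/2 \<le> M" "2 * M \<le> R powr (5/8)" and d: "1 \<le> d" "real d \<le> sqrt R"
begin

definition S :: "nat set" where "S = {m. M \<le> real m \<and> real (m + d) < 2 * M}"
definition E :: real where "E = R powr (3/4)"
text \<open>Up to a constant, \<open>q / M^2\<close> is the root of the second derivative of the
  phase; in terms of \<open>q\<close> the test yields \<open>U * q + M^2 / q + 1\<close>.\<close>

definition q :: real where "q = sqrt (V * R * real d)"
definition U :: real where "U = U2 - U1"

lemma U_pos: "0 < U" and U_le: "U \<le> B" "U * sqrt V \<le> B" and B_pos: "0 < B"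
  using window B by (auto simp: U_def)

lemma q_pos: "0 < q" and q_square: "q\<^sup>2 = V * R * real d"
  unfolding q_def using V R d by auto

lemma E_ge_1: "1 \<le> E" unfolding E_def using R by (simp add: ge_one_powr_ge_zero)

lemma E_square: "E\<^sup>2 = R * sqrt R"
proof -
  have "E\<^sup>2 = R powr (3/2)" unfolding E_def power2_eq_square by (simp flip: powr_add)
  also have "\<dots> = R powr (1 + 1/2)" by simp
  also have "\<dots> = R * sqrt R" using R by (simp only: powr_add powr_half_sqrt) simp
  finally show ?thesis .
qed

text \<open>The restriction of the shifts to \<open>d \<le> sqrt R\<close> enters here.\<close>

lemma Rd_le: "R * real d \<le> E\<^sup>2"
  unfolding E_square using d R by (intro mult_left_mono) auto

lemma sqrt_Rd_le: "sqrt (R * real d) \<le> E"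
  using real_sqrt_le_mono[OF Rd_le] E_ge_1 by simp

lemma q_eq: "q = sqrt V * sqrt (R * real d)" unfolding q_def by (simp add: real_sqrt_mult)

lemma Uq_le: "U * q \<le> B * E"
proof -
  have "U * q = (U * sqrt V) * sqrt (R * real d)" by (simp add: q_eq)
  also have "\<dots> \<le> B * E" using U_le sqrt_Rd_le B_pos V U_pos R by (intro mult_mono) auto
  finally show ?thesis .
qed

text \<open>The hypothesis on \<open>M\<close> enters here, through
  \<open>2 * (5/8) = 1/2 + 3/4\<close>.\<close>

lemma M_square_le: "M\<^sup>2 \<le> sqrt R * E"
proof -
  have "M \<le> R powr (5/8)" using M by linarith
  then have "M\<^sup>2 \<le> (R powr (5/8))\<^sup>2" using M by (intro power_mono) auto
  also have "\<dots> = R powr (1/2 + 3/4)" unfolding power2_eq_square by (simp flip: powr_add)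
  also have "\<dots> = sqrt R * E" using R by (simp only: powr_add powr_half_sqrt E_def)
  finally show ?thesis .
qed

lemma M_square_le_ME: "M\<^sup>2 \<le> M * E"
proof -
  have "M \<le> R powr (5/8)" using M by linarith
  also have "\<dots> \<le> E" unfolding E_def using R by (intro powr_mono) auto
  finally show ?thesis using M unfolding power2_eq_square by (intro mult_left_mono) auto
qed

lemma M_square_le_RE: "M\<^sup>2 \<le> R * E"
proof -
  have "sqrt R \<le> R" using R by (simp add: real_sqrt_le_iff' real_le_lsqrt power2_eq_square)
  then have "sqrt R * E \<le> R * E" using E_ge_1 by (intro mult_right_mono) auto
  then show ?thesis using M_square_le by linarith
qed

lemma one_le_M_square: "1 \<le> 4 * M\<^sup>2"
proof -
  have "(1/2)\<^sup>2 \<le> M\<^sup>2" using M by (intro power_mono) auto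
  then show ?thesis by (simp add: power2_eq_square)
qed

abbreviation term_norm :: "nat \<Rightarrow> real" where "term_norm m \<equiv> norm (T R m (m + d))"

context
  fixes m assumes m: "m \<in> S"
begin

lemma m_bounds: "0 < M" "M \<le> real m" "m < m + d" "real (m + d) < 2 * M"
  using m M d by (auto simp: S_def)

lemma term_trivial: "term_norm m \<le> (4 * B + 4) * M\<^sup>2"
proof -
  have "term_norm m \<le> 4 * U * M\<^sup>2 + 1" unfolding U_def by (rule T_trivial[OF m_bounds])
  also have "\<dots> \<le> 4 * B * M\<^sup>2 + 4 * M\<^sup>2"
    using U_le one_le_M_square by (intro add_mono mult_right_mono mult_left_mono) auto
  finally show ?thesis by (simp add: algebra_simps)
qed

lemma term_second_derivative: "term_norm m \<le> 80 * C / sqrt c * (U * q) + 40 / sqrt c * (M\<^sup>2 / q) + 1"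
proof -
  define \<mu> where "\<mu> = c * V * R * (real (m + d) - real m) / (16 * M ^ 4)"
  have "term_norm m \<le> 320 * C / c * U * M\<^sup>2 * sqrt \<mu> + 10 / sqrt \<mu> + 1"
    unfolding U_def \<mu>_def using R by (intro T_second_derivative[OF m_bounds c V _ s G1]) auto
  moreover have "sqrt \<mu> = sqrt c * q / (4 * M\<^sup>2)"
  proof -
    have "M ^ 4 = (M\<^sup>2)\<^sup>2" by (simp flip: power_mult)
    then have "\<mu> = c * (V * R * real d) / (4 * M\<^sup>2)\<^sup>2" by (simp add: \<mu>_def power_mult_distrib mult_ac)
    then have "sqrt \<mu> = sqrt c * q / \<bar>4 * M\<^sup>2\<bar>"
      by (simp only: real_sqrt_divide real_sqrt_mult real_sqrt_abs q_def)
    then show ?thesis by simp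
  qed
  moreover have "320 * C / c * U * M\<^sup>2 * (sqrt c * q / (4 * M\<^sup>2)) = 80 * C / sqrt c * (U * q)"
  proof -
    have "c = sqrt c * sqrt c" using c by simp
    then have "320 * C / c * U * M\<^sup>2 * (sqrt c * q / (4 * M\<^sup>2))
      = 320 * C / (sqrt c * sqrt c) * U * M\<^sup>2 * (sqrt c * q / (4 * M\<^sup>2))" by simp
    also have "\<dots> = 80 * C / sqrt c * (U * q)" using c m_bounds(1) by (simp add: field_simps del: real_sqrt_mult_self)
    finally show ?thesis .
  qed
  moreover have "10 / (sqrt c * q / (4 * M\<^sup>2)) = 40 / sqrt c * (M\<^sup>2 / q)" using c q_pos m_bounds(1) by simp
  ultimately show ?thesis by simp
qed

end

lemma finite_S: "finite S"
  unfolding S_def by (rule finite_subset[of _ "{..nat \<lceil>2 * M\<rceil>}"]) (auto, linarith)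

lemma card_S: "real (card S) \<le> 3 * M"
proof -
  have "real (card S) \<le> M / 1 + 1"
    by (rule card_le_of_separated[OF finite_S, of 1 M real M]) (use M in \<open>auto simp: S_def\<close>)
  then show ?thesis using M by simp
qed

lemma sum_le_of_uniform:
  assumes "\<And>m. m \<in> Y \<Longrightarrow> f m \<le> K * E" "Y \<subseteq> S" "0 \<le> K"
  shows "(\<Sum>m\<in>Y. f m) \<le> 3 * K * M * E"
proof -
  have "real (card Y) \<le> 3 * M" using card_mono[OF finite_S assms(2)] card_S by linarith
  then have "real (card Y) * (K * E) \<le> 3 * M * (K * E)" using assms E_ge_1 by (intro mult_right_mono) auto
  moreover have "(\<Sum>m\<in>Y. f m) \<le> real (card Y) * (K * E)" by (intro sum_bounded_above assms)
  ultimately show ?thesis by (simp add: mult_ac)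
qed

text \<open>If \<open>V\<close> is bounded below, then \<open>q\<close> is at least of order
  \<open>sqrt R\<close>, and \<open>M^2 / q\<close> is of order \<open>E\<close>. The second
  derivative test then suffices for every single \<open>m\<close>.\<close>

lemma nondegenerate_bound:
  assumes "0 < v" "v \<le> V"
  shows "(\<Sum>m\<in>S. term_norm m) \<le> 3 * (80 * C / sqrt c * B + 40 / sqrt c * (1 / sqrt v) + 1) * M * E"
proof (rule sum_le_of_uniform)
  fix m assume "m \<in> S"
  have "M\<^sup>2 / q \<le> (sqrt R * E) / (sqrt v * sqrt R)"
  proof (rule frac_le)
    have "sqrt v * sqrt R \<le> sqrt V * sqrt (R * real d)" using assms d R by (intro mult_mono) auto
    then show "sqrt v * sqrt R \<le> q" by (simp add: q_eq)
  qed (use M_square_le E_ge_1 assms R in auto)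
  also have "\<dots> = 1 / sqrt v * E" using R by simp
  finally have *: "M\<^sup>2 / q \<le> 1 / sqrt v * E" .
  have "term_norm m \<le> 80 * C / sqrt c * (U * q) + 40 / sqrt c * (M\<^sup>2 / q) + 1"
    by (rule term_second_derivative) fact
  also have "\<dots> \<le> 80 * C / sqrt c * (B * E) + 40 / sqrt c * (1 / sqrt v * E) + 1 * E"
    using * Uq_le E_ge_1 c by (intro add_mono mult_left_mono) auto
  finally show "term_norm m \<le> (80 * C / sqrt c * B + 40 / sqrt c * (1 / sqrt v) + 1) * E"
    by (simp add: algebra_simps)
qed (use assms c B_pos in auto)

text \<open>No lower bound on \<open>V\<close> is available, so \<open>M^2 / q\<close> may exceed
  \<open>E\<close> for individual \<open>m\<close>. By Kuzmin--Landau only those \<open>m\<close>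
  matter for which \<open>\<theta> m\<close> lies within about \<open>W\<close> of an integer; their
  scarcity compensates. \<open>K\<close> bounds the divisor function and \<open>L\<close> a harmonic
  sum.\<close>

lemma degenerate_bound:
  fixes g K :: real and N :: nat
  assumes g: "0 < g" and Gg: "\<And>u. U1 \<le> u \<Longrightarrow> u \<le> U2 \<Longrightarrow> \<bar>G u - g\<bar> \<le> C * U * V"
    and UV: "16 * C * U * V \<le> g"
    and K: "\<And>n. 0 < n \<Longrightarrow> real n \<le> g * R * real d + 2 * M\<^sup>2 \<Longrightarrow> real (card {e. e dvd n}) \<le> K" "1 \<le> K"
    and N: "g * R * real d + 2 * M\<^sup>2 \<le> real N"
  defines "L \<equiv> 2 * (1 + ln (real N + 1))"
  defines "k2 \<equiv> 60 / sqrt c" and "b' \<equiv> 4 * B + 4"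
  shows "(\<Sum>m\<in>S. term_norm m) \<le>
    (3 * b' + 3 * (240 * C / sqrt c * B + 1) + 48 / g + (16 + b') + (16 * C * k2 + 4 + b')
      + (96 * k2 * C * B + 24 + 3 * g * k2 * B + 6 * g)) * K * L * M * E"
proof -
  have L: "1 \<le> L" unfolding L_def by simp
  have pos: "0 \<le> b'" "0 < k2" "0 < C" "0 < B" "0 < M" "0 < E" "0 < U"
    using B_pos c M E_ge_1 U_pos by (auto simp: b'_def k2_def)
  \<comment> \<open>\<open>W\<close> bounds the deviation of the slope from
    \<open>- \<theta>\<close>. The identity \<open>W * M^2 = C * U * q^2\<close> links it to the
    second derivative test.\<close>
  define W where "W = (C * U * V) * R * real d / M\<^sup>2"
  have W: "0 < W" "W * M\<^sup>2 = C * U * q\<^sup>2" unfolding W_def q_square using pos V R d by auto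
  have KL: "1 \<le> K * L" using K(2) L mult_mono[of 1 K 1 L] by simp
  have final: ?thesis if "(\<Sum>m\<in>S. term_norm m) \<le> x * (K * L) * (M * E)"
    "x \<le> 3 * b' + 3 * (240 * C / sqrt c * B + 1) + 48 / g + (16 + b') + (16 * C * k2 + 4 + b')
      + (96 * k2 * C * B + 24 + 3 * g * k2 * B + 6 * g)" for x
  proof -
    have "x * (K * L) * (M * E) \<le> (3 * b' + 3 * (240 * C / sqrt c * B + 1) + 48 / g + (16 + b') + (16 * C * k2 + 4 + b')
      + (96 * k2 * C * B + 24 + 3 * g * k2 * B + 6 * g)) * (K * L) * (M * E)"
      using that(2) KL pos by (intro mult_right_mono) auto
    then show ?thesis using that(1) by (simp only: mult.assoc)
  qed
  have absorb: "x * M * E \<le> x * (K * L) * (M * E)" if "0 \<le> x" for x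
    using mult_left_mono[OF KL, of "x * (M * E)"] that pos by (simp add: mult_ac)
  have nonneg: "0 \<le> 240 * C / sqrt c * B" "0 \<le> 48 / g" "0 \<le> 16 * C * k2" "0 \<le> 96 * k2 * C * B" "0 \<le> 3 * g * k2 * B"
    using pos c g by auto
  define x1 x2 x3 x4 x5 x6 where "x1 = 3 * b'" and "x2 = 3 * (240 * C / sqrt c * B + 1)" and "x3 = 48 / g"
    and "x4 = 16 + b'" and "x5 = 16 * C * k2 + 4 + b'" and "x6 = 96 * k2 * C * B + 24 + 3 * g * k2 * B + 6 * g"
  have grp: "0 \<le> x1" "0 \<le> x2" "0 \<le> x3" "0 \<le> x4" "0 \<le> x5" "0 \<le> x6"
    unfolding x1_def x2_def x3_def x4_def x5_def x6_def using pos nonneg g by (auto intro!: add_nonneg_nonneg)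
  have le: "x1 \<le> x1 + x2 + x3 + x4 + x5 + x6" "x2 \<le> x1 + x2 + x3 + x4 + x5 + x6"
    "x3 + (x4 + (x5 + x6)) \<le> x1 + x2 + x3 + x4 + x5 + x6"
    using grp by linarith+
  note le = le[unfolded x1_def x2_def x3_def x4_def x5_def x6_def]
  \<comment> \<open>For \<open>M^2 < E\<close> the trivial bound suffices. For
    \<open>W \<ge> 1/4\<close> slopes no longer single out an integer, but the term
    \<open>M^2 / q\<close> is then dominated by \<open>U * q\<close>.\<close>
  consider "M\<^sup>2 < E" | "1/4 \<le> W" | "E \<le> M\<^sup>2" "W < 1/4" by linarith
  then show ?thesis
  proof cases
    case 1
    have "(\<Sum>m\<in>S. term_norm m) \<le> 3 * b' * M * E"
    proof (rule sum_le_of_uniform)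
      fix m assume "m \<in> S"
      then have "term_norm m \<le> b' * M\<^sup>2" unfolding b'_def by (rule term_trivial)
      also have "\<dots> \<le> b' * E" using 1 pos by (intro mult_left_mono) auto
      finally show "term_norm m \<le> b' * E" .
    qed (use pos in auto)
    also have "\<dots> \<le> (3 * b') * (K * L) * (M * E)" using absorb[of "3 * b'"] pos by simp
    finally show ?thesis by (rule final[OF _ le(1)])
  next
    case 2
    have "M\<^sup>2 / q \<le> 4 * C * (U * q)"
    proof -
      have "1 * M\<^sup>2 \<le> (4 * W) * M\<^sup>2" using 2 by (intro mult_right_mono) auto
      then have "M\<^sup>2 \<le> 4 * C * (U * q) * q" using W(2) by (simp add: power2_eq_square mult_ac)
      then show ?thesis using q_pos by (simp add: pos_divide_le_eq)
    qed
    also have "\<dots> \<le> 4 * C * (B * E)" using Uq_le pos by (intro mult_left_mono) auto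
    finally have *: "M\<^sup>2 / q \<le> 4 * C * (B * E)" .
    have "(\<Sum>m\<in>S. term_norm m) \<le> 3 * (240 * C / sqrt c * B + 1) * M * E"
    proof (rule sum_le_of_uniform)
      fix m assume "m \<in> S"
      then have "term_norm m \<le> 80 * C / sqrt c * (U * q) + 40 / sqrt c * (M\<^sup>2 / q) + 1"
        by (rule term_second_derivative)
      also have "\<dots> \<le> 80 * C / sqrt c * (B * E) + 40 / sqrt c * (4 * C * (B * E)) + 1 * E"
        using * Uq_le E_ge_1 c by (intro add_mono mult_left_mono) auto
      finally show "term_norm m \<le> (240 * C / sqrt c * B + 1) * E"
        by (simp add: algebra_simps)
    qed (use nonneg in auto)
    also have "\<dots> \<le> (3 * (240 * C / sqrt c * B + 1)) * (K * L) * (M * E)"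
      using absorb[of "3 * (240 * C / sqrt c * B + 1)"] nonneg by simp
    finally show ?thesis by (rule final[OF _ le(2)])
  next
    case 3
    interpret N: near_integers "g * R * real d" M d S
      by unfold_locales (use g R d M in \<open>auto simp: S_def\<close>)
    have kl: "term_norm m \<le> 4 / N.\<eta> m" if "m \<in> S" "2 * W \<le> N.\<eta> m" for m
    proof -
      have \<eta>: "N.\<eta> m = \<bar>g * R * (real (m + d) - real m) / (real m * real (m + d)) - real_of_int (N.\<nu> m)\<bar>"
        by (simp add: N.\<eta>_def N.\<theta>_def)
      have "0 < N.\<eta> m" using that(2) W(1) by linarith
      then show ?thesis unfolding \<eta> using that(2) N.\<eta>_le[of m] R
        by (intro T_kuzmin_landau[OF m_bounds[OF that(1)] _ s, where K = "C * U * V"] Gg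
              order_trans[OF _ conjunct1[OF G1]])
           (use c V in \<open>auto simp: \<eta> W_def\<close>)
    qed
    \<comment> \<open>Because \<open>W < 1/4\<close>, the main term \<open>U * q\<close> is at most
      \<open>M^2 / (4 * C * q)\<close>. The two terms merge with constant
      \<open>80 / 4 + 40 = 60\<close>, the numerator of \<open>k2\<close>.\<close>
    have second: "term_norm m \<le> k2 * (M\<^sup>2 / q) + 1" if "m \<in> S" for m
    proof -
      have "U * q = W * (M\<^sup>2 / q) / C"
        using W(2) q_pos pos by (simp add: field_simps power2_eq_square)
      also have "\<dots> \<le> (1/4) * (M\<^sup>2 / q) / C"
        using 3 pos q_pos by (intro divide_right_mono mult_right_mono) auto
      finally have "80 * C / sqrt c * (U * q) \<le> 80 * C / sqrt c * ((1/4) * (M\<^sup>2 / q) / C)"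
        using c pos by (intro mult_left_mono) auto
      also have "\<dots> = 20 / sqrt c * (M\<^sup>2 / q)" using pos by simp
      finally have "term_norm m \<le> 20 / sqrt c * (M\<^sup>2 / q) + 40 / sqrt c * (M\<^sup>2 / q) + 1"
        using term_second_derivative[OF that] by linarith
      then show ?thesis unfolding k2_def by (simp add: algebra_simps)
    qed
    have trivial: "term_norm m \<le> b' * M\<^sup>2" if "m \<in> S" for m unfolding b'_def by (rule term_trivial[OF that])
    \<comment> \<open>\<open>Z\<close> has nearest integer 0 and \<open>P m = 0\<close>, so divisors
      say nothing there. \<open>Y1\<close> is the range of Kuzmin--Landau with a positive integer,
      and \<open>Y2\<close> the exceptional set that has to be counted.\<close>
    define Z where "Z = {m \<in> S. N.\<nu> m \<le> 0}"
    define Y1 where "Y1 = {m \<in> S. 1 \<le> N.\<nu> m \<and> 2 * W \<le> N.\<eta> m}"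
    define Y2 where "Y2 = {m \<in> S. 1 \<le> N.\<nu> m \<and> N.\<eta> m < 2 * W}"
    have part: "S = Z \<union> (Y1 \<union> Y2)" "Z \<inter> (Y1 \<union> Y2) = {}" "Y1 \<inter> Y2 = {}"
      by (auto simp: Z_def Y1_def Y2_def)
    have finY: "finite Z" "finite Y1" "finite Y2" using finite_S by (auto simp: Z_def Y1_def Y2_def)
    have sumZ: "(\<Sum>m\<in>Z. term_norm m) \<le> (48 / g) * (K * L) * (M * E)"
    proof -
      have "(\<Sum>m\<in>Z. term_norm m) \<le> 3 * (16 / g) * M * E"
      proof (rule sum_le_of_uniform)
        fix m assume "m \<in> Z"
        then have m: "m \<in> S" "N.\<nu> m = 0" using N.\<nu>_nonneg[of m] by (auto simp: Z_def)
        have \<eta>: "N.\<eta> m = N.\<theta> m" using N.\<theta>_pos[OF m(1)] by (simp add: N.\<eta>_def m(2))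
        have lower: "g * R * real d / (4 * M\<^sup>2) \<le> N.\<eta> m" unfolding \<eta> by (rule N.\<theta>_bounds(1)[OF m(1)])
        \<comment> \<open>On \<open>Z\<close> the distance to the nearest integer is
          \<open>\<theta> m\<close> itself, and the smallness of \<open>U * V\<close> relative to
          \<open>g\<close> makes it at least \<open>2 * W\<close>.\<close>
        have "2 * W = (16 * C * U * V) * (R * real d / (8 * M\<^sup>2))" using pos by (simp add: W_def field_simps)
        also have "\<dots> \<le> g * (R * real d / (8 * M\<^sup>2))" using UV R by (intro mult_right_mono) auto
        also have "\<dots> \<le> g * R * real d / (4 * M\<^sup>2)" using g R pos by (simp add: field_simps)
        finally have "term_norm m \<le> 4 / N.\<eta> m" using lower by (intro kl m(1)) linarith
        also have "\<dots> \<le> 4 / (g * R / (4 * M\<^sup>2))"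
        proof (rule divide_left_mono)
          have "g * R * 1 / (4 * M\<^sup>2) \<le> g * R * real d / (4 * M\<^sup>2)"
            using g R d by (intro divide_right_mono mult_left_mono) auto
          then show "g * R / (4 * M\<^sup>2) \<le> N.\<eta> m" using lower by simp
          moreover have "0 < g * R / (4 * M\<^sup>2)" using g R pos by simp
          ultimately show "0 < N.\<eta> m * (g * R / (4 * M\<^sup>2))" by (intro mult_pos_pos) linarith+
        qed simp
        also have "\<dots> = 16 / (g * R) * M\<^sup>2" by simp
        also have "\<dots> \<le> 16 / (g * R) * (R * E)" using M_square_le_RE g R by (intro mult_left_mono) auto
        also have "\<dots> = 16 / g * E" using R by simp
        finally show "term_norm m \<le> 16 / g * E" .
      qed (use g in \<open>auto simp: Z_def\<close>)
      also have "\<dots> \<le> (48 / g) * (K * L) * (M * E)" using absorb[of "48 / g"] nonneg by simp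
      finally show ?thesis .
    qed
    have sumY1: "(\<Sum>m\<in>Y1. term_norm m) \<le> (16 + b') * (K * L) * (M * E)"
    proof -
      have "(\<Sum>m\<in>Y1. term_norm m) \<le> (16 + b') * M\<^sup>2 * K * (2 * (1 + ln (real N + 1)))"
        by (rule N.sum_le_of_near) (use kl trivial W(1) pos K N in \<open>auto simp: Y1_def\<close>)
      also have "\<dots> = (16 + b') * (K * L) * M\<^sup>2" by (simp add: L_def)
      also have "\<dots> \<le> (16 + b') * (K * L) * (M * E)"
        using M_square_le_ME pos KL by (intro mult_left_mono) auto
      finally show ?thesis .
    qed
    have sumY2: "(\<Sum>m\<in>Y2. term_norm m) \<le> ((16 * C * k2 + 4 + b')
      + (96 * k2 * C * B + 24 + 3 * g * k2 * B + 6 * g)) * (K * L) * (M * E)"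
    proof (cases "U * sqrt V * M \<le> 1")
      case True
      \<comment> \<open>The count is \<open>16 * W * M^2 + 1\<close>. The second derivative bound is
        multiplied with its first part and the trivial bound with the 1; the minimum
        \<open>t\<close> allows both.\<close>
      define t where "t = min (k2 * (M\<^sup>2 / q) + 1) (b' * M\<^sup>2)"
      have t: "t \<le> k2 * (M\<^sup>2 / q) + 1" "t \<le> b' * M\<^sup>2" "0 \<le> t"
        unfolding t_def using pos q_pos by auto
      \<comment> \<open>By \<open>W * M^2 = C * U * q^2\<close> the product is \<open>C\<close>
        times \<open>U * sqrt V * M\<close> times \<open>M * sqrt (R * d)\<close>, where the first
        factor is at most 1 in this case.\<close>
      have WMq: "W * M\<^sup>2 * (M\<^sup>2 / q) \<le> C * (M * E)"
      proof -
        have "W * M\<^sup>2 * (M\<^sup>2 / q) = C * U * q\<^sup>2 * (M\<^sup>2 / q)" by (simp only: W(2))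
        also have "\<dots> = C * (U * q * M\<^sup>2)" using q_pos by (simp add: power2_eq_square)
        also have "U * q * M\<^sup>2 = (U * sqrt V * M) * (M * sqrt (R * real d))"
          by (simp add: q_eq power2_eq_square)
        also have "\<dots> \<le> 1 * (M * E)" using True sqrt_Rd_le pos R by (intro mult_mono) auto
        finally show ?thesis using pos by simp
      qed
      have "(\<Sum>m\<in>Y2. term_norm m) \<le> real (card Y2) * t"
        by (rule sum_bounded_above, unfold t_def, rule min.boundedI, rule second, simp add: Y2_def, rule trivial, simp add: Y2_def)
      also have "\<dots> \<le> (K * (8 * (2 * W) * M\<^sup>2 + 1)) * t"
        by (intro mult_right_mono N.card_near_by_divisors t) (use W K in \<open>auto simp: Y2_def\<close>)
      also have "\<dots> = K * (16 * (W * M\<^sup>2) * t + t)" by (simp add: algebra_simps)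
      also have "\<dots> \<le> K * (16 * (W * M\<^sup>2) * (k2 * (M\<^sup>2 / q) + 1) + b' * M\<^sup>2)"
        using K(2) W(1) t by (intro mult_left_mono add_mono) auto
      also have "\<dots> = K * (16 * k2 * (W * M\<^sup>2 * (M\<^sup>2 / q)) + 16 * W * M\<^sup>2 + b' * M\<^sup>2)" by (simp add: algebra_simps)
      also have "\<dots> \<le> K * (16 * k2 * (C * (M * E)) + 4 * (M * E) + b' * (M * E))"
      proof (intro mult_left_mono add_mono WMq M_square_le_ME)
        have "16 * W * M\<^sup>2 \<le> 4 * M\<^sup>2" using 3 by (intro mult_right_mono) auto
        then show "16 * W * M\<^sup>2 \<le> 4 * (M * E)" using M_square_le_ME by linarith
      qed (use pos K(2) in auto)
      also have "\<dots> = (16 * C * k2 + 4 + b') * K * (M * E)" by (simp add: algebra_simps)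
      also have "\<dots> \<le> (16 * C * k2 + 4 + b') * (K * L) * (M * E)"
        using L K(2) pos nonneg by (intro mult_right_mono mult_left_mono) auto
      also have "\<dots> \<le> ((16 * C * k2 + 4 + b') + (96 * k2 * C * B + 24 + 3 * g * k2 * B + 6 * g)) * (K * L) * (M * E)"
        using KL pos nonneg g by (intro mult_right_mono) auto
      finally show ?thesis .
    next
      case False
      have WMq: "W * M * (M\<^sup>2 / q) \<le> C * B * (M * E)"
      proof -
        have "W * M * (M\<^sup>2 / q) = (W * M\<^sup>2) / q * M" by simp
        also have "\<dots> = C * U * q\<^sup>2 / q * M" by (simp only: W(2))
        also have "\<dots> = C * (U * q) * M" using q_pos by (simp add: power2_eq_square)
        also have "\<dots> \<le> C * (B * E) * M" using Uq_le pos by (intro mult_left_mono mult_right_mono) auto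
        finally show ?thesis by (simp add: mult_ac)
      qed
      \<comment> \<open>This is the term \<open>A / M^2\<close> of the spacing count times
        \<open>M^2 / q\<close>, up to \<open>g\<close>. It equals
        \<open>sqrt (R * d) / sqrt V\<close>, and \<open>1 / sqrt V < U * M\<close> holds precisely
        in this case.\<close>
      have Rdq: "R * real d / q \<le> B * (M * E)"
      proof -
        have "R * real d / q = sqrt (R * real d) * (1 / sqrt V)"
        proof -
          have "R * real d = sqrt (R * real d) * sqrt (R * real d)" using R by simp
          then have "R * real d / q = sqrt (R * real d) * sqrt (R * real d) / (sqrt V * sqrt (R * real d))" by (simp add: q_eq)
          then show ?thesis using R d V by (simp del: real_sqrt_mult_self)
        qed
        also have "1 / sqrt V \<le> U * M" using False V by (simp add: pos_divide_le_eq mult_ac)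
        then have "sqrt (R * real d) * (1 / sqrt V) \<le> E * (B * M)"
        proof (intro mult_mono sqrt_Rd_le)
          assume "1 / sqrt V \<le> U * M"
          also have "U * M \<le> B * M" using U_le pos by (intro mult_right_mono) auto
          finally show "1 / sqrt V \<le> B * M" .
        qed (use pos V in auto)
        finally show ?thesis by (simp add: mult_ac)
      qed
      \<comment> \<open>Here \<open>E \<le> M^2\<close> is used, which the first case of the
        distinction guarantees.\<close>
      have AM: "g * R * real d / M\<^sup>2 \<le> 2 * g * (M * E)"
      proof -
        have "g * R * real d / M\<^sup>2 \<le> g * E\<^sup>2 / E" using 3(1) Rd_le g pos R
          by (intro frac_le) (auto simp: mult.assoc)
        also have "\<dots> = g * 1 * E" using pos by (simp add: power2_eq_square)
        also have "\<dots> \<le> g * (2 * M) * E" using M g pos by (intro mult_right_mono mult_left_mono) auto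
        finally show ?thesis by simp
      qed
      have "(\<Sum>m\<in>Y2. term_norm m) \<le> real (card Y2) * (k2 * (M\<^sup>2 / q) + 1)"
        by (rule sum_bounded_above, rule second) (simp add: Y2_def)
      also have "\<dots> \<le> (48 * (2 * W) * M + 3 * (g * R * real d) / M\<^sup>2) * (k2 * (M\<^sup>2 / q) + 1)"
        by (intro mult_right_mono N.card_near_by_spacing) (use W pos q_pos in \<open>auto simp: Y2_def\<close>)
      also have "\<dots> = 96 * k2 * (W * M * (M\<^sup>2 / q)) + 96 * W * M + 3 * g * k2 * (R * real d / q) + 3 * (g * R * real d / M\<^sup>2)"
        using pos q_pos by (simp add: field_simps)
      also have "\<dots> \<le> 96 * k2 * (C * B * (M * E)) + 24 * (M * E) + 3 * g * k2 * (B * (M * E)) + 3 * (2 * g * (M * E))"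
      proof (intro add_mono mult_left_mono WMq Rdq AM)
        have "96 * W * M \<le> 24 * M * 1" using 3 pos by simp
        also have "\<dots> \<le> 24 * M * E" using E_ge_1 pos by (intro mult_left_mono) auto
        finally show "96 * W * M \<le> 24 * (M * E)" by simp
      qed (use pos g in auto)
      also have "\<dots> = (96 * k2 * C * B + 24 + 3 * g * k2 * B + 6 * g) * M * E" by (simp add: algebra_simps)
      also have "\<dots> \<le> (96 * k2 * C * B + 24 + 3 * g * k2 * B + 6 * g) * (K * L) * (M * E)"
        by (rule absorb) (use nonneg g in auto)
      also have "\<dots> \<le> ((16 * C * k2 + 4 + b') + (96 * k2 * C * B + 24 + 3 * g * k2 * B + 6 * g)) * (K * L) * (M * E)"
        using KL pos nonneg g by (intro mult_right_mono) auto
      finally show ?thesis .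
    qed
    have "(\<Sum>m\<in>S. term_norm m) = (\<Sum>m\<in>Z \<union> (Y1 \<union> Y2). term_norm m)" using part(1) by simp
    also have "\<dots> = (\<Sum>m\<in>Z. term_norm m) + ((\<Sum>m\<in>Y1. term_norm m) + (\<Sum>m\<in>Y2. term_norm m))"
      using finY part(2,3) by (simp add: sum.union_disjoint)
    also have "\<dots> \<le> (48 / g) * (K * L) * (M * E) + ((16 + b') * (K * L) * (M * E) + ((16 * C * k2 + 4 + b')
      + (96 * k2 * C * B + 24 + 3 * g * k2 * B + 6 * g)) * (K * L) * (M * E))"
      by (intro add_mono sumZ sumY1 sumY2)
    also have "\<dots> = (48 / g + (16 + b' + ((16 * C * k2 + 4 + b')
      + (96 * k2 * C * B + 24 + 3 * g * k2 * B + 6 * g)))) * (K * L) * (M * E)"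
      by (simp only: distrib_right)
    finally show ?thesis by (rule final[OF _ le(3)])
  qed
qed

end

section \<open>Phases near an endpoint\<close>

lemma ln_le_powr: "ln x \<le> x powr e / e" if "0 < e" "0 < x" for x e :: real
proof -
  have "e * ln x = ln (x powr e)" using that by (simp add: ln_powr)
  also have "\<dots> \<le> x powr e" using ln_less_self[of "x powr e"] that by simp
  finally show ?thesis using that by (simp add: field_simps)
qed

text \<open>Near the endpoint \<open>p\<close> the derivative of \<open>G\<close> may vanish or blow up like a power \<open>\<kappa>\<close>.\<close>

locale endpoint_phase =
  fixes H \<phi> G G1 :: "real \<Rightarrow> real" and a b p \<kappa> c C s :: real
  assumes ab: "0 \<le> a" "a < b" and p: "p = a \<or> p = b"
    and deriv_H: "\<And>u. a < u \<Longrightarrow> u < b \<Longrightarrow> (H has_real_derivative \<phi> u) (at u)"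
    and deriv_\<phi>: "\<And>u. a < u \<Longrightarrow> u < b \<Longrightarrow> (\<phi> has_real_derivative (G u - \<phi> u) / (2 * u)) (at u)"
    and deriv_G: "\<And>u. a < u \<Longrightarrow> u < b \<Longrightarrow> (G has_real_derivative G1 u) (at u)"
    and c: "0 < c" "c \<le> C" and s: "s \<in> {1, -1}" and \<kappa>: "-2 \<le> \<kappa>"
    and G1: "\<And>u. a < u \<Longrightarrow> u < b \<Longrightarrow> \<bar>u - p\<bar> \<le> (b - a) / 2 \<Longrightarrow>
        c * \<bar>u - p\<bar> powr \<kappa> \<le> s * G1 u \<and> s * G1 u \<le> C * \<bar>u - p\<bar> powr \<kappa>"
    and G: "0 < \<kappa> \<Longrightarrow> \<exists>g>0. \<forall>u. a < u \<longrightarrow> u < b \<longrightarrow> \<bar>u - p\<bar> \<le> (b - a) / 2 \<longrightarrow>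
        \<bar>G u - g\<bar> \<le> C * \<bar>u - p\<bar> powr (\<kappa> + 1)"
begin

text \<open>A dyadic window, whose length is comparable to its distance from \<open>p\<close>, so
  that a power of \<open>\<bar>u - p\<bar>\<close> is constant on it up to a factor. Both windows of
  the theorem have this shape.\<close>

definition endpoint_window :: "real \<Rightarrow> real \<Rightarrow> bool" where
  "endpoint_window U1 U2 \<longleftrightarrow> a < U1 \<and> U1 < U2 \<and> U2 < b \<and> U2 - U1 \<le> (b - a) / 4 \<and>
     (\<forall>u. U1 \<le> u \<longrightarrow> u \<le> U2 \<longrightarrow> U2 - U1 \<le> \<bar>u - p\<bar> \<and> \<bar>u - p\<bar> \<le> 2 * (U2 - U1))"

lemma phase_window_if_endpoint_window:
  assumes "endpoint_window U1 U2"
  shows "phase_window H \<phi> G G1 a b U1 U2"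
  using assms ab deriv_H deriv_\<phi> deriv_G by unfold_locales (auto simp: endpoint_window_def)

lemma powr_window:
  fixes U x e :: real
  assumes "0 < U" "U \<le> x" "x \<le> 2 * U"
  shows "2 powr (- \<bar>e\<bar>) * U powr e \<le> x powr e" "x powr e \<le> 2 powr \<bar>e\<bar> * U powr e"
proof -
  show "2 powr (- \<bar>e\<bar>) * U powr e \<le> x powr e"
  proof (cases "0 \<le> e")
    case True
    then have "1 * U powr e \<le> x powr e" using assms by (simp add: powr_mono2)
    moreover have "2 powr (- \<bar>e\<bar>) * U powr e \<le> 1 * U powr e"
      using powr_mono[of "- \<bar>e\<bar>" 0 2] by (intro mult_right_mono) auto
    ultimately show ?thesis by linarith
  next
    case False
    have "2 powr (- \<bar>e\<bar>) * U powr e = (2 * U) powr e" using False assms by (simp add: powr_mult)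
    also have "\<dots> \<le> x powr e" using False assms by (intro powr_mono2') auto
    finally show ?thesis .
  qed
  show "x powr e \<le> 2 powr \<bar>e\<bar> * U powr e"
  proof (cases "0 \<le> e")
    case True
    then have "x powr e \<le> (2 * U) powr e" using assms by (simp add: powr_mono2)
    then show ?thesis using True assms by (simp add: powr_mult)
  next
    case False
    have "x powr e \<le> 1 * U powr e" using False assms by (simp add: powr_mono2')
    also have "\<dots> \<le> 2 powr \<bar>e\<bar> * U powr e" by (intro mult_right_mono) (auto simp: ge_one_powr_ge_zero)
    finally show ?thesis .
  qed
qed

text \<open>With \<open>V = (U2 - U1) powr \<kappa>\<close>, the quantity
  \<open>U * sqrt V = U powr (1 + \<kappa> / 2)\<close> is bounded because
  \<open>\<kappa> \<ge> -2\<close>. If \<open>\<kappa> \<le> 0\<close>, then \<open>V\<close> is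
  bounded below on all windows. If \<open>\<kappa> > 0\<close>, either \<open>V\<close> is bounded
  below or \<open>U * V\<close> is small enough for the degenerate case.\<close>

lemma correlation_bound:
  fixes e :: real
  assumes "0 < e"
  obtains K where "0 \<le> K" "\<And>U1 U2 R M d. endpoint_window U1 U2 \<Longrightarrow> 1 \<le> R \<Longrightarrow> 1/2 \<le> M \<Longrightarrow>
    2 * M \<le> R powr (5/8) \<Longrightarrow> 1 \<le> d \<Longrightarrow> real d \<le> sqrt R \<Longrightarrow>
    (\<Sum>m\<in>{m. M \<le> real m \<and> real (m + d) < 2 * M}. norm (phase_window.T H U1 U2 R m (m + d))) \<le> K * M * R powr (3/4 + e)"
proof -
  \<comment> \<open>The exponent \<open>\<bar>\<kappa>\<bar> + 1\<close> in \<open>C'\<close> leaves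
    room for \<open>\<bar>u - p\<bar> powr (\<kappa> + 1)\<close>, the bound for
    \<open>G - g\<close>.\<close>
  define c' C' B where "c' = c * 2 powr (- \<bar>\<kappa>\<bar>)" and "C' = C * 2 powr (\<bar>\<kappa>\<bar> + 1)"
    and "B = (b - a) + (b - a) powr (1 + \<kappa> / 2)"
  have C0: "0 < C" using c by simp
  have cC': "0 < c'" "c' \<le> C'"
  proof -
    show "0 < c'" using c by (simp add: c'_def)
    show "c' \<le> C'" unfolding c'_def C'_def using c by (intro mult_mono powr_mono) auto
  qed
  have Bpos: "0 < B" unfolding B_def using ab by (simp add: add_pos_nonneg)
  have instances: "differenced_sum H \<phi> G G1 a b U1 U2 c' C' B ((U2 - U1) powr \<kappa>) R M s d"
    if "endpoint_window U1 U2" "1 \<le> R" "1/2 \<le> M" "2 * M \<le> R powr (5/8)" "1 \<le> d" "real d \<le> sqrt R" for U1 U2 R M d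
  proof -
    interpret phase_window H \<phi> G G1 a b U1 U2 by (rule phase_window_if_endpoint_window[OF that(1)])
    define U where "U = U2 - U1"
    have U: "0 < U" "U \<le> b - a" using that(1) ab by (auto simp: U_def endpoint_window_def)
    have near: "U \<le> \<bar>u - p\<bar>" "\<bar>u - p\<bar> \<le> 2 * U" "a < u" "u < b" "\<bar>u - p\<bar> \<le> (b - a) / 2" if "U1 \<le> u" "u \<le> U2" for u
    proof -
      have w: "a < U1" "U2 < b" "U \<le> (b - a) / 4" using \<open>endpoint_window U1 U2\<close> by (auto simp: endpoint_window_def U_def)
      show *: "U \<le> \<bar>u - p\<bar>" "\<bar>u - p\<bar> \<le> 2 * U" using \<open>endpoint_window U1 U2\<close> that by (auto simp: endpoint_window_def U_def)
      show "a < u" "u < b" using w that by auto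
      show "\<bar>u - p\<bar> \<le> (b - a) / 2" using w(3) *(2) by linarith
    qed
    show ?thesis
    proof unfold_locales
      fix u assume u: "U1 \<le> u" "u \<le> U2"
      note near = near[OF u]
      note G1u = G1[OF near(3-5)]
      note pw = powr_window[OF U(1) near(1,2), of \<kappa>]
      have "c' * U powr \<kappa> \<le> c * \<bar>u - p\<bar> powr \<kappa>" using mult_left_mono[OF pw(1), of c] c by (simp add: c'_def mult_ac)
      moreover have "C * \<bar>u - p\<bar> powr \<kappa> \<le> C * (2 powr \<bar>\<kappa>\<bar> * U powr \<kappa>)" using C0 pw by (intro mult_left_mono) auto
      moreover have "C * (2 powr \<bar>\<kappa>\<bar> * U powr \<kappa>) \<le> C' * U powr \<kappa>"
        unfolding C'_def mult.assoc using C0 by (intro mult_left_mono mult_right_mono powr_mono) auto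
      ultimately show "c' * (U2 - U1) powr \<kappa> \<le> s * G1 u \<and> s * G1 u \<le> C' * (U2 - U1) powr \<kappa>"
        using G1u unfolding U_def by linarith
    next
      show "U2 - U1 \<le> B" unfolding B_def using U by (simp add: U_def add_increasing2)
      have "U * sqrt (U powr \<kappa>) = U powr 1 * U powr (\<kappa> / 2)" using U by (simp add: powr_half_sqrt[symmetric] powr_powr)
      also have "\<dots> = U powr (1 + \<kappa> / 2)" by (simp add: powr_add)
      also have "\<dots> \<le> (b - a) powr (1 + \<kappa> / 2)" using U \<kappa> by (intro powr_mono2) auto
      also have "\<dots> \<le> B" using ab by (simp add: B_def)
      finally show "(U2 - U1) * sqrt ((U2 - U1) powr \<kappa>) \<le> B" by (simp add: U_def)
    qed (use cC' s that U in \<open>auto simp: U_def\<close>)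
  qed
  have nondeg: "\<exists>K\<ge>0. \<forall>U1 U2 R M d. endpoint_window U1 U2 \<longrightarrow> v \<le> (U2 - U1) powr \<kappa> \<longrightarrow> 1 \<le> R \<longrightarrow> 1/2 \<le> M \<longrightarrow>
    2 * M \<le> R powr (5/8) \<longrightarrow> 1 \<le> d \<longrightarrow> real d \<le> sqrt R \<longrightarrow>
    (\<Sum>m\<in>{m. M \<le> real m \<and> real (m + d) < 2 * M}. norm (phase_window.T H U1 U2 R m (m + d))) \<le> K * M * R powr (3/4 + e)"
    if "0 < v" for v
  proof (intro exI[of _ "3 * (80 * C' / sqrt c' * B + 40 / sqrt c' * (1 / sqrt v) + 1)"] conjI allI impI)
    show "0 \<le> 3 * (80 * C' / sqrt c' * B + 40 / sqrt c' * (1 / sqrt v) + 1)"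
      using that cC' Bpos by auto
    fix U1 U2 R M :: real and d :: nat
    assume *: "endpoint_window U1 U2" "v \<le> (U2 - U1) powr \<kappa>" "1 \<le> R" "1/2 \<le> M" "2 * M \<le> R powr (5/8)" "1 \<le> d" "real d \<le> sqrt R"
    interpret differenced_sum H \<phi> G G1 a b U1 U2 c' C' B "(U2 - U1) powr \<kappa>" R M s d by (rule instances; fact)
    have "(\<Sum>m\<in>{m. M \<le> real m \<and> real (m + d) < 2 * M}. norm (T R m (m + d)))
        \<le> 3 * (80 * C' / sqrt c' * B + 40 / sqrt c' * (1 / sqrt v) + 1) * M * R powr (3/4)"
      using nondegenerate_bound[OF that *(2)] unfolding S_def E_def .
    also have "\<dots> \<le> 3 * (80 * C' / sqrt c' * B + 40 / sqrt c' * (1 / sqrt v) + 1) * M * R powr (3/4 + e)"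
      using that cC' Bpos * assms by (intro mult_left_mono powr_mono mult_nonneg_nonneg add_nonneg_nonneg) auto
    finally show "(\<Sum>m\<in>{m. M \<le> real m \<and> real (m + d) < 2 * M}. norm (T R m (m + d)))
        \<le> 3 * (80 * C' / sqrt c' * B + 40 / sqrt c' * (1 / sqrt v) + 1) * M * R powr (3/4 + e)" .
  qed
  show ?thesis
  proof (cases "\<kappa> \<le> 0")
    case True
    have "0 < (b - a) powr \<kappa>" using ab by simp
    from nondeg[OF this] obtain K where K: "0 \<le> K" "\<forall>U1 U2 R M d. endpoint_window U1 U2 \<longrightarrow> (b - a) powr \<kappa> \<le> (U2 - U1) powr \<kappa> \<longrightarrow> 1 \<le> R \<longrightarrow> 1/2 \<le> M \<longrightarrow>
      2 * M \<le> R powr (5/8) \<longrightarrow> 1 \<le> d \<longrightarrow> real d \<le> sqrt R \<longrightarrow>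
      (\<Sum>m\<in>{m. M \<le> real m \<and> real (m + d) < 2 * M}. norm (phase_window.T H U1 U2 R m (m + d))) \<le> K * M * R powr (3/4 + e)"
      by blast
    have *: "(b - a) powr \<kappa> \<le> (U2 - U1) powr \<kappa>" if "endpoint_window U1 U2" for U1 U2
      using that True ab by (intro powr_mono2') (auto simp: endpoint_window_def)
    show ?thesis by (rule that[OF K(1)]) (use K(2) * in blast)
  next
    case False
    then have \<kappa>0: "0 < \<kappa>" by simp
    obtain g where g: "0 < g" and Gg: "\<And>u. a < u \<Longrightarrow> u < b \<Longrightarrow> \<bar>u - p\<bar> \<le> (b - a) / 2 \<Longrightarrow>
        \<bar>G u - g\<bar> \<le> C * \<bar>u - p\<bar> powr (\<kappa> + 1)" using G[OF \<kappa>0] by blast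
    \<comment> \<open>The threshold below which \<open>16 * C' * U * V \<le> g\<close>. Dividing it
      by \<open>b - a\<close>, an upper bound for \<open>U\<close>, gives a threshold for
      \<open>V\<close> alone.\<close>
    define c1 where "c1 = g / (16 * C')"
    have c1: "0 < c1" using g cC' by (simp add: c1_def)
    have "0 < c1 / (b - a)" using c1 ab by simp
    from nondeg[OF this] obtain K where K: "0 \<le> K" "\<forall>U1 U2 R M d. endpoint_window U1 U2 \<longrightarrow> c1 / (b - a) \<le> (U2 - U1) powr \<kappa> \<longrightarrow> 1 \<le> R \<longrightarrow> 1/2 \<le> M \<longrightarrow>
      2 * M \<le> R powr (5/8) \<longrightarrow> 1 \<le> d \<longrightarrow> real d \<le> sqrt R \<longrightarrow>
      (\<Sum>m\<in>{m. M \<le> real m \<and> real (m + d) < 2 * M}. norm (phase_window.T H U1 U2 R m (m + d))) \<le> K * M * R powr (3/4 + e)"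
      by blast
    \<comment> \<open>A quarter, because \<open>A\<close> below is of order \<open>R^2\<close> and
      \<open>A powr e'\<close> occurs twice, for the divisors and for the logarithm.\<close>
    define e' where "e' = e / 4"
    have e': "0 < e'" using assms by (simp add: e'_def)
    obtain K0 where K0: "K0 \<ge> 1" "\<And>n. n > 0 \<Longrightarrow> real (card {d::nat. d dvd n}) \<le> K0 * real n powr e'"
      using divisor_bound[OF e'] by blast
    define x where "x = (let k2 = 60 / sqrt c'; b' = 4 * B + 4 in
      3 * b' + 3 * (240 * C' / sqrt c' * B + 1) + 48 / g + (16 + b') + (16 * C' * k2 + 4 + b')
      + (96 * k2 * C' * B + 24 + 3 * g * k2 * B + 6 * g))"
    have x: "0 \<le> x" unfolding x_def Let_def using cC' Bpos g by (auto intro!: add_nonneg_nonneg)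
    define K1 where "K1 = x * K0 * (2 * (1 + 1 / e')) * (g + 4) powr (2 * e')"
    have K1: "0 \<le> K1" unfolding K1_def using x K0 e' by auto
    show ?thesis
    proof (rule that)
      show "0 \<le> K + K1" using K K1 by simp
      fix U1 U2 R M :: real and d :: nat
      assume *: "endpoint_window U1 U2" "1 \<le> R" "1/2 \<le> M" "2 * M \<le> R powr (5/8)" "1 \<le> d" "real d \<le> sqrt R"
      define y where "y = M * R powr (3/4 + e)"
      have y: "0 \<le> y" using * by (simp add: y_def)
      interpret differenced_sum H \<phi> G G1 a b U1 U2 c' C' B "(U2 - U1) powr \<kappa>" R M s d by (rule instances; fact)
      show "(\<Sum>m\<in>{m. M \<le> real m \<and> real (m + d) < 2 * M}. norm (T R m (m + d))) \<le> (K + K1) * M * R powr (3/4 + e)"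
      proof (cases "c1 / (b - a) \<le> (U2 - U1) powr \<kappa>")
        case True
        then have "(\<Sum>m\<in>{m. M \<le> real m \<and> real (m + d) < 2 * M}. norm (T R m (m + d))) \<le> K * M * R powr (3/4 + e)"
          using K(2) * by blast
        also have "\<dots> \<le> (K + K1) * M * R powr (3/4 + e)"
          using K1 * by (intro mult_right_mono) auto
        finally show ?thesis .
      next
        case False
        define V where "V = (U2 - U1) powr \<kappa>"
        have UV: "U * V \<le> c1"
        proof -
          have "U * V \<le> (b - a) * (c1 / (b - a))"
            using False *(1) U_pos c1 ab by (intro mult_mono) (auto simp: V_def U_def endpoint_window_def)
          then show ?thesis using ab by simp
        qed
        \<comment> \<open>\<open>A\<close> dominates \<open>g * R * d + 2 * M^2\<close> with a
          margin of 2, which lets \<open>N\<close> satisfy both \<open>A - 2 \<le> N\<close> and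
          \<open>N + 1 \<le> A\<close>.\<close>
        define A where "A = (g + 4) * R\<^sup>2"
        define N where "N = nat \<lfloor>A\<rfloor> - 1"
        have R2: "1 \<le> R\<^sup>2" using * by simp
        have A4: "4 \<le> A"
        proof -
          have "4 * 1 \<le> (g + 4) * R\<^sup>2" using g R2 by (intro mult_mono) auto
          then show ?thesis by (simp add: A_def)
        qed
        have low: "g * R * real d + 2 * M\<^sup>2 \<le> A - 2"
        proof -
          have "sqrt R \<le> sqrt (R * R)" using *(2) mult_left_mono[of 1 R R] by (intro real_sqrt_le_mono) simp
          then have "real d \<le> R" using *(2,6) by simp
          then have "g * R * real d \<le> g * R * R" using g * by (intro mult_left_mono) auto
          moreover have "M\<^sup>2 \<le> R\<^sup>2"
          proof (rule power_mono)
            have "M \<le> R powr (5/8)" using * by linarith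
            also have "\<dots> \<le> R powr 1" using * by (intro powr_mono) auto
            finally show "M \<le> R" using * by simp
          qed (use * in auto)
          ultimately show ?thesis using R2 unfolding A_def by (simp add: power2_eq_square algebra_simps)
        qed
        have N: "A - 2 \<le> real N" "real N + 1 \<le> A" unfolding N_def using A4 by linarith+
        have powA: "A powr e' = (g + 4) powr e' * R powr (2 * e')"
          unfolding A_def using g * by (simp add: powr_mult powr_powr flip: powr_numeral)
        have A1: "1 \<le> A powr e'" using A4 e' by (intro ge_one_powr_ge_zero) auto
        have div: "real (card {e. e dvd n}) \<le> K0 * A powr e'" if "0 < n" "real n \<le> g * R * real d + 2 * M\<^sup>2" for n
        proof -
          have "real (card {e. e dvd n}) \<le> K0 * real n powr e'" by (rule K0(2)[OF that(1)])
          also have "\<dots> \<le> K0 * A powr e'" using that low K0 e' by (intro mult_left_mono powr_mono2) auto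
          finally show ?thesis .
        qed
        have L: "2 * (1 + ln (real N + 1)) \<le> 2 * (1 + 1 / e') * A powr e'"
        proof -
          have "ln (real N + 1) \<le> ln A" using N A4 by (subst ln_le_cancel_iff) auto
          also have "\<dots> \<le> A powr e' / e'" using ln_le_powr[OF e', of A] A4 by simp
          finally show ?thesis using A1 by (simp add: algebra_simps)
        qed
        have bnd: "(\<Sum>m\<in>S. norm (T R m (m + d))) \<le> x * (K0 * A powr e') * (2 * (1 + ln (real N + 1))) * M * E"
          unfolding x_def Let_def
        proof (rule degenerate_bound[OF g])
          fix u assume u: "U1 \<le> u" "u \<le> U2"
          have w: "a < u" "u < b" "U \<le> \<bar>u - p\<bar>" "\<bar>u - p\<bar> \<le> 2 * U" "U \<le> (b - a) / 4"
            using *(1) u by (auto simp: endpoint_window_def U_def)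
          then have "\<bar>G u - g\<bar> \<le> C * \<bar>u - p\<bar> powr (\<kappa> + 1)" by (intro Gg) linarith+
          also have "\<dots> \<le> C * (2 powr \<bar>\<kappa> + 1\<bar> * U powr (\<kappa> + 1))"
            using C0 powr_window(2)[OF U_pos w(3,4)] by (intro mult_left_mono) auto
          also have "\<dots> = C' * U * (U2 - U1) powr \<kappa>"
            using \<kappa>0 U_pos by (simp add: C'_def powr_add U_def)
          finally show "\<bar>G u - g\<bar> \<le> C' * U * (U2 - U1) powr \<kappa>" .
        next
          have "16 * C' * (U * V) \<le> 16 * C' * c1" using UV cC' by (intro mult_left_mono) auto
          also have "\<dots> = g" using cC' by (simp add: c1_def)
          finally show "16 * C' * U * (U2 - U1) powr \<kappa> \<le> g" by (simp add: V_def mult.assoc)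
        next
          show "1 \<le> K0 * A powr e'" using mult_mono[of 1 K0 1 "A powr e'"] K0 A1 by simp
        qed (use div low N in auto)
        also have "\<dots> \<le> x * (K0 * A powr e') * (2 * (1 + 1 / e') * A powr e') * M * E"
          using x K0 L E_ge_1 * by (intro mult_right_mono mult_left_mono) auto
        also have "\<dots> = K1 * M * (R powr (4 * e') * E)"
        proof -
          have "A powr e' * A powr e' = (g + 4) powr (2 * e') * R powr (4 * e')"
            unfolding powA by (simp add: mult.assoc powr_add[symmetric] mult.left_commute)
          then show ?thesis unfolding K1_def by (simp add: mult_ac)
        qed
        also have "R powr (4 * e') * E = R powr (3/4 + e)"
          unfolding E_def e'_def by (simp flip: powr_add add: add.commute)
        also have "K1 * M * R powr (3/4 + e) \<le> (K + K1) * M * R powr (3/4 + e)"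
          using K * by (intro mult_right_mono) auto
        finally show ?thesis unfolding S_def .
      qed
    qed
  qed
qed

end

section \<open>From correlation sums to the sum weighted by \<open>r2\<close>\<close>

context endpoint_phase
begin

definition index :: "real \<Rightarrow> real \<Rightarrow> real \<Rightarrow> (nat \<times> nat) set" where
  "index U1 U2 M = {(n, m). 0 < n \<and> 0 < m \<and> U1 \<le> real n / (real m)\<^sup>2 \<and> real n / (real m)\<^sup>2 < U2
     \<and> M \<le> real m \<and> real m < 2 * M}"

text \<open>Cauchy--Schwarz separates the weights \<open>r2 n\<close> from the sums over
  \<open>m\<close>. After differencing, the correlations are exactly the sums \<open>T\<close>, to
  which \<open>correlation_bound\<close> applies on average over \<open>m\<close>.\<close>

lemma weighted_sum_bound:
  fixes e :: real
  assumes "0 < e"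
  obtains K where "0 \<le> K" "\<And>U1 U2 R M. endpoint_window U1 U2 \<Longrightarrow> 1 < R \<Longrightarrow> 0 < M \<Longrightarrow> 2 * M \<le> R powr (5/8) \<Longrightarrow>
    norm (\<Sum>(n, m)\<in>index U1 U2 M. of_nat (r2 n) * e_fun (R * (real m * H (real n / (real m)\<^sup>2)))) \<le> K * M\<^sup>2 * R powr (3/8 + 2 * e)"
proof -
  obtain K1 where K1: "0 \<le> K1" "\<And>U1 U2 R M d. endpoint_window U1 U2 \<Longrightarrow> 1 \<le> R \<Longrightarrow> 1/2 \<le> M \<Longrightarrow>
    2 * M \<le> R powr (5/8) \<Longrightarrow> 1 \<le> d \<Longrightarrow> real d \<le> sqrt R \<Longrightarrow>
    (\<Sum>m\<in>{m. M \<le> real m \<and> real (m + d) < 2 * M}. norm (phase_window.T H U1 U2 R m (m + d))) \<le> K1 * M * R powr (3/4 + e)"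
    using correlation_bound[OF assms] by blast
  obtain K2 where K2: "K2 \<ge> 1" "\<And>N. N \<ge> 1 \<Longrightarrow> (\<Sum>n\<le>N. (real (r2 n))\<^sup>2) \<le> K2 * real N powr (1 + e)"
    using r2_mean_square[OF assms] by blast
  \<comment> \<open>All \<open>n\<close> are at most \<open>4 * b * M^2 + 2\<close>, and
    \<open>1 \<le> 4 * M^2\<close> turns the 2 into \<open>8 * M^2\<close>.\<close>
  define \<beta> where "\<beta> = 4 * b + 8"
  have \<beta>: "8 \<le> \<beta>" "b \<le> \<beta>" using ab by (auto simp: \<beta>_def)
  define K where "K = sqrt (K2 * \<beta> powr (1 + e) * (7 * (8 * \<beta> + K1)))"
  have K: "0 \<le> K" unfolding K_def using K2 \<beta> K1 by auto
  show ?thesis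
  proof (rule that[OF K])
    fix U1 U2 R M :: real
    assume win: "endpoint_window U1 U2" and R: "1 < R" and M: "0 < M" "2 * M \<le> R powr (5/8)"
    interpret phase_window H \<phi> G G1 a b U1 U2 by (rule phase_window_if_endpoint_window[OF win])
    let ?S = "\<Sum>(n, m)\<in>index U1 U2 M. of_nat (r2 n) * e_fun (R * (real m * H (real n / (real m)\<^sup>2)))"
    show "norm ?S \<le> K * M\<^sup>2 * R powr (3/8 + 2 * e)"
    \<comment> \<open>Below 1/2 there is no integer \<open>m\<close> with
      \<open>0 < m < 2 * M\<close>.\<close>
    proof (cases "M < 1/2")
      case True
      then have "index U1 U2 M = {}" by (auto simp: index_def)
      then show ?thesis using K by simp
    next
      case False
      then have M2: "1/2 \<le> M" by simp
      have M24: "1 \<le> 4 * M\<^sup>2"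
      proof -
        have "(1/2)\<^sup>2 \<le> M\<^sup>2" using M2 by (intro power_mono) auto
        then show ?thesis by (simp add: power2_eq_square)
      qed
      define E where "E = R powr (3/4)"
      have E: "1 \<le> E" unfolding E_def using R by (simp add: ge_one_powr_ge_zero)
      have ME: "M \<le> E"
      proof -
        have "M \<le> R powr (5/8)" using M by linarith
        also have "\<dots> \<le> E" unfolding E_def using R by (intro powr_mono) auto
        finally show ?thesis .
      qed
      have M2E: "M\<^sup>2 \<le> sqrt R * E" and M2R: "M\<^sup>2 \<le> R powr 2"
      proof -
        have "M \<le> R powr (5/8)" using M by linarith
        then have "M\<^sup>2 \<le> (R powr (5/8))\<^sup>2" using M by (intro power_mono) auto
        also have *: "\<dots> = R powr (1/2 + 3/4)" unfolding power2_eq_square by (simp flip: powr_add)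
        also have "\<dots> = sqrt R * E" using R by (simp only: powr_add powr_half_sqrt E_def)
        finally show "M\<^sup>2 \<le> sqrt R * E" .
        have "R powr (1/2 + 3/4) \<le> R powr 2" using R by (intro powr_mono) auto
        then show "M\<^sup>2 \<le> R powr 2" using * \<open>M\<^sup>2 \<le> (R powr (5/8))\<^sup>2\<close> by linarith
      qed
      define X where "X = nat \<lceil>4 * b * M\<^sup>2\<rceil> + 1"
      have b0: "0 \<le> 4 * b * M\<^sup>2" using ab by simp
      have X: "1 \<le> X" "4 * b * M\<^sup>2 \<le> real X" "real X \<le> \<beta> * M\<^sup>2"
      proof -
        show "1 \<le> X" by (simp add: X_def)
        show "4 * b * M\<^sup>2 \<le> real X" unfolding X_def using b0 by linarith
        have "real X \<le> 4 * b * M\<^sup>2 + 2" unfolding X_def using b0 by linarith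
        also have "\<dots> \<le> \<beta> * M\<^sup>2" using M24 by (simp add: \<beta>_def algebra_simps)
        finally show "real X \<le> \<beta> * M\<^sup>2" .
      qed
      define N where "N = {1..X}"
      define Y where "Y = \<lfloor>2 * M\<rfloor>"
      \<comment> \<open>Extended by zero to all integers \<open>m\<close>, as the shifts of the
        differencing require. The product of two shifted values then vanishes outside
        \<open>window_set\<close>.\<close>
      define z :: "nat \<Rightarrow> int \<Rightarrow> complex" where
        "z n m = (if M \<le> real_of_int m \<and> real_of_int m < 2 * M \<and> U1 \<le> real n / (real_of_int m)\<^sup>2 \<and> real n / (real_of_int m)\<^sup>2 < U2
          then e_fun (R * (real_of_int m * H (real n / (real_of_int m)\<^sup>2))) else 0)" for n m
      have z_le: "norm (z n m) \<le> 1" for n m by (simp add: z_def)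
      have Y: "0 \<le> Y" "real_of_int Y \<le> 2 * M" using M by (auto simp: Y_def)
      have z_supp: "z n m = 0" if "m \<notin> {0..Y}" for n m
      proof -
        have "real_of_int m < M \<or> 2 * M \<le> real_of_int m"
          using that M by (auto simp: Y_def le_floor_iff not_le)
        then show ?thesis by (auto simp: z_def)
      qed
      have inX: "n \<in> N" if "0 < n" "real n / t\<^sup>2 < U2" "M \<le> t" "t < 2 * M" for n t
      proof -
        have "real n < U2 * t\<^sup>2" using that M by (simp add: pos_divide_less_eq)
        also have "\<dots> \<le> b * (2 * M)\<^sup>2"
          using that M window U2_pos by (intro mult_mono power_mono) auto
        also have "\<dots> \<le> real X" using X(2) by (simp add: power_mult_distrib)
        finally show ?thesis using that(1) by (simp add: N_def)
      qed
      have S_eq: "?S = (\<Sum>n\<in>N. of_nat (r2 n) * (\<Sum>m\<in>{0..Y}. z n m))"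
      proof -
        let ?f = "\<lambda>n m. of_nat (r2 n) * e_fun (R * (real m * H (real n / (real m)\<^sup>2)))"
        have "(\<Sum>n\<in>N. of_nat (r2 n) * (\<Sum>m\<in>{0..Y}. z n m)) = (\<Sum>(n, m)\<in>N \<times> {0..Y}. of_nat (r2 n) * z n m)"
          by (simp add: sum_distrib_left sum.cartesian_product)
        also have "\<dots> = (\<Sum>(n, m)\<in>(\<lambda>(n, m). (n, int m)) ` index U1 U2 M. of_nat (r2 n) * z n m)"
        proof (rule sum.mono_neutral_right)
          show "(\<lambda>(n, m). (n, int m)) ` index U1 U2 M \<subseteq> N \<times> {0..Y}"
          proof clarify
            fix n m assume *: "(n, m) \<in> index U1 U2 M"
            then have "n \<in> N" using inX[of n "real m"] by (auto simp: index_def)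
            moreover have "int m \<in> {0..Y}" using * by (auto simp: index_def Y_def le_floor_iff)
            ultimately show "n \<in> N \<and> int m \<in> {0..Y}" by blast
          qed
          show "\<forall>i\<in>N \<times> {0..Y} - (\<lambda>(n, m). (n, int m)) ` index U1 U2 M. (case i of (n, m) \<Rightarrow> of_nat (r2 n) * z n m) = 0"
          proof clarify
            fix n m assume *: "(n, m) \<notin> (\<lambda>(n, m). (n, int m)) ` index U1 U2 M" "n \<in> N" "m \<in> {0..Y}"
            have "z n m = 0"
            proof (rule ccontr)
              assume "z n m \<noteq> 0"
              then have "M \<le> real_of_int m \<and> real_of_int m < 2 * M \<and> U1 \<le> real n / (real_of_int m)\<^sup>2 \<and> real n / (real_of_int m)\<^sup>2 < U2"
                by (auto simp: z_def split: if_splits)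
              moreover obtain k where k: "m = int k" using *(3) by (auto dest: zero_le_imp_eq_int)
              ultimately have "M \<le> real k" "real k < 2 * M" "U1 \<le> real n / (real k)\<^sup>2" "real n / (real k)\<^sup>2 < U2"
                by simp_all
              moreover from this have "0 < k" using M by (cases k) auto
              moreover have "0 < n" using *(2) by (simp add: N_def)
              ultimately have "(n, k) \<in> index U1 U2 M" by (simp add: index_def)
              then have "(\<lambda>(n, m). (n, int m)) (n, k) \<in> (\<lambda>(n, m). (n, int m)) ` index U1 U2 M" by (rule imageI)
              then show False using *(1) k by simp
            qed
            then show "of_nat (r2 n) * z n m = 0" by simp
          qed
        qed (simp add: N_def)
        also have "\<dots> = (\<Sum>(n, m)\<in>index U1 U2 M. of_nat (r2 n) * z n (int m))"
          by (subst sum.reindex) (auto simp: inj_on_def intro!: sum.cong)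
        also have "\<dots> = ?S"
          by (rule sum.cong[OF refl]) (auto simp: index_def z_def)
        finally show ?thesis by simp
      qed
      \<comment> \<open>\<open>d < D\<close> forces \<open>d < min M (sqrt R)\<close>, while
        \<open>D\<close> itself is at least this minimum.\<close>
      define D where "D = nat \<lceil>min M (sqrt R)\<rceil>"
      have D: "1 \<le> D" "M \<le> real D \<or> sqrt R \<le> real D" "real D \<le> 3 * M"
      proof -
        have m0: "0 < min M (sqrt R)" using M R by simp
        then show "1 \<le> D" unfolding D_def by linarith
        have "min M (sqrt R) \<le> real D" unfolding D_def by linarith
        then show "M \<le> real D \<or> sqrt R \<le> real D" by (auto simp: min_def split: if_splits)
        have "real D \<le> min M (sqrt R) + 1" unfolding D_def using m0 by linarith
        then show "real D \<le> 3 * M" using M2 by linarith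
      qed
      have dD: "real d \<le> sqrt R" if "d < D" for d
      proof -
        have "real d < min M (sqrt R)" using that unfolding D_def by linarith
        then show ?thesis by simp
      qed
      have "(\<Sum>n\<in>N. (norm (\<Sum>m\<in>{0..Y}. z n m))\<^sup>2)
        \<le> (real_of_int (Y - 0) + 1 + real D) * ((4 * \<beta> * M ^ 3) / real D + K1 * M * R powr (3/4 + e))"
      proof (rule van_der_Corput_differencing[OF _ D(1)])
        have "(\<Sum>n\<in>N. \<Sum>m\<in>{0..Y}. (norm (z n m))\<^sup>2) \<le> (\<Sum>n\<in>N. \<Sum>m\<in>{0..Y}. 1)"
          using z_le by (intro sum_mono) (simp add: power_le_one)
        also have "\<dots> = real X * (real_of_int Y + 1)" using Y by (simp add: N_def)
        also have "\<dots> \<le> (\<beta> * M\<^sup>2) * (4 * M)" using X Y M2 \<beta> by (intro mult_mono) auto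
        finally show "(\<Sum>n\<in>N. \<Sum>m\<in>{0..Y}. (norm (z n m))\<^sup>2) \<le> 4 * \<beta> * M ^ 3"
          by (simp add: eval_nat_numeral mult_ac)
      next
        fix d :: int assume d: "1 \<le> d" "d < int D"
        define d' where "d' = nat d"
        have d': "d = int d'" "1 \<le> d'" "d' < D" using d by (auto simp: d'_def)
        let ?M = "{m. M \<le> real m \<and> real (m + d') < 2 * M}"
        have finM: "finite ?M" by (rule finite_subset[of _ "{..nat \<lceil>2 * M\<rceil>}"]) (auto, linarith)
        have T_eq: "(\<Sum>n\<in>N. z n (int m + d) * cnj (z n (int m))) = T R m (m + d')" if "m \<in> ?M" for m
        proof -
          have m: "0 < m" "M \<le> real m" "real m < 2 * M" "M \<le> real (m + d')" "real (m + d') < 2 * M"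
            using that M by (auto intro!: gr0I)
          have "(\<Sum>n\<in>N. z n (int m + d) * cnj (z n (int m))) = (\<Sum>n\<in>window_set m (m + d'). z n (int m + d) * cnj (z n (int m)))"
          proof (rule sum.mono_neutral_right)
            show "window_set m (m + d') \<subseteq> N" using inX[of _ "real m"] m by (auto simp: window_set_def)
            show "\<forall>n\<in>N - window_set m (m + d'). z n (int m + d) * cnj (z n (int m)) = 0"
              by (auto simp: window_set_def z_def N_def d'(1))
          qed (simp add: N_def)
          also have "\<dots> = T R m (m + d')" unfolding T_def
          proof (rule sum.cong[OF refl])
            fix n assume "n \<in> window_set m (m + d')"
            then show "z n (int m + d) * cnj (z n (int m)) = e_fun (R * F (real m) (real (m + d')) (real n))"
              using m by (simp add: window_set_def z_def d'(1) F_def right_diff_distrib e_fun_diff)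
          qed
          finally show ?thesis .
        qed
        have "(\<Sum>n\<in>N. \<Sum>m\<in>{0..Y}. z n (m + d) * cnj (z n m)) = (\<Sum>m\<in>{0..Y}. \<Sum>n\<in>N. z n (m + d) * cnj (z n m))"
          by (rule sum.swap)
        also have "\<dots> = (\<Sum>m\<in>int ` ?M. \<Sum>n\<in>N. z n (m + d) * cnj (z n m))"
        proof (rule sum.mono_neutral_right)
          show "int ` ?M \<subseteq> {0..Y}" by (auto simp: Y_def le_floor_iff)
          show "\<forall>m\<in>{0..Y} - int ` ?M. (\<Sum>n\<in>N. z n (m + d) * cnj (z n m)) = 0"
          proof
            fix m assume m: "m \<in> {0..Y} - int ` ?M"
            then have "m = int (nat m)" by simp
            with m have "nat m \<notin> ?M" by (metis (no_types, lifting) DiffE image_eqI)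
            then have "\<not> (M \<le> real_of_int m \<and> real_of_int (m + d) < 2 * M)"
              using m d'(1) by (auto simp: nat_add_distrib)
            then show "(\<Sum>n\<in>N. z n (m + d) * cnj (z n m)) = 0"
              by (intro sum.neutral) (auto simp: z_def)
          qed
        qed simp
        also have "\<dots> = (\<Sum>m\<in>?M. \<Sum>n\<in>N. z n (int m + d) * cnj (z n (int m)))"
          by (subst sum.reindex) (auto simp: inj_on_def)
        also have "\<dots> = (\<Sum>m\<in>?M. T R m (m + d'))" by (intro sum.cong refl T_eq)
        also have "norm \<dots> \<le> (\<Sum>m\<in>?M. norm (T R m (m + d')))" by (rule norm_sum)
        also have "\<dots> \<le> K1 * M * R powr (3/4 + e)"
          by (rule K1(2)[OF win _ M2 M(2) d'(2) dD[OF d'(3)]]) (use R in simp)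
        finally show "norm (\<Sum>n\<in>N. \<Sum>m\<in>{0..Y}. z n (m + d) * cnj (z n m)) \<le> K1 * M * R powr (3/4 + e)" .
      qed (use Y z_supp K1 M in \<open>auto simp: N_def\<close>)
      also have "\<dots> \<le> (7 * M) * ((8 * \<beta>) * (M * R powr (3/4 + e)) + K1 * M * R powr (3/4 + e))"
      proof (intro mult_mono add_mono)
        show "real_of_int (Y - 0) + 1 + real D \<le> 7 * M" using Y D M2 by simp
        \<comment> \<open>The diagonal term: if \<open>D \<ge> M\<close>, then
          \<open>M \<le> E\<close> suffices; if \<open>D \<ge> sqrt R\<close>, the bound
          \<open>M^2 \<le> sqrt R * E\<close> is needed, and with it the full hypothesis on
          \<open>M\<close>.\<close>
        have "M ^ 3 / real D \<le> 2 * (M * E)"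
        proof -
          have "M ^ 3 \<le> (M * E) * real D"
            using D(2)
          proof
            assume "M \<le> real D"
            have "M ^ 3 = (M * M) * M" by (simp add: eval_nat_numeral)
            also have "\<dots> \<le> (M * E) * real D" using \<open>M \<le> real D\<close> ME M E by (intro mult_mono) auto
            finally show ?thesis .
          next
            assume *: "sqrt R \<le> real D"
            have "M ^ 3 = M * M\<^sup>2" by (simp add: eval_nat_numeral)
            also have "\<dots> \<le> M * (real D * E)"
            proof (rule mult_left_mono)
              have "sqrt R * E \<le> real D * E" using * E by (intro mult_right_mono) auto
              then show "M\<^sup>2 \<le> real D * E" using M2E by linarith
            qed (use M in simp)
            finally show ?thesis by (simp add: mult_ac)
          qed
          then have "M ^ 3 / real D \<le> M * E" using D(1) by (simp add: pos_divide_le_eq)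
          also have "\<dots> \<le> 2 * (M * E)" using M E by simp
          finally show ?thesis .
        qed
        also have "\<dots> \<le> 2 * (M * R powr (3/4 + e))"
          unfolding E_def using M R assms by (intro mult_left_mono powr_mono) auto
        finally show "(4 * \<beta> * M ^ 3) / real D \<le> (8 * \<beta>) * (M * R powr (3/4 + e))"
          using \<beta> mult_left_mono[of "M ^ 3 / real D" "2 * (M * R powr (3/4 + e))" "4 * \<beta>"] by simp
      qed (use M \<beta> K1 in auto)
      also have "\<dots> = 7 * (8 * \<beta> + K1) * M\<^sup>2 * R powr (3/4 + e)"
        by (simp add: power2_eq_square algebra_simps)
      finally have z_bound: "(\<Sum>n\<in>N. (norm (\<Sum>m\<in>{0..Y}. z n m))\<^sup>2) \<le> 7 * (8 * \<beta> + K1) * M\<^sup>2 * R powr (3/4 + e)" .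
      have "(\<Sum>n\<in>N. (real (r2 n))\<^sup>2) \<le> (\<Sum>n\<le>X. (real (r2 n))\<^sup>2)" by (intro sum_mono2) (auto simp: N_def)
      also have "\<dots> \<le> K2 * real X powr (1 + e)" by (rule K2(2)[OF X(1)])
      also have "\<dots> \<le> K2 * (\<beta> * M\<^sup>2) powr (1 + e)" using X K2 assms by (intro mult_left_mono powr_mono2) auto
      also have "(\<beta> * M\<^sup>2) powr (1 + e) = \<beta> powr (1 + e) * M\<^sup>2 * (M\<^sup>2) powr e"
        using \<beta> M by (simp add: powr_mult powr_add[of "M\<^sup>2"])
      also have "(M\<^sup>2) powr e \<le> (R powr 2) powr e" using M2R assms by (intro powr_mono2) auto
      also have "(R powr 2) powr e = R powr (2 * e)" by (simp add: powr_powr)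
      finally have r2_bound: "(\<Sum>n\<in>N. (real (r2 n))\<^sup>2) \<le> K2 * (\<beta> powr (1 + e) * M\<^sup>2 * R powr (2 * e))"
        using K2 \<beta> by (simp add: mult_left_mono)
      have "norm ?S \<le> (\<Sum>n\<in>N. real (r2 n) * norm (\<Sum>m\<in>{0..Y}. z n m))"
        unfolding S_eq by (rule order_trans[OF norm_sum]) (simp add: norm_mult)
      then have "(norm ?S)\<^sup>2 \<le> (\<Sum>n\<in>N. real (r2 n) * norm (\<Sum>m\<in>{0..Y}. z n m))\<^sup>2"
        by (intro power_mono) auto
      also have "\<dots> \<le> (\<Sum>n\<in>N. (real (r2 n))\<^sup>2) * (\<Sum>n\<in>N. (norm (\<Sum>m\<in>{0..Y}. z n m))\<^sup>2)"
        by (rule Cauchy_Schwarz_ineq_sum)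
      also have "\<dots> \<le> (K2 * (\<beta> powr (1 + e) * M\<^sup>2 * R powr (2 * e))) * (7 * (8 * \<beta> + K1) * M\<^sup>2 * R powr (3/4 + e))"
        using K2 by (intro mult_mono r2_bound z_bound) (auto intro!: sum_nonneg)
      also have "\<dots> = K\<^sup>2 * (M\<^sup>2)\<^sup>2 * (R powr (2 * e) * R powr (3/4 + e))"
      proof -
        have "K\<^sup>2 = K2 * \<beta> powr (1 + e) * (7 * (8 * \<beta> + K1))"
          unfolding K_def using K2 \<beta> K1 by simp
        then show ?thesis by (simp only: power2_eq_square mult_ac)
      qed
      \<comment> \<open>The exponent is \<open>3/4 + 3 * e\<close>, half of which is below
        \<open>3/8 + 2 * e\<close>.\<close>
      also have "R powr (2 * e) * R powr (3/4 + e) \<le> R powr (2 * (3/8 + 2 * e))"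
        using R assms by (simp add: powr_add[symmetric])
      also have "R powr (2 * (3/8 + 2 * e)) = (R powr (3/8 + 2 * e))\<^sup>2"
        by (simp only: power2_eq_square powr_add[symmetric] mult_2)
      finally have "(norm ?S)\<^sup>2 \<le> (K * M\<^sup>2 * R powr (3/8 + 2 * e))\<^sup>2"
        by (simp add: power_mult_distrib mult_left_mono)
      then show ?thesis by (rule power2_le_imp_le) (use K in simp)
    qed
  qed
qed

end

section \<open>Analytic functions and their leading terms\<close>

lemma at_right_le_at_within_Ico: "at_right (x::real) \<le> at x within {0..<L}" if "x \<in> {0..<L}"
proof -
  have "at_right x = at x within {x..(x + L) / 2}" using that by (simp add: at_within_Icc_at_right)
  also have "\<dots> \<le> at x within {0..<L}" using that by (intro at_le) auto
  finally show ?thesis .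
qed

lemma at_left_le_at_within_Ico: "at_left (x::real) \<le> at x within {0..<L}" if "x \<in> {0<..<L}"
proof -
  have "at x within {0..<L} = at x" using that by (intro at_within_interior) (auto simp: interior_atLeastLessThan)
  then show ?thesis by (simp add: at_le)
qed

lemma deriv_within_eq:
  assumes "x \<in> {0..<L}" "(f has_real_derivative D) (at x within {0..<L})"
  shows "deriv_within {0..<L} f x = D"
proof -
  have "at x within {0..<L} \<noteq> bot"
    using at_right_le_at_within_Ico[OF assms(1)] trivial_limit_at_right_real[of x] by (metis bot.extremum_uniqueI)
  then show ?thesis unfolding deriv_within_def
    by (rule vector_derivative_within) (use assms(2) in \<open>simp add: has_real_derivative_iff_has_vector_derivative\<close>)
qed

text \<open>The radius is cut down to \<open>L - a\<close>, so that every \<open>K\<close> below it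
  gives a point \<open>a + K\<close> of the interval. Convergence there yields convergence for all
  \<open>\<bar>t\<bar> < K\<close>, even for \<open>a = 0\<close>, where the left side lies outside
  the interval.\<close>

lemma analytic_power_series:
  assumes "real_analytic_on {0..<L} f" "a \<in> {0..<L}"
  obtains c \<rho> where "0 < \<rho>" "\<rho> \<le> L - a" "\<And>t. \<bar>t\<bar> < \<rho> \<Longrightarrow> summable (\<lambda>n. c n * t ^ n)"
    "\<And>x. x \<in> {0..<L} \<Longrightarrow> \<bar>x - a\<bar> < \<rho> \<Longrightarrow> f x = (\<Sum>n. c n * (x - a) ^ n)"
proof -
  obtain c \<rho> where c: "0 < \<rho>" "\<And>x. x \<in> {0..<L} \<Longrightarrow> \<bar>x - a\<bar> < \<rho> \<Longrightarrow> (\<lambda>n. c n * (x - a) ^ n) sums f x"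
    using assms unfolding real_analytic_on_def by blast
  define \<rho>' where "\<rho>' = min \<rho> (L - a)"
  have \<rho>': "0 < \<rho>'" using c assms(2) by (simp add: \<rho>'_def)
  show ?thesis
  proof (rule that[OF \<rho>'])
    show "\<rho>' \<le> L - a" by (simp add: \<rho>'_def)
    fix t assume t: "\<bar>t\<bar> < \<rho>'"
    then obtain K where K: "\<bar>t\<bar> < K" "K < \<rho>'" using dense by blast
    have "(\<lambda>n. c n * ((a + K) - a) ^ n) sums f (a + K)"
      by (rule c(2)) (use K t assms(2) in \<open>auto simp: \<rho>'_def\<close>)
    then have "summable (\<lambda>n. c n * K ^ n)" by (simp add: sums_iff)
    then show "summable (\<lambda>n. c n * t ^ n)" by (rule powser_inside) (use K in auto)
  next
    fix x assume "x \<in> {0..<L}" "\<bar>x - a\<bar> < \<rho>'"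
    then show "f x = (\<Sum>n. c n * (x - a) ^ n)" using c(2)[of x] by (simp add: \<rho>'_def sums_iff)
  qed
qed

text \<open>The series is differentiated on a full neighbourhood and only then restricted to the
  interval, so the endpoint 0 is not a special case.\<close>

lemma analytic_deriv_aux:
  assumes "real_analytic_on {0..<L} f" "a \<in> {0..<L}"
  obtains c \<rho> where "0 < \<rho>" "\<And>x. x \<in> {0..<L} \<Longrightarrow> \<bar>x - a\<bar> < \<rho> \<Longrightarrow>
    (f has_real_derivative (\<Sum>n. c n * (x - a) ^ n)) (at x within {0..<L}) \<and> summable (\<lambda>n. c n * (x - a) ^ n)"
proof -
  obtain c \<rho> where c: "0 < \<rho>" "\<rho> \<le> L - a" "\<And>t. \<bar>t\<bar> < \<rho> \<Longrightarrow> summable (\<lambda>n. c n * t ^ n)"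
    "\<And>x. x \<in> {0..<L} \<Longrightarrow> \<bar>x - a\<bar> < \<rho> \<Longrightarrow> f x = (\<Sum>n. c n * (x - a) ^ n)"
    by (rule analytic_power_series[OF assms], rule that)
  show ?thesis
  proof (rule that[OF c(1)], rule conjI)
    fix x assume x: "x \<in> {0..<L}" "\<bar>x - a\<bar> < \<rho>"
    then obtain K where K: "\<bar>x - a\<bar> < K" "K < \<rho>" using dense by blast
    have "summable (\<lambda>n. c n * K ^ n)" using K by (intro c(3)) auto
    then have "((\<lambda>t. \<Sum>n. c n * t ^ n) has_real_derivative (\<Sum>n. diffs c n * (x - a) ^ n)) (at (x - a))"
      by (rule termdiffs_strong) (use K in auto)
    then have "((\<lambda>x. \<Sum>n. c n * (x - a) ^ n) has_real_derivative (\<Sum>n. diffs c n * (x - a) ^ n)) (at x)"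
      using DERIV_shift[of "\<lambda>t. \<Sum>n. c n * t ^ n" _ x "- a"] by simp
    then have "((\<lambda>x. \<Sum>n. c n * (x - a) ^ n) has_real_derivative (\<Sum>n. diffs c n * (x - a) ^ n)) (at x within {0..<L})"
      by (rule has_field_derivative_at_within)
    then show "(f has_real_derivative (\<Sum>n. diffs c n * (x - a) ^ n)) (at x within {0..<L})"
    proof (rule has_field_derivative_transform_within)
      show "0 < \<rho> - \<bar>x - a\<bar>" using x by simp
      show "(\<Sum>n. c n * (y - a) ^ n) = f y" if "y \<in> {0..<L}" "dist y x < \<rho> - \<bar>x - a\<bar>" for y
        using that by (intro c(4)[symmetric]) (auto simp: dist_real_def)
    qed (use x in auto)
    show "summable (\<lambda>n. diffs c n * (x - a) ^ n)"
      by (rule termdiff_converges[of _ \<rho>]) (use x c(3) in auto)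
  qed
qed

lemma analytic_has_deriv_within:
  assumes "real_analytic_on {0..<L} f" "x \<in> {0..<L}"
  shows "(f has_real_derivative deriv_within {0..<L} f x) (at x within {0..<L})"
proof -
  obtain c \<rho> where c: "0 < \<rho>" "\<And>y. y \<in> {0..<L} \<Longrightarrow> \<bar>y - x\<bar> < \<rho> \<Longrightarrow>
    (f has_real_derivative (\<Sum>n. c n * (y - x) ^ n)) (at y within {0..<L}) \<and> summable (\<lambda>n. c n * (y - x) ^ n)"
    by (rule analytic_deriv_aux[OF assms], rule that)
  have *: "(f has_real_derivative (\<Sum>n. c n * (x - x) ^ n)) (at x within {0..<L})"
    using c(2)[OF assms(2)] c(1) by simp
  show ?thesis using * unfolding deriv_within_eq[OF assms(2) *] .
qed

lemma analytic_deriv_within: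
  assumes "real_analytic_on {0..<L} f"
  shows "real_analytic_on {0..<L} (deriv_within {0..<L} f)"
  unfolding real_analytic_on_def
proof
  fix a assume a: "a \<in> {0..<L}"
  obtain c \<rho> where c: "0 < \<rho>" "\<And>y. y \<in> {0..<L} \<Longrightarrow> \<bar>y - a\<bar> < \<rho> \<Longrightarrow>
    (f has_real_derivative (\<Sum>n. c n * (y - a) ^ n)) (at y within {0..<L}) \<and> summable (\<lambda>n. c n * (y - a) ^ n)"
    by (rule analytic_deriv_aux[OF assms a], rule that)
  have "(\<lambda>n. c n * (x - a) ^ n) sums deriv_within {0..<L} f x" if "x \<in> {0..<L}" "\<bar>x - a\<bar> < \<rho>" for x
  proof -
    have "deriv_within {0..<L} f x = (\<Sum>n. c n * (x - a) ^ n)" using c(2)[OF that] deriv_within_eq[OF that(1)] by blast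
    then show ?thesis using c(2)[OF that] by (simp add: sums_iff)
  qed
  then show "\<exists>c. \<exists>\<rho>>0. \<forall>x\<in>{0..<L}. \<bar>x - a\<bar> < \<rho> \<longrightarrow> (\<lambda>n. c n * (x - a) ^ n) sums deriv_within {0..<L} f x"
    using c(1) by blast
qed

text \<open>\<open>l\<close> is the first nonzero coefficient at \<open>a\<close>. One exists, since
  otherwise \<open>g\<close> would vanish on a whole interval, against the finiteness of its
  zeros.\<close>

lemma analytic_leading_term:
  assumes "real_analytic_on {0..<L} g" "a \<in> {0..<L}" "finite {x \<in> {0..<L}. g x = 0}"
  obtains k l where "l \<noteq> 0" "((\<lambda>x. g x / (x - a) ^ k) \<longlongrightarrow> l) (at a within {0..<L})"
proof -
  obtain c \<rho> where c: "0 < \<rho>" "\<rho> \<le> L - a" "\<And>t. \<bar>t\<bar> < \<rho> \<Longrightarrow> summable (\<lambda>n. c n * t ^ n)"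
    "\<And>x. x \<in> {0..<L} \<Longrightarrow> \<bar>x - a\<bar> < \<rho> \<Longrightarrow> g x = (\<Sum>n. c n * (x - a) ^ n)"
    by (rule analytic_power_series[OF assms(1,2)], rule that)
  have ex: "\<exists>n. c n \<noteq> 0"
  proof (rule ccontr)
    assume "\<not> (\<exists>n. c n \<noteq> 0)"
    then have "{a<..<a + \<rho>} \<subseteq> {x \<in> {0..<L}. g x = 0}" using c(2,4) assms(2) by auto
    moreover have "infinite {a<..<a + \<rho>}" using c(1) by (simp add: infinite_Ioo)
    ultimately show False using assms(3) finite_subset by blast
  qed
  define k where "k = (LEAST n. c n \<noteq> 0)"
  have k: "c k \<noteq> 0" unfolding k_def by (rule LeastI_ex[OF ex])
  have k0: "c n = 0" if "n < k" for n using not_less_Least[OF that[unfolded k_def]] by blast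
  define Q where "Q t = (\<Sum>n. c (n + k) * t ^ n)" for t
  have sum_shift: "(\<Sum>n. c n * t ^ n) = t ^ k * Q t" and summ: "t \<noteq> 0 \<Longrightarrow> summable (\<lambda>n. c (n + k) * t ^ n)"
    if t: "\<bar>t\<bar> < \<rho>" for t
  proof -
    have eq: "c (n + k) * t ^ (n + k) = t ^ k * (c (n + k) * t ^ n)" for n by (simp add: power_add)
    have s: "summable (\<lambda>n. c (n + k) * t ^ (n + k))" using c(3)[OF t] by (rule summable_ignore_initial_segment)
    show "summable (\<lambda>n. c (n + k) * t ^ n)" if "t \<noteq> 0"
      using s unfolding eq by (subst (asm) summable_cmult_iff) (use that in auto)
    show "(\<Sum>n. c n * t ^ n) = t ^ k * Q t"
    proof (cases "t = 0")
      case False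
      have "(\<Sum>n. c n * t ^ n) = (\<Sum>n. c (n + k) * t ^ (n + k)) + (\<Sum>i<k. c i * t ^ i)"
        by (rule suminf_split_initial_segment[OF c(3)[OF t]])
      also have "(\<Sum>i<k. c i * t ^ i) = 0" using k0 by simp
      also have "(\<Sum>n. c (n + k) * t ^ (n + k)) = t ^ k * Q t"
        unfolding eq Q_def by (rule suminf_mult[OF \<open>t \<noteq> 0 \<Longrightarrow> summable (\<lambda>n. c (n + k) * t ^ n)\<close>[OF False]])
      finally show ?thesis by simp
    next
      case True
      then show ?thesis using k0[of 0] by (cases k) (auto simp: Q_def powser_zero)
    qed
  qed
  obtain K where K: "0 < K" "K < \<rho>" using dense c(1) by blast
  have "isCont Q 0" unfolding Q_def
    by (rule isCont_powser[of _ K]) (use summ[of K] K in auto)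
  moreover have "Q 0 = c k" unfolding Q_def by (simp only: powser_zero add_0)
  ultimately have "(Q \<longlongrightarrow> c k) (at 0)" by (simp only: isCont_def)
  then have "((\<lambda>x. Q (x - a)) \<longlongrightarrow> c k) (at a)" using LIM_offset[of Q "c k" 0 "- a"] by simp
  then have lim: "((\<lambda>x. Q (x - a)) \<longlongrightarrow> c k) (at a within {0..<L})" by (rule tendsto_mono[rotated]) (simp add: at_le)
  have "eventually (\<lambda>x. Q (x - a) = g x / (x - a) ^ k) (at a within {0..<L})"
    unfolding eventually_at
  proof (intro exI[of _ \<rho>] conjI ballI impI)
    fix x assume "x \<in> {0..<L}" "x \<noteq> a \<and> dist x a < \<rho>"
    then show "Q (x - a) = g x / (x - a) ^ k" using c(4)[of x] sum_shift[of "x - a"] by (simp add: dist_real_def)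
  qed (rule c(1))
  then have "((\<lambda>x. g x / (x - a) ^ k) \<longlongrightarrow> c k) (at a within {0..<L})" using lim by (rule Lim_transform_eventually[rotated])
  then show ?thesis using k that by blast
qed

text \<open>L'Hopital's rule for \<open>g - y\<close> over \<open>(x - a) ^ Suc k\<close>, on the
  one side from which the arc reaches \<open>a\<close>.\<close>

lemma leading_term_of_primitive:
  fixes g g' :: "real \<Rightarrow> real"
  assumes F: "F = at_left a \<or> F = at_right a"
    and lim: "(g \<longlongrightarrow> y) F" and deriv: "eventually (\<lambda>x. (g has_real_derivative g' x) (at x)) F"
    and lead: "((\<lambda>x. g' x / (x - a) ^ k) \<longlongrightarrow> l) F"
  shows "((\<lambda>x. (g x - y) / (x - a) ^ Suc k) \<longlongrightarrow> l / real (Suc k)) F"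
proof -
  have 1: "((\<lambda>x. g x - y) \<longlongrightarrow> 0) F" using lim by (rule LIM_zero)
  have "((\<lambda>x. x - a) \<longlongrightarrow> a - a) F" using F by (elim disjE; hypsubst; intro tendsto_intros)
  from tendsto_power[OF this, of "Suc k"] have 2: "((\<lambda>x. (x - a) ^ Suc k) \<longlongrightarrow> 0) F" by simp
  have ne: "eventually (\<lambda>x. x \<noteq> a) F" using F by (auto simp: eventually_at_filter)
  have 3: "eventually (\<lambda>x. (x - a) ^ Suc k \<noteq> 0) F" "eventually (\<lambda>x. real (Suc k) * (x - a) ^ k \<noteq> 0) F"
    using ne by (eventually_elim, simp)+
  have 4: "eventually (\<lambda>x. ((\<lambda>x. g x - y) has_real_derivative g' x) (at x)) F"
    using deriv by eventually_elim (auto intro!: derivative_eq_intros)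
  have 5: "eventually (\<lambda>x. ((\<lambda>x. (x - a) ^ Suc k) has_real_derivative real (Suc k) * (x - a) ^ k) (at x)) F"
    by (rule always_eventually) (auto intro!: derivative_eq_intros simp del: power_Suc)
  have 6: "((\<lambda>x. g' x / (real (Suc k) * (x - a) ^ k)) \<longlongrightarrow> l / real (Suc k)) F"
    using tendsto_divide[OF lead tendsto_const[of "real (Suc k)"]] by (simp add: mult.commute)
  from F show ?thesis
  proof
    assume "F = at_left a"
    note * = 1 2 3 4 5 6
    show ?thesis unfolding \<open>F = at_left a\<close> by (rule lhopital_left) (rule *[unfolded \<open>F = at_left a\<close>])+
  next
    assume "F = at_right a"
    note * = 1 2 3 4 5 6
    show ?thesis unfolding \<open>F = at_right a\<close> by (rule lhopital_right) (rule *[unfolded \<open>F = at_right a\<close>])+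
  qed
qed

lemma bigtheta_leading_term:
  fixes g :: "real \<Rightarrow> real"
  assumes "F = at_left a \<or> F = at_right a" "((\<lambda>x. g x / (x - a) ^ k) \<longlongrightarrow> l) F" "l \<noteq> 0"
  shows "g \<in> \<Theta>[F](\<lambda>x. \<bar>x - a\<bar> powr real k)"
proof (rule bigthetaI_tendsto_norm)
  have ne: "eventually (\<lambda>x. x \<noteq> a) F" using assms(1) by (auto simp: eventually_at_filter)
  have "eventually (\<lambda>x. norm (g x / (x - a) ^ k) = norm (g x / \<bar>x - a\<bar> powr real k)) F"
    using ne by eventually_elim (simp add: powr_realpow power_abs)
  then show "((\<lambda>x. norm (g x / \<bar>x - a\<bar> powr real k)) \<longlongrightarrow> norm l) F"
    by (rule Lim_transform_eventually[OF tendsto_norm[OF assms(2)]])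
qed (use assms(3) in simp)

text \<open>The vanishing orders of \<open>f'''\<close>, \<open>f''\<close>, \<open>f'\<close> and \<open>f'\<^sup>2 - f'(a)\<^sup>2\<close> at \<open>a\<close> are \<open>k\<close>, \<open>k2\<close>, \<open>k1\<close> and \<open>q\<close>.
  If \<open>f''(a) = 0\<close> then \<open>k2 = k + 1\<close>, which keeps \<open>\<kappa>\<close> above \<open>-2\<close>.\<close>

lemma curvature_order:
  fixes D1 D2 D3 :: "real \<Rightarrow> real"
  assumes F: "F = at_left a \<or> F = at_right a"
    and lim: "(D1 \<longlongrightarrow> D1 a) F" "(D2 \<longlongrightarrow> D2 a) F"
    and deriv: "eventually (\<lambda>x. (D1 has_real_derivative D2 x) (at x)) F" "eventually (\<lambda>x. (D2 has_real_derivative D3 x) (at x)) F"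
    and lead: "((\<lambda>x. D3 x / (x - a) ^ k) \<longlongrightarrow> l) F" "l \<noteq> 0"
  obtains \<kappa> where "-2 \<le> \<kappa>" "0 < \<kappa> \<Longrightarrow> D2 a \<noteq> 0"
    "(\<lambda>x. D3 x / (4 * D1 x * D2 x ^ 3)) \<in> \<Theta>[F](\<lambda>x. \<bar>(D1 x)\<^sup>2 - (D1 a)\<^sup>2\<bar> powr \<kappa>)"
proof -
  have ne: "eventually (\<lambda>x. 0 < \<bar>x - a\<bar>) F" using F by (auto simp: eventually_at_filter)
  \<comment> \<open>If \<open>f''\<close> vanishes at \<open>a\<close>, it is the primitive of
    \<open>f'''\<close> with value 0 there, and its order is one larger.\<close>
  obtain k2 l2 where k2: "l2 \<noteq> 0" "((\<lambda>x. D2 x / (x - a) ^ k2) \<longlongrightarrow> l2) F" "D2 a \<noteq> 0 \<and> k2 = 0 \<or> D2 a = 0 \<and> k2 = Suc k"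
  proof (cases "D2 a = 0")
    case True
    have "((\<lambda>x. D2 x / (x - a) ^ Suc k) \<longlongrightarrow> l / real (Suc k)) F"
      using leading_term_of_primitive[OF F lim(2) deriv(2) lead(1)] True by simp
    then show ?thesis using that[of "l / real (Suc k)" "Suc k"] lead(2) True by simp
  next
    case False
    then show ?thesis using that[of "D2 a" 0] lim(2) by simp
  qed
  define l1 where "l1 = l2 / real (Suc k2)"
  have l1: "l1 \<noteq> 0" using k2(1) by (simp add: l1_def)
  have diff: "((\<lambda>x. (D1 x - D1 a) / (x - a) ^ Suc k2) \<longlongrightarrow> l1) F"
    unfolding l1_def by (rule leading_term_of_primitive[OF F lim(1) deriv(1) k2(2)])
  \<comment> \<open>If \<open>D1 a = 0\<close>, the difference of squares is itself a square and the
    order doubles. Otherwise the factor \<open>D1 x + D1 a\<close> has the nonzero limit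
    \<open>2 * D1 a\<close>.\<close>
  obtain k1 l1' q lq where k1: "l1' \<noteq> 0" "((\<lambda>x. D1 x / (x - a) ^ k1) \<longlongrightarrow> l1') F"
    and q: "lq \<noteq> 0" "((\<lambda>x. ((D1 x)\<^sup>2 - (D1 a)\<^sup>2) / (x - a) ^ q) \<longlongrightarrow> lq) F"
    and k1q: "k1 = 0 \<and> q = Suc k2 \<or> k1 = Suc k2 \<and> q = 2 * Suc k2"
  proof (cases "D1 a = 0")
    case True
    have "((\<lambda>x. ((D1 x - D1 a) / (x - a) ^ Suc k2)\<^sup>2) \<longlongrightarrow> l1\<^sup>2) F"
      by (intro tendsto_power diff)
    then have "((\<lambda>x. ((D1 x)\<^sup>2 - (D1 a)\<^sup>2) / (x - a) ^ (2 * Suc k2)) \<longlongrightarrow> l1\<^sup>2) F"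
      using True by (simp add: power_divide power_mult[symmetric] mult.commute del: power_Suc)
    then show ?thesis using that[of l1 "Suc k2" "l1\<^sup>2" "2 * Suc k2"] l1 diff True by simp
  next
    case False
    have "((\<lambda>x. (D1 x - D1 a) / (x - a) ^ Suc k2 * (D1 x + D1 a)) \<longlongrightarrow> l1 * (D1 a + D1 a)) F"
      by (intro tendsto_intros diff lim)
    then have "((\<lambda>x. ((D1 x)\<^sup>2 - (D1 a)\<^sup>2) / (x - a) ^ Suc k2) \<longlongrightarrow> l1 * (D1 a + D1 a)) F"
      by (simp add: power2_eq_square square_diff_square_factored mult.commute del: power_Suc)
    then show ?thesis using that[of "D1 a" 0 "l1 * (D1 a + D1 a)" "Suc k2"] l1 lim(1) False by simp
  qed
  \<comment> \<open>\<open>e\<close> is the order of the quotient in \<open>x - a\<close>; division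
    by \<open>q\<close> turns it into an exponent of the difference of the squares.\<close>
  define e where "e = real k - real k1 - 3 * real k2"
  define \<kappa> where "\<kappa> = e / real q"
  have q0: "0 < q" using k1q by auto
  note \<Theta>3 = bigtheta_leading_term[OF F lead] and \<Theta>2 = bigtheta_leading_term[OF F k2(2,1)]
    and \<Theta>1 = bigtheta_leading_term[OF F k1(2,1)] and \<Theta>q = bigtheta_leading_term[OF F q(2,1)]
  show ?thesis
  proof (rule that)
    \<comment> \<open>The tightest case is \<open>k2 = k + 1\<close>, \<open>k1 = 0\<close>,
      \<open>q = k + 2\<close>, where \<open>e = - 2 * k - 3\<close> exceeds \<open>- 2 * q\<close>
      by 1.\<close>
    have "- 2 * real q \<le> e" using k2(3) k1q by (auto simp: e_def)
    then show "-2 \<le> \<kappa>" using q0 by (simp add: \<kappa>_def pos_le_divide_eq)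
    show "D2 a \<noteq> 0" if "0 < \<kappa>"
    proof
      assume "D2 a = 0"
      then have "e \<le> 0" using k2(3) by (auto simp: e_def)
      then have "\<kappa> \<le> 0" using q0 by (simp add: \<kappa>_def divide_nonpos_pos)
      then show False using that by simp
    qed
    have "(\<lambda>x. D3 x / (4 * D1 x * D2 x ^ 3)) \<in> \<Theta>[F](\<lambda>x. \<bar>x - a\<bar> powr real k / (4 * \<bar>x - a\<bar> powr real k1 * (\<bar>x - a\<bar> powr real k2) ^ 3))"
      unfolding power3_eq_cube divide_inverse
      by (intro landau_theta.mult bigtheta_inverse[THEN iffD2] bigtheta_refl \<Theta>1 \<Theta>2 \<Theta>3)
    also have "(\<lambda>x. \<bar>x - a\<bar> powr real k / (4 * \<bar>x - a\<bar> powr real k1 * (\<bar>x - a\<bar> powr real k2) ^ 3)) \<in> \<Theta>[F](\<lambda>x. (1/4) * \<bar>x - a\<bar> powr e)"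
    proof (rule bigthetaI_cong)
      show "eventually (\<lambda>x. \<bar>x - a\<bar> powr real k / (4 * \<bar>x - a\<bar> powr real k1 * (\<bar>x - a\<bar> powr real k2) ^ 3) = (1/4) * \<bar>x - a\<bar> powr e) F"
        using ne by eventually_elim (simp add: e_def powr_diff powr_power mult.commute)
    qed
    also have "(\<lambda>x. (1/4) * \<bar>x - a\<bar> powr e) \<in> \<Theta>[F](\<lambda>x. \<bar>x - a\<bar> powr e)" by simp
    also have "(\<lambda>x. \<bar>x - a\<bar> powr e) \<in> \<Theta>[F](\<lambda>x. \<bar>\<bar>x - a\<bar> powr real q\<bar> powr \<kappa>)"
      using q0 by (simp add: powr_powr \<kappa>_def)
    also have "(\<lambda>x. \<bar>\<bar>x - a\<bar> powr real q\<bar> powr \<kappa>) \<in> \<Theta>[F](\<lambda>x. \<bar>(D1 x)\<^sup>2 - (D1 a)\<^sup>2\<bar> powr \<kappa>)"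
      by (rule bigtheta_powr, subst bigtheta_sym) (rule \<Theta>q)
    finally show "(\<lambda>x. D3 x / (4 * D1 x * D2 x ^ 3)) \<in> \<Theta>[F](\<lambda>x. \<bar>(D1 x)\<^sup>2 - (D1 a)\<^sup>2\<bar> powr \<kappa>)" .
  qed
qed

section \<open>Arcs of the generatrix\<close>

text \<open>In the application \<open>lo\<close> and \<open>hi\<close> are consecutive points of the
  sequence \<open>r\<close>. The conditions on \<open>f''\<close> and \<open>f'''\<close> hold only
  inside the arc: both may vanish at the ends, and this is the degeneracy that
  \<open>\<kappa>\<close> measures.\<close>

locale generatrix_arc =
  fixes f D1 D2 D3 :: "real \<Rightarrow> real" and lo hi :: real
  assumes lohi: "0 \<le> lo" "lo < hi"
    and cont: "continuous_on {lo..hi} D1" "continuous_on {lo..hi} D2" "continuous_on {lo<..<hi} D3"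
    and deriv: "\<And>x. lo < x \<Longrightarrow> x < hi \<Longrightarrow> (f has_real_derivative D1 x) (at x)"
      "\<And>x. lo < x \<Longrightarrow> x < hi \<Longrightarrow> (D1 has_real_derivative D2 x) (at x)"
      "\<And>x. lo < x \<Longrightarrow> x < hi \<Longrightarrow> (D2 has_real_derivative D3 x) (at x)"
    and D2_neg: "\<And>x. lo < x \<Longrightarrow> x < hi \<Longrightarrow> D2 x < 0"
    and D3_nonzero: "\<And>x. lo < x \<Longrightarrow> x < hi \<Longrightarrow> D3 x \<noteq> 0"
    and D1_lo: "D1 lo \<le> 0"
begin

definition u :: "real \<Rightarrow> real" where "u x = (D1 x)\<^sup>2"

lemma D1_less: "D1 y < D1 x" if "lo \<le> x" "x < y" "y \<le> hi"
proof (rule DERIV_neg_imp_decreasing_open[OF that(2)])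
  show "\<exists>d. (D1 has_real_derivative d) (at z) \<and> d < 0" if "x < z" "z < y" for z
    using deriv(2)[of z] D2_neg[of z] that \<open>lo \<le> x\<close> \<open>y \<le> hi\<close> by auto
  show "continuous_on {x..y} D1" using that by (intro continuous_on_subset[OF cont(1)]) auto
qed

lemma D1_nonpos: "lo \<le> x \<Longrightarrow> x \<le> hi \<Longrightarrow> D1 x \<le> 0"
  using D1_less[of lo x] D1_lo by (cases "x = lo") auto

lemma D1_neg: "lo < x \<Longrightarrow> x \<le> hi \<Longrightarrow> D1 x < 0"
  using D1_less[of lo x] D1_lo by auto

lemma u_less: "u x < u y" if "lo \<le> x" "x < y" "y \<le> hi"
proof -
  have "(- D1 x)\<^sup>2 < (- D1 y)\<^sup>2" using D1_less[OF that] D1_nonpos[of x] that by (intro power_strict_mono) auto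
  then show ?thesis by (simp add: u_def)
qed

lemma continuous_on_u: "continuous_on {lo..hi} u"
  unfolding u_def by (intro continuous_intros cont)

lemma deriv_u: "lo < x \<Longrightarrow> x < hi \<Longrightarrow> (u has_real_derivative 2 * D1 x * D2 x) (at x)"
  unfolding u_def using DERIV_power[OF deriv(2), of x 2] by (simp add: mult_ac)

definition \<rho> :: "real \<Rightarrow> real" where "\<rho> v = (SOME x. lo < x \<and> x < hi \<and> u x = v)"

lemma \<rho>: "lo < \<rho> v" "\<rho> v < hi" "u (\<rho> v) = v" if "u lo < v" "v < u hi"
proof -
  have "\<exists>x\<ge>lo. x \<le> hi \<and> u x = v"
    using that lohi by (intro IVT' continuous_on_u) auto
  then obtain x where x: "lo \<le> x" "x \<le> hi" "u x = v" by blast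
  then have "lo < x \<and> x < hi \<and> u x = v" using that by (cases "x = lo"; cases "x = hi") auto
  then have "lo < \<rho> v \<and> \<rho> v < hi \<and> u (\<rho> v) = v" unfolding \<rho>_def by (rule someI)
  then show "lo < \<rho> v" "\<rho> v < hi" "u (\<rho> v) = v" by auto
qed

lemma u_between: "u lo < u x" "u x < u hi" if "lo < x" "x < hi"
  using u_less[of lo x] u_less[of x hi] that by auto

lemma u_inj: "x = y" if "u x = u y" "lo \<le> x" "x \<le> hi" "lo \<le> y" "y \<le> hi"
  using u_less[of x y] u_less[of y x] that by (cases x y rule: linorder_cases) auto

lemma \<rho>_u: "\<rho> (u x) = x" if "lo < x" "x < hi"
  by (rule u_inj) (use \<rho>[OF u_between[OF that]] that in auto)

lemma D1_\<rho>: "D1 (\<rho> v) = - sqrt v" if "u lo < v" "v < u hi"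
proof -
  define x where "x = \<rho> v"
  have x: "lo < x" "x < hi" "(D1 x)\<^sup>2 = v" using \<rho>[OF that] by (auto simp: x_def u_def)
  have "sqrt v = \<bar>D1 x\<bar>" unfolding x(3)[symmetric] by (rule real_sqrt_abs)
  then show ?thesis using D1_neg[of x] x(1,2) by (simp add: x_def[symmetric])
qed

lemma u_lo_nonneg: "0 \<le> u lo" by (simp add: u_def)

context
  fixes v assumes v: "u lo < v" "v < u hi"
begin

lemma v_pos: "0 < v" using v u_lo_nonneg by linarith

lemma D2_\<rho>_neg: "D2 (\<rho> v) < 0" using D2_neg \<rho>[OF v] by auto

lemma deriv_\<rho>: "(\<rho> has_real_derivative - 1 / (2 * sqrt v * D2 (\<rho> v))) (at v)"
proof -
  let ?x = "\<rho> v"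
  note x = \<rho>[OF v]
  define d where "d = min (?x - lo) (hi - ?x) / 2"
  have d: "0 < d" using x by (simp add: d_def)
  have near: "lo < z" "z < hi" if "\<bar>z - ?x\<bar> \<le> d" for z
  proof -
    have "2 * \<bar>z - ?x\<bar> \<le> ?x - lo" "2 * \<bar>z - ?x\<bar> \<le> hi - ?x" using that by (auto simp: d_def)
    then have "\<bar>z - ?x\<bar> < ?x - lo" "\<bar>z - ?x\<bar> < hi - ?x" using x by simp_all
    then show "lo < z" "z < hi" by (simp_all add: abs_less_iff)
  qed
  have "isCont \<rho> (u ?x)"
    by (rule isCont_inverse_function[where f = u, OF d]) (use near \<rho>_u deriv_u in \<open>auto intro: DERIV_isCont[OF deriv_u]\<close>)
  then have "isCont \<rho> v" using x by simp
  then have "(\<rho> has_real_derivative inverse (2 * D1 ?x * D2 ?x)) (at v)"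
    by (intro DERIV_inverse_function[where f = u and g = \<rho>, OF deriv_u[OF x(1,2)] _ v])
      (use D1_neg[of ?x] D2_neg[of ?x] x \<rho> in auto)
  also have "inverse (2 * D1 ?x * D2 ?x) = - 1 / (2 * sqrt v * D2 ?x)"
    unfolding D1_\<rho>[OF v] by (simp add: field_simps)
  finally show ?thesis .
qed

lemma deriv_D2_\<rho>: "((\<lambda>v. D2 (\<rho> v)) has_real_derivative D3 (\<rho> v) * (- 1 / (2 * sqrt v * D2 (\<rho> v)))) (at v)"
  by (rule DERIV_chain'[OF deriv_\<rho> deriv(3)]) (use \<rho>[OF v] in auto)

end

text \<open>The support function at \<open>(sqrt v, 0, 1)\<close>, a Legendre transform:
  \<open>\<rho> v\<close> is the radius at which the profile has slope
  \<open>- sqrt v\<close>.\<close>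

definition H :: "real \<Rightarrow> real" where "H v = sqrt v * \<rho> v + f (\<rho> v)"
definition \<phi> :: "real \<Rightarrow> real" where "\<phi> v = \<rho> v / (2 * sqrt v)"
definition G :: "real \<Rightarrow> real" where "G v = - 1 / (2 * D2 (\<rho> v))"
definition G1 :: "real \<Rightarrow> real" where "G1 v = D3 (\<rho> v) / (4 * D1 (\<rho> v) * D2 (\<rho> v) ^ 3)"

context
  fixes v assumes v: "u lo < v" "v < u hi"
begin

text \<open>Envelope effect: the two terms with the derivative of \<open>\<rho>\<close> cancel
  because \<open>D1 (\<rho> v) = - sqrt v\<close>.\<close>

lemma deriv_H: "(H has_real_derivative \<phi> v) (at v)"
proof -
  define y where "y = - 1 / (2 * sqrt v * D2 (\<rho> v))"
  have 1: "((\<lambda>v. f (\<rho> v)) has_real_derivative D1 (\<rho> v) * y) (at v)" unfolding y_def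
    by (rule DERIV_chain'[OF deriv_\<rho>[OF v] deriv(1)]) (use \<rho>[OF v] in auto)
  have 2: "((\<lambda>v. sqrt v * \<rho> v) has_real_derivative inverse (sqrt v) / 2 * \<rho> v + y * sqrt v) (at v)" unfolding y_def
    by (rule DERIV_mult[OF DERIV_real_sqrt[OF v_pos[OF v]] deriv_\<rho>[OF v]])
  have "inverse (sqrt v) / 2 * \<rho> v + y * sqrt v + D1 (\<rho> v) * y = \<phi> v"
    unfolding D1_\<rho>[OF v] \<phi>_def by (simp add: field_simps)
  then show ?thesis unfolding H_def using DERIV_add[OF 2 1] by simp
qed

lemma deriv_\<phi>: "(\<phi> has_real_derivative (G v - \<phi> v) / (2 * v)) (at v)"
proof -
  have "(\<phi> has_real_derivative (- 1 / (2 * sqrt v * D2 (\<rho> v)) * (2 * sqrt v) - \<rho> v * (2 * (inverse (sqrt v) / 2)))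
      / ((2 * sqrt v) * (2 * sqrt v))) (at v)"
    unfolding \<phi>_def using v_pos[OF v]
    by (intro DERIV_divide deriv_\<rho>[OF v] DERIV_cmult DERIV_real_sqrt) auto
  also have "(- 1 / (2 * sqrt v * D2 (\<rho> v)) * (2 * sqrt v) - \<rho> v * (2 * (inverse (sqrt v) / 2)))
      / ((2 * sqrt v) * (2 * sqrt v)) = (G v - \<phi> v) / (2 * v)"
  proof -
    define t where "t = sqrt v"
    have t: "0 < t" "v = t * t" using v_pos[OF v] by (auto simp: t_def)
    show ?thesis unfolding G_def \<phi>_def t_def[symmetric] unfolding t(2)
      using t(1) D2_\<rho>_neg[OF v] unfolding t(2) by (simp add: field_simps)
  qed
  finally show ?thesis .
qed

lemma deriv_G: "(G has_real_derivative G1 v) (at v)"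
proof -
  let ?y = "D2 (\<rho> v)"
  have y: "?y < 0" by (rule D2_\<rho>_neg[OF v])
  have "(G has_real_derivative (0 * (2 * ?y) - (- 1) * (2 * (D3 (\<rho> v) * (- 1 / (2 * sqrt v * ?y))))) / ((2 * ?y) * (2 * ?y))) (at v)"
    unfolding G_def using y by (intro DERIV_divide DERIV_const DERIV_cmult deriv_D2_\<rho>[OF v]) auto
  also have "(0 * (2 * ?y) - (- 1) * (2 * (D3 (\<rho> v) * (- 1 / (2 * sqrt v * ?y))))) / ((2 * ?y) * (2 * ?y)) = G1 v"
    unfolding G1_def D1_\<rho>[OF v] using y v_pos[OF v] by (simp add: field_simps power3_eq_cube)
  finally show ?thesis .
qed

end

lemma D3_sign: obtains s where "s \<in> {1, -1::real}" "\<And>x. lo < x \<Longrightarrow> x < hi \<Longrightarrow> s * D3 x = \<bar>D3 x\<bar>"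
proof -
  define m where "m = (lo + hi) / 2"
  have m: "lo < m" "m < hi" using lohi by (auto simp: m_def)
  have same: "0 < D3 x * D3 m" if x: "lo < x" "x < hi" for x
  proof (rule ccontr)
    assume "\<not> 0 < D3 x * D3 m"
    then have neg: "D3 x * D3 m < 0" using D3_nonzero x m by (simp add: less_le not_less)
    have "\<exists>z. lo < z \<and> z < hi \<and> D3 z = 0"
    proof -
      have "connected (D3 ` {lo<..<hi})" by (intro connected_continuous_image cont connected_Ioo)
      moreover have "D3 x \<in> D3 ` {lo<..<hi}" "D3 m \<in> D3 ` {lo<..<hi}" using x m by auto
      ultimately have "0 \<in> D3 ` {lo<..<hi}"
        using neg unfolding connected_iff_interval by (smt (verit) mult_less_0_iff)
      then show ?thesis by auto
    qed
    then show False using D3_nonzero by blast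
  qed
  show ?thesis
  proof (rule that[of "sgn (D3 m)"])
    show "sgn (D3 m) \<in> {1, -1}" using D3_nonzero[OF m] by (auto simp: sgn_if)
    show "sgn (D3 m) * D3 x = \<bar>D3 x\<bar>" if "lo < x" "x < hi" for x
      using same[OF that] by (auto simp: sgn_if zero_less_mult_iff)
  qed
qed

text \<open>The asymptotic order at \<open>e\<close> gives the two-sided bound near \<open>e\<close>
  only. A compactness argument extends it to the half of the arc, measured in \<open>u\<close>, that
  is adjacent to \<open>e\<close>.\<close>

lemma endpoint_phase_exists:
  assumes e: "e = lo \<and> F = at_right lo \<or> e = hi \<and> F = at_left hi"
    and \<kappa>: "-2 \<le> \<kappa>" "0 < \<kappa> \<Longrightarrow> D2 e \<noteq> 0"
    and \<Theta>: "(\<lambda>x. D3 x / (4 * D1 x * D2 x ^ 3)) \<in> \<Theta>[F](\<lambda>x. \<bar>(D1 x)\<^sup>2 - (D1 e)\<^sup>2\<bar> powr \<kappa>)"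
  obtains c C s where "endpoint_phase H \<phi> G G1 (u lo) (u hi) (u e) \<kappa> c C s"
proof -
  define \<Phi> where "\<Phi> x = \<bar>D3 x / (4 * D1 x * D2 x ^ 3)\<bar> / \<bar>u x - u e\<bar> powr \<kappa>" for x
  define w where "w = (u hi - u lo) / 2"
  have w: "0 < w" using u_less[of lo hi] lohi by (simp add: w_def)
  have e_in: "lo \<le> e" "e \<le> hi" using e lohi by auto
  have ne: "u x \<noteq> u e" if "lo < x" "x < hi" for x
    using u_inj[of x e] that e lohi by auto
  have \<Phi>_pos: "0 < \<Phi> x" if "lo < x" "x < hi" for x
    using D3_nonzero[OF that] D1_neg[of x] D2_neg[OF that] ne[OF that] that by (simp add: \<Phi>_def)
  have \<Phi>_cont: "continuous_on {lo<..<hi} \<Phi>"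
    unfolding \<Phi>_def
  proof (intro continuous_intros)
    show "continuous_on {lo<..<hi} D3" by (rule cont(3))
    show "continuous_on {lo<..<hi} D1" "continuous_on {lo<..<hi} D2" "continuous_on {lo<..<hi} u"
      by (rule continuous_on_subset[OF cont(1)] continuous_on_subset[OF cont(2)] continuous_on_subset[OF continuous_on_u]; auto)+
    show "\<forall>x\<in>{lo<..<hi}. 4 * D1 x * D2 x ^ 3 \<noteq> 0" using D1_neg D2_neg by force
  qed (use ne in auto)
  obtain c1 where c1: "0 < c1" "eventually (\<lambda>x. c1 * \<bar>u x - u e\<bar> powr \<kappa> \<le> \<bar>D3 x / (4 * D1 x * D2 x ^ 3)\<bar>) F"
    using landau_omega.bigE[OF bigthetaD2[OF \<Theta>]] by (auto simp: u_def)
  obtain c2 where c2: "0 < c2" "eventually (\<lambda>x. \<bar>D3 x / (4 * D1 x * D2 x ^ 3)\<bar> \<le> c2 * \<bar>u x - u e\<bar> powr \<kappa>) F"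
    using landau_o.bigE[OF bigthetaD1[OF \<Theta>]] by (auto simp: u_def)
  have ev: "eventually (\<lambda>x. c1 * \<bar>u x - u e\<bar> powr \<kappa> \<le> \<bar>D3 x / (4 * D1 x * D2 x ^ 3)\<bar> \<and>
      \<bar>D3 x / (4 * D1 x * D2 x ^ 3)\<bar> \<le> c2 * \<bar>u x - u e\<bar> powr \<kappa>) F"
    using c1(2) c2(2) by eventually_elim simp
  have near_endpoint: "\<exists>\<delta>>0. \<forall>x. lo < x \<longrightarrow> x < hi \<longrightarrow> \<bar>x - e\<bar> < \<delta> \<longrightarrow> P x" if P: "eventually P F" for P
    using e
  proof (elim disjE conjE)
    assume *: "e = lo" "F = at_right lo"
    from P[unfolded *(2) eventually_at] obtain d where "0 < d" "\<forall>x\<in>{lo<..}. x \<noteq> lo \<and> dist x lo < d \<longrightarrow> P x"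
      by (elim exE conjE)
    then show ?thesis by (intro exI[of _ d]) (auto simp: *(1) dist_real_def)
  next
    assume *: "e = hi" "F = at_left hi"
    from P[unfolded *(2) eventually_at] obtain d where "0 < d" "\<forall>x\<in>{..<hi}. x \<noteq> hi \<and> dist x hi < d \<longrightarrow> P x"
      by (elim exE conjE)
    then show ?thesis by (intro exI[of _ d]) (auto simp: *(1) dist_real_def)
  qed
  from near_endpoint[OF ev] obtain \<delta> where \<delta>: "0 < \<delta>" "\<forall>x. lo < x \<longrightarrow> x < hi \<longrightarrow> \<bar>x - e\<bar> < \<delta> \<longrightarrow>
      c1 * \<bar>u x - u e\<bar> powr \<kappa> \<le> \<bar>D3 x / (4 * D1 x * D2 x ^ 3)\<bar> \<and>
      \<bar>D3 x / (4 * D1 x * D2 x ^ 3)\<bar> \<le> c2 * \<bar>u x - u e\<bar> powr \<kappa>"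
    by (elim exE conjE)
  \<comment> \<open>The part of that half not covered by the asymptotics. It is compact and avoids
    \<open>e\<close> by \<open>\<delta>\<close> and the other endpoint by the size of
    \<open>w\<close>, so \<open>\<Phi>\<close> attains a positive minimum and a maximum on
    it.\<close>
  define K where "K = {x \<in> {lo..hi}. \<delta> \<le> \<bar>x - e\<bar> \<and> \<bar>u x - u e\<bar> \<le> w}"
  have "closed {x \<in> {lo..hi}. \<delta> \<le> \<bar>x - e\<bar>}" "closed {x \<in> {lo..hi}. \<bar>u x - u e\<bar> \<le> w}"
    by (intro continuous_on_closed_Collect_le continuous_intros continuous_on_u closed_atLeastAtMost)+
  then have "closed ({x \<in> {lo..hi}. \<delta> \<le> \<bar>x - e\<bar>} \<inter> {x \<in> {lo..hi}. \<bar>u x - u e\<bar> \<le> w})" by (rule closed_Int)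
  moreover have "K = {lo..hi} \<inter> ({x \<in> {lo..hi}. \<delta> \<le> \<bar>x - e\<bar>} \<inter> {x \<in> {lo..hi}. \<bar>u x - u e\<bar> \<le> w})"
    by (auto simp: K_def)
  ultimately have compK: "compact K" by (simp only: compact_Int_closed compact_Icc)
  have K_sub: "K \<subseteq> {lo<..<hi}"
  proof
    fix x assume x: "x \<in> K"
    have "x \<noteq> e" using x \<delta>(1) by (auto simp: K_def)
    have xw: "\<bar>u x - u e\<bar> \<le> w" "lo \<le> x" "x \<le> hi" using x by (auto simp: K_def)
    have far: "w < \<bar>u lo - u hi\<bar>" "w < \<bar>u hi - u lo\<bar>" using w by (auto simp: w_def)
    have "x \<noteq> lo" "x \<noteq> hi"
      using e \<open>x \<noteq> e\<close> xw(1) far by (elim disjE conjE; fastforce)+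
    then show "x \<in> {lo<..<hi}" using xw by simp
  qed
  obtain c3 c4 where c34: "0 < c3" "0 < c4" "\<And>x. x \<in> K \<Longrightarrow> c3 \<le> \<Phi> x \<and> \<Phi> x \<le> c4"
  proof (cases "K = {}")
    case True
    then show ?thesis using that[of 1 1] by auto
  next
    case False
    have contK: "continuous_on K \<Phi>" by (rule continuous_on_subset[OF \<Phi>_cont K_sub])
    obtain x1 where x1: "x1 \<in> K" "\<forall>x\<in>K. \<Phi> x1 \<le> \<Phi> x" using continuous_attains_inf[OF compK False contK] by blast
    obtain x2 where x2: "x2 \<in> K" "\<forall>x\<in>K. \<Phi> x \<le> \<Phi> x2" using continuous_attains_sup[OF compK False contK] by blast
    have "0 < \<Phi> x1" "0 < \<Phi> x2" using subsetD[OF K_sub x1(1)] subsetD[OF K_sub x2(1)] \<Phi>_pos by auto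
    then show ?thesis using x1(2) x2(2) by (intro that[of "\<Phi> x1" "\<Phi> x2"]) auto
  qed
  define c C where "c = min c1 c3" and "C = max c2 (max c4 c)"
  have cC: "0 < c" "c \<le> C" using c1(1) c34(1) by (auto simp: c_def C_def)
  have bounds: "c * \<bar>u x - u e\<bar> powr \<kappa> \<le> \<bar>D3 x / (4 * D1 x * D2 x ^ 3)\<bar> \<and>
      \<bar>D3 x / (4 * D1 x * D2 x ^ 3)\<bar> \<le> C * \<bar>u x - u e\<bar> powr \<kappa>"
    if x: "lo < x" "x < hi" "\<bar>u x - u e\<bar> \<le> w" for x
  proof -
    have P: "0 < \<bar>u x - u e\<bar> powr \<kappa>" using ne[OF x(1,2)] by simp
    have c: "c * \<bar>u x - u e\<bar> powr \<kappa> \<le> c1 * \<bar>u x - u e\<bar> powr \<kappa>" "c * \<bar>u x - u e\<bar> powr \<kappa> \<le> c3 * \<bar>u x - u e\<bar> powr \<kappa>"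
      "c2 * \<bar>u x - u e\<bar> powr \<kappa> \<le> C * \<bar>u x - u e\<bar> powr \<kappa>" "c4 * \<bar>u x - u e\<bar> powr \<kappa> \<le> C * \<bar>u x - u e\<bar> powr \<kappa>"
      unfolding c_def C_def by (rule mult_right_mono; simp)+
    show ?thesis
    proof (cases "\<bar>x - e\<bar> < \<delta>")
      case True
      then show ?thesis using \<delta>(2)[rule_format, OF x(1,2)] c by linarith
    next
      case False
      then have "x \<in> K" using x by (auto simp: K_def)
      then have "c3 \<le> \<Phi> x" "\<Phi> x \<le> c4" using c34(3) by auto
      then have "c3 * \<bar>u x - u e\<bar> powr \<kappa> \<le> \<bar>D3 x / (4 * D1 x * D2 x ^ 3)\<bar>"
        "\<bar>D3 x / (4 * D1 x * D2 x ^ 3)\<bar> \<le> c4 * \<bar>u x - u e\<bar> powr \<kappa>"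
        unfolding \<Phi>_def by (simp_all only: pos_le_divide_eq[OF P] pos_divide_le_eq[OF P])
      then show ?thesis using c by linarith
    qed
  qed
  obtain s where s: "s \<in> {1, -1::real}" "\<And>x. lo < x \<Longrightarrow> x < hi \<Longrightarrow> s * D3 x = \<bar>D3 x\<bar>" by (rule D3_sign, rule that)
  \<comment> \<open>\<open>D1\<close> and \<open>D2 ^ 3\<close> are both negative, so
    \<open>G1\<close> has the constant sign of \<open>D3\<close>.\<close>
  have G1_abs: "s * G1 v = \<bar>G1 v\<bar>" if v: "u lo < v" "v < u hi" for v
  proof -
    have x: "lo < \<rho> v" "\<rho> v < hi" using \<rho>[OF v] by auto
    have "D2 (\<rho> v) ^ 3 < 0" using D2_neg[OF x] by (simp add: power_less_zero_eq)
    then have "0 < 4 * D1 (\<rho> v) * D2 (\<rho> v) ^ 3" using D1_neg[of "\<rho> v"] x by (simp add: mult_neg_neg)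
    then show ?thesis using s(2)[OF x] unfolding G1_def by (simp add: abs_divide)
  qed
  have G1_bounds: "c * \<bar>v - u e\<bar> powr \<kappa> \<le> \<bar>G1 v\<bar> \<and> \<bar>G1 v\<bar> \<le> C * \<bar>v - u e\<bar> powr \<kappa>"
    if v: "u lo < v" "v < u hi" "\<bar>v - u e\<bar> \<le> w" for v
    using bounds[of "\<rho> v"] \<rho>[OF v(1,2)] v(3) by (simp add: G1_def)
  \<comment> \<open>\<open>g = - 1 / (2 * D2 e)\<close> is the limit of \<open>G\<close> at the
    endpoint, finite because \<open>\<kappa> > 0\<close> forces
    \<open>D2 e \<noteq> 0\<close>.\<close>
  have G_lim: "\<exists>g>0. \<forall>v. u lo < v \<longrightarrow> v < u hi \<longrightarrow> \<bar>v - u e\<bar> \<le> w \<longrightarrow> \<bar>G v - g\<bar> \<le> C * \<bar>v - u e\<bar> powr (\<kappa> + 1)"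
    if \<kappa>0: "0 < \<kappa>"
  proof (intro exI[of _ "- 1 / (2 * D2 e)"] conjI allI impI)
    have D2e: "D2 e \<noteq> 0" by (rule \<kappa>(2)[OF \<kappa>0])
    have Ile: "F \<noteq> bot" "F \<le> at e within {lo..hi}" "eventually (\<lambda>x. lo < x \<and> x < hi) F"
    proof -
      show "F \<noteq> bot" using e trivial_limit_at_right_real[of lo] trivial_limit_at_left_real[of hi]
        by (elim disjE conjE) simp_all
      have "at_right lo = at lo within {lo..hi}" "at_left hi = at hi within {lo..hi}"
        using lohi by (simp_all add: at_within_Icc_at_right at_within_Icc_at_left)
      then show "F \<le> at e within {lo..hi}" using e by (elim disjE conjE) simp_all
      show "eventually (\<lambda>x. lo < x \<and> x < hi) F"
        using e eventually_at_right_real[OF lohi(2)] eventually_at_left_real[OF lohi(2)]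
        by (elim disjE conjE) (simp_all add: greaterThanLessThan_iff)
    qed
    have D2lim: "(D2 \<longlongrightarrow> D2 e) F"
      by (rule tendsto_mono[OF Ile(2)]) (use cont(2) e_in in \<open>simp add: continuous_on_def\<close>)
    have ulim: "(u \<longlongrightarrow> u e) F"
      by (rule tendsto_mono[OF Ile(2)]) (use continuous_on_u e_in in \<open>simp add: continuous_on_def\<close>)
    have "eventually (\<lambda>x. D2 x \<le> 0) F" using Ile(3) by eventually_elim (use D2_neg in \<open>auto intro: less_imp_le\<close>)
    then have "D2 e \<le> 0" using D2lim Ile(1) by (intro tendsto_upperbound)
    then show "0 < - 1 / (2 * D2 e)" using D2e by (simp add: zero_less_divide_iff)
    fix v assume v: "u lo < v" "v < u hi" "\<bar>v - u e\<bar> \<le> w"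
    \<comment> \<open>For \<open>y\<close> at most as far from \<open>u e\<close> as
      \<open>v\<close>, the intermediate point is no farther either, and \<open>\<kappa> > 0\<close>
      makes the power monotone. Letting \<open>y\<close> tend to \<open>u e\<close> gives the
      claim.\<close>
    have mvt: "\<bar>G v - G y\<bar> \<le> C * \<bar>v - u e\<bar> powr \<kappa> * \<bar>v - y\<bar>"
      if y: "u lo < y" "y < u hi" "\<bar>y - u e\<bar> \<le> \<bar>v - u e\<bar>" for y
    proof -
      have "\<exists>\<xi>. \<bar>G v - G y\<bar> = \<bar>v - y\<bar> * \<bar>G1 \<xi>\<bar> \<and> min v y \<le> \<xi> \<and> \<xi> \<le> max v y"
      proof (cases v y rule: linorder_cases)
        case less
        then have "\<exists>z. v < z \<and> z < y \<and> G y - G v = (y - v) * G1 z"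
          by (intro MVT2) (use v y deriv_G in auto)
        then obtain z where z: "v < z" "z < y" "G y - G v = (y - v) * G1 z" by blast
        have "\<bar>G v - G y\<bar> = \<bar>v - y\<bar> * \<bar>G1 z\<bar>"
          unfolding abs_minus_commute[of "G v" "G y"] abs_minus_commute[of v y] z(3) by (rule abs_mult)
        then show ?thesis using z by (intro exI[of _ z]) simp
      next
        case greater
        then have "\<exists>z. y < z \<and> z < v \<and> G v - G y = (v - y) * G1 z"
          by (intro MVT2) (use v y deriv_G in auto)
        then obtain z where z: "y < z" "z < v" "G v - G y = (v - y) * G1 z" by blast
        have "\<bar>G v - G y\<bar> = \<bar>v - y\<bar> * \<bar>G1 z\<bar>" unfolding z(3) by (rule abs_mult)
        then show ?thesis using z by (intro exI[of _ z]) simp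
      qed auto
      then obtain \<xi> where \<xi>: "\<bar>G v - G y\<bar> = \<bar>v - y\<bar> * \<bar>G1 \<xi>\<bar>" "min v y \<le> \<xi>" "\<xi> \<le> max v y" by blast
      have \<xi>': "u lo < \<xi>" "\<xi> < u hi" using \<xi> v y by (auto simp: min_def max_def split: if_splits)
      have \<xi>e: "\<bar>\<xi> - u e\<bar> \<le> \<bar>v - u e\<bar>" using \<xi>(2,3) y(3) by (auto simp: min_def max_def abs_le_iff abs_if split: if_splits)
      have "\<bar>G1 \<xi>\<bar> \<le> C * \<bar>\<xi> - u e\<bar> powr \<kappa>" using G1_bounds[OF \<xi>'] \<xi>e v(3) by simp
      also have "\<dots> \<le> C * \<bar>v - u e\<bar> powr \<kappa>" using \<xi>e \<kappa>0 cC by (intro mult_left_mono powr_mono2) auto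
      finally have "\<bar>v - y\<bar> * \<bar>G1 \<xi>\<bar> \<le> \<bar>v - y\<bar> * (C * \<bar>v - u e\<bar> powr \<kappa>)" by (rule mult_left_mono) simp
      then show ?thesis unfolding \<xi>(1) by (simp only: mult.commute)
    qed
    have ve: "\<bar>v - u e\<bar> > 0" using v(1,2) e by (elim disjE conjE) simp_all
    have "((\<lambda>x. \<bar>G v - (- 1 / (2 * D2 x))\<bar>) \<longlongrightarrow> \<bar>G v - (- 1 / (2 * D2 e))\<bar>) F"
      by (intro tendsto_rabs tendsto_diff tendsto_divide tendsto_mult tendsto_const D2lim) (use D2e in simp)
    moreover have "((\<lambda>x. C * \<bar>v - u e\<bar> powr \<kappa> * \<bar>v - u x\<bar>) \<longlongrightarrow> C * \<bar>v - u e\<bar> powr \<kappa> * \<bar>v - u e\<bar>) F"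
      by (intro tendsto_rabs tendsto_diff tendsto_mult tendsto_const ulim)
    moreover have "eventually (\<lambda>x. dist (u x) (u e) < \<bar>v - u e\<bar>) F" by (rule tendstoD[OF ulim ve])
    then have "eventually (\<lambda>x. \<bar>G v - (- 1 / (2 * D2 x))\<bar> \<le> C * \<bar>v - u e\<bar> powr \<kappa> * \<bar>v - u x\<bar>) F"
      using Ile(3)
    proof eventually_elim
      case (elim x)
      have "\<bar>G v - G (u x)\<bar> \<le> C * \<bar>v - u e\<bar> powr \<kappa> * \<bar>v - u x\<bar>"
        using elim u_between[of x] by (intro mvt) (auto simp: dist_real_def)
      then show ?case using \<rho>_u[of x] elim by (simp add: G_def)
    qed
    ultimately have "\<bar>G v - (- 1 / (2 * D2 e))\<bar> \<le> C * \<bar>v - u e\<bar> powr \<kappa> * \<bar>v - u e\<bar>"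
      by (intro tendsto_le[OF Ile(1)])
    also have "\<dots> = C * \<bar>v - u e\<bar> powr (\<kappa> + 1)" using ve by (simp add: powr_add)
    finally show "\<bar>G v - (- 1 / (2 * D2 e))\<bar> \<le> C * \<bar>v - u e\<bar> powr (\<kappa> + 1)" .
  qed
  have ends: "u e = u lo \<or> u e = u hi" using e by (elim disjE conjE) simp_all
  have lt: "u lo < u hi" using u_less[of lo hi] lohi by simp
  have G1_signed: "c * \<bar>v - u e\<bar> powr \<kappa> \<le> s * G1 v \<and> s * G1 v \<le> C * \<bar>v - u e\<bar> powr \<kappa>"
    if "u lo < v" "v < u hi" "\<bar>v - u e\<bar> \<le> w" for v
    unfolding G1_abs[OF that(1,2)] by (rule G1_bounds[OF that])
  have "endpoint_phase H \<phi> G G1 (u lo) (u hi) (u e) \<kappa> c C s"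
  proof (rule endpoint_phase.intro)
    fix v assume v: "u lo < v" "v < u hi"
    show "(H has_real_derivative \<phi> v) (at v)" by (rule deriv_H[OF v])
    show "(\<phi> has_real_derivative (G v - \<phi> v) / (2 * v)) (at v)" by (rule deriv_\<phi>[OF v])
    show "(G has_real_derivative G1 v) (at v)" by (rule deriv_G[OF v])
    assume "\<bar>v - u e\<bar> \<le> (u hi - u lo) / 2"
    then show "c * \<bar>v - u e\<bar> powr \<kappa> \<le> s * G1 v \<and> s * G1 v \<le> C * \<bar>v - u e\<bar> powr \<kappa>"
      by (intro G1_signed v) (simp only: w_def)
  next
    assume "0 < \<kappa>"
    show "\<exists>g>0. \<forall>v. u lo < v \<longrightarrow> v < u hi \<longrightarrow> \<bar>v - u e\<bar> \<le> (u hi - u lo) / 2 \<longrightarrow>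
        \<bar>G v - g\<bar> \<le> C * \<bar>v - u e\<bar> powr (\<kappa> + 1)"
      using G_lim[OF \<open>0 < \<kappa>\<close>] unfolding w_def .
  qed (rule u_lo_nonneg lt ends cC(1) cC(2) s(1) \<kappa>(1))+
  then show ?thesis by (rule that)
qed

end

section \<open>The body of rotation\<close>

lemma vector_in_body_of_rotation:
  "(vector [x, 0, z] :: real^3) \<in> body_of_rotation rinf f1 f2 \<longleftrightarrow> \<bar>x\<bar> \<le> rinf \<and> f2 \<bar>x\<bar> \<le> z \<and> z \<le> f1 \<bar>x\<bar>"
  by (simp add: body_of_rotation_def Let_def vector_3)

lemma inner_vector_3: "p \<bullet> (vector [a, b, c] :: real^3) = p $ 1 * a + p $ 2 * b + p $ 3 * c"
  by (simp add: inner_vec_def sum_3 vector_3)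

lemma combination_of_vectors:
  "u *\<^sub>R (vector [x, 0, z] :: real^3) + v *\<^sub>R vector [x', 0, z'] = vector [u * x + v * x', 0, u * z + v * z']"
  by (simp add: vec_eq_iff forall_3 vector_3)

context
  fixes rinf :: real and f1 f2 :: "real \<Rightarrow> real"
  assumes f21: "\<forall>x\<in>{0..rinf}. f2 x \<le> f1 x" and conv: "convex (body_of_rotation rinf f1 f2)"
begin

lemma top_in_body: "x \<in> {0..rinf} \<Longrightarrow> (vector [x, 0, f1 x] :: real^3) \<in> body_of_rotation rinf f1 f2"
  using f21 by (auto simp: vector_in_body_of_rotation)

text \<open>Convexity of the body is used in the half plane through the axis: a combination of two
  top points stays below the top of the body.\<close>

lemma generatrix_concave: "convex_on {0..rinf} (\<lambda>x. - f1 x)"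
proof (rule convex_onI)
  fix t x y :: real
  assume t: "0 < t" "t < 1" and x: "x \<in> {0..rinf}" and y: "y \<in> {0..rinf}"
  have "(1 - t) *\<^sub>R (vector [x, 0, f1 x] :: real^3) + t *\<^sub>R vector [y, 0, f1 y] \<in> body_of_rotation rinf f1 f2"
    by (intro convexD[OF conv] top_in_body x y) (use t in auto)
  moreover have "0 \<le> (1 - t) * x + t * y" using t x y by simp
  ultimately have "(1 - t) * f1 x + t * f1 y \<le> f1 ((1 - t) * x + t * y)"
    unfolding combination_of_vectors vector_in_body_of_rotation by simp
  then show "- f1 ((1 - t) *\<^sub>R x + t *\<^sub>R y) \<le> (1 - t) * - f1 x + t * - f1 y" by simp
qed (rule convex_real_interval)

text \<open>The midpoint of the top points above \<open>x\<close> and \<open>- x\<close> lies on the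
  axis, by rotational symmetry at the same height.\<close>

lemma generatrix_le_0:
  assumes "x \<in> {0..rinf}"
  shows "f1 x \<le> f1 0"
proof -
  have "(vector [- x, 0, f1 x] :: real^3) \<in> body_of_rotation rinf f1 f2"
    using assms f21 by (auto simp: vector_in_body_of_rotation)
  from convexD[OF conv top_in_body[OF assms] this, of "1/2" "1/2"]
  have "(vector [1/2 * x + 1/2 * (- x), 0, 1/2 * f1 x + 1/2 * f1 x] :: real^3) \<in> body_of_rotation rinf f1 f2"
    unfolding combination_of_vectors by simp
  moreover have "1/2 * x + 1/2 * (- x) = 0" "1/2 * f1 x + 1/2 * f1 x = f1 x" by simp_all
  ultimately show ?thesis by (simp only: vector_in_body_of_rotation abs_zero)
qed

lemma generatrix_tangent:
  assumes "0 < c" "c < rinf" "(f1 has_real_derivative D) (at c)" "y \<in> {0..rinf}"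
  shows "f1 y \<le> f1 c + D * (y - c)"
proof -
  have der: "((\<lambda>x. - f1 x) has_real_derivative - D) (at c within {0..rinf})"
    by (rule DERIV_minus[OF has_field_derivative_at_within[OF assms(3)]])
  have c: "c \<in> interior {0..rinf}" using assms(1,2) by (simp add: interior_atLeastAtMost_real)
  have "- D * (y - c) \<le> - f1 y - - f1 c"
    by (rule convex_on_imp_above_tangent[OF generatrix_concave connected_Icc c assms(4) der])
  moreover have "- D * (y - c) = - (D * (y - c))" by (rule mult_minus_left)
  ultimately show ?thesis by linarith
qed

text \<open>The maximum is attained at the profile point with slope \<open>- sqrt v\<close>. For a
  point at distance \<open>t\<close> from the axis the first coordinate is at most \<open>t\<close>
  and the height is below the tangent at \<open>x\<close>; the terms in \<open>t\<close> then
  cancel.\<close>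

lemma h_fun_eq:
  assumes x: "0 < x" "x < rinf" "(f1 has_real_derivative - sqrt v) (at x)"
    and v: "v = n / m\<^sup>2" "0 < n" "0 < m"
  shows "h_fun (body_of_rotation rinf f1 f2) n m = m * (sqrt v * x + f1 x)"
  unfolding h_fun_def support_function_def
proof (rule cSup_eq_maximum)
  have n: "sqrt n = m * sqrt v" using v by (simp add: real_sqrt_divide)
  have "(vector [x, 0, f1 x] :: real^3) \<bullet> vector [sqrt n, 0, m] = m * (sqrt v * x + f1 x)"
    unfolding inner_vector_3 n by (simp add: vector_3 algebra_simps)
  moreover have "(vector [x, 0, f1 x] :: real^3) \<in> body_of_rotation rinf f1 f2"
    by (rule top_in_body) (use x in simp)
  ultimately show "m * (sqrt v * x + f1 x) \<in> (\<lambda>p. p \<bullet> vector [sqrt n, 0, m]) ` body_of_rotation rinf f1 f2"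
    by (rule image_eqI[OF sym])
  fix y assume "y \<in> (\<lambda>p. p \<bullet> vector [sqrt n, 0, m]) ` body_of_rotation rinf f1 f2"
  then obtain p :: "real^3" where p: "p \<in> body_of_rotation rinf f1 f2" "y = p \<bullet> vector [sqrt n, 0, m]" by blast
  define t where "t = sqrt ((p $ 1)\<^sup>2 + (p $ 2)\<^sup>2)"
  have t: "t \<le> rinf" "p $ 3 \<le> f1 t" "0 \<le> t" using p(1) by (auto simp: body_of_rotation_def Let_def t_def)
  have p1: "p $ 1 \<le> t" unfolding t_def by (rule order_trans[OF abs_ge_self real_sqrt_ge_abs1])
  have "f1 t \<le> f1 x + - sqrt v * (t - x)" by (rule generatrix_tangent[OF x]) (use t in auto)
  then have "p $ 3 \<le> f1 x - sqrt v * (t - x)" using t(2) by simp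
  then have "m * p $ 3 \<le> m * (f1 x - sqrt v * (t - x))" using v by (intro mult_left_mono) auto
  moreover have "p $ 1 * (m * sqrt v) \<le> t * (m * sqrt v)" using p1 v by (intro mult_right_mono) auto
  moreover have "y = p $ 1 * (m * sqrt v) + m * p $ 3" unfolding p(2) inner_vector_3 n by (simp add: mult.commute)
  ultimately show "y \<le> m * (sqrt v * x + f1 x)" by (simp add: algebra_simps)
qed

end

section \<open>Signs of the derivatives of the profile and the bound on one arc\<close>

context
  fixes rinf :: real and f1 f2 D1 D2 D3 :: "real \<Rightarrow> real" and lo hi :: real
  assumes f21: "\<forall>x\<in>{0..rinf}. f2 x \<le> f1 x" and conv: "convex (body_of_rotation rinf f1 f2)"
    and analytic: "real_analytic_on {0..<rinf} f1"
    and D_eq: "D1 = deriv_within {0..<rinf} f1" "D2 = deriv_within {0..<rinf} D1" "D3 = deriv_within {0..<rinf} D2"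
    and ends: "0 \<le> lo" "lo < hi" "hi < rinf"
    and finite_zeros: "finite {x \<in> {0..<rinf}. D3 x = 0}"
    and nonzero: "\<And>x. lo < x \<Longrightarrow> x < hi \<Longrightarrow> D3 x \<noteq> 0"
begin

lemma analytic_D: "real_analytic_on {0..<rinf} D1" "real_analytic_on {0..<rinf} D2" "real_analytic_on {0..<rinf} D3"
  unfolding D_eq by (intro analytic_deriv_within analytic)+

lemma derivs_within:
  assumes "x \<in> {0..<rinf}"
  shows "(f1 has_real_derivative D1 x) (at x within {0..<rinf})" "(D1 has_real_derivative D2 x) (at x within {0..<rinf})"
    "(D2 has_real_derivative D3 x) (at x within {0..<rinf})"
  using analytic_has_deriv_within[OF analytic assms] analytic_has_deriv_within[OF analytic_D(1) assms]
    analytic_has_deriv_within[OF analytic_D(2) assms] unfolding D_eq by auto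

lemma derivs:
  assumes "0 < x" "x < rinf"
  shows "(f1 has_real_derivative D1 x) (at x)" "(D1 has_real_derivative D2 x) (at x)" "(D2 has_real_derivative D3 x) (at x)"
proof -
  have "at x within {0..<rinf} = at x" using assms by (intro at_within_interior) (auto simp: interior_atLeastLessThan)
  then show "(f1 has_real_derivative D1 x) (at x)" "(D1 has_real_derivative D2 x) (at x)" "(D2 has_real_derivative D3 x) (at x)"
    using derivs_within[of x] assms by auto
qed

lemma continuous_D: "continuous_on {0..<rinf} D1" "continuous_on {0..<rinf} D2" "continuous_on {0..<rinf} D3"
  by (rule DERIV_continuous_on, rule analytic_has_deriv_within, rule analytic_D, assumption)+

lemma tangent: "0 < c \<Longrightarrow> c < rinf \<Longrightarrow> y \<in> {0..rinf} \<Longrightarrow> f1 y \<le> f1 c + D1 c * (y - c)"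
  by (rule generatrix_tangent[OF f21 conv _ _ derivs(1)])

text \<open>Each of the two points lies below the tangent at the other; adding the two inequalities
  compares the slopes.\<close>

lemma D1_antimono: "D1 y \<le> D1 x" if "0 < x" "x < y" "y < rinf"
proof -
  have "f1 y \<le> f1 x + D1 x * (y - x)" "f1 x \<le> f1 y + D1 y * (x - y)" using that by (auto intro!: tangent)
  then have "D1 y * (y - x) \<le> D1 x * (y - x)" by (simp add: algebra_simps)
  then show ?thesis using that by (simp add: mult_le_cancel_right)
qed

lemma D1_nonpos: "D1 x \<le> 0" if "0 \<le> x" "x < rinf"
proof -
  have pos: "D1 x \<le> 0" if "0 < x" "x < rinf" for x
  proof -
    have "f1 0 \<le> f1 x + D1 x * (0 - x)" using that by (intro tangent) auto
    moreover have "f1 x \<le> f1 0" by (rule generatrix_le_0[OF f21 conv]) (use that in auto)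
    ultimately have "x * D1 x \<le> 0" by (simp add: mult.commute)
    then show ?thesis using that by (simp add: mult_le_0_iff)
  qed
  show ?thesis
  proof (cases "x = 0")
    \<comment> \<open>Tangents are available only at positive radii; the value at 0 follows by
      continuity.\<close>
    case True
    have r: "(0::real) \<in> {0..<rinf}" "0 < rinf" using that by auto
    have "(D1 \<longlongrightarrow> D1 0) (at 0 within {0..<rinf})" using continuous_D(1) r by (simp add: continuous_on_def)
    then have "(D1 \<longlongrightarrow> D1 0) (at_right 0)" by (rule tendsto_mono[OF at_right_le_at_within_Ico[OF r(1)]])
    moreover have "eventually (\<lambda>x. D1 x \<le> 0) (at_right 0)"
      using eventually_at_right_real[OF r(2)] by eventually_elim (use pos in auto)
    ultimately show ?thesis unfolding True by (intro tendsto_upperbound) auto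
  qed (use pos that in auto)
qed

lemma D2_nonpos: "D2 x \<le> 0" if "0 < x" "x < rinf"
proof (rule ccontr)
  assume "\<not> D2 x \<le> 0"
  then have "0 < D2 x" by simp
  from DERIV_pos_inc_right[OF derivs(2)[OF that] this]
  obtain d where d: "0 < d" "\<forall>h>0. h < d \<longrightarrow> D1 x < D1 (x + h)" by blast
  define h where "h = min d (rinf - x) / 2"
  have h: "0 < h" "h < d" "x + h < rinf" using d that by (auto simp: h_def min_def field_simps)
  have "D1 x < D1 (x + h)" using d(2) h(1,2) by blast
  moreover have "D1 (x + h) \<le> D1 x" using that h by (intro D1_antimono) auto
  ultimately show False by linarith
qed

text \<open>An interior zero of \<open>D2\<close> would be a local maximum, because
  \<open>D2\<close> is nowhere positive for positive radii; then \<open>D3\<close> would vanish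
  there, which the arc excludes.\<close>

lemma D2_neg: "D2 x < 0" if "lo < x" "x < hi"
proof -
  have x: "0 < x" "x < rinf" using that ends by auto
  have "D2 x \<noteq> 0"
  proof
    assume "D2 x = 0"
    have "D3 x = 0"
    proof (rule DERIV_local_max[OF derivs(3)[OF x]])
      show "0 < min x (rinf - x)" using x by simp
      show "\<forall>y. \<bar>x - y\<bar> < min x (rinf - x) \<longrightarrow> D2 y \<le> D2 x"
        using D2_nonpos \<open>D2 x = 0\<close> by (auto simp: abs_less_iff)
    qed
    then show False using nonzero that by blast
  qed
  then show ?thesis using D2_nonpos[OF x] by simp
qed

lemma arc: "generatrix_arc f1 D1 D2 D3 lo hi"
proof
  show "continuous_on {lo..hi} D1" "continuous_on {lo..hi} D2" "continuous_on {lo<..<hi} D3"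
    by (rule continuous_on_subset[OF continuous_D(1)] continuous_on_subset[OF continuous_D(2)]
        continuous_on_subset[OF continuous_D(3)]; use ends in auto)+
  show "D1 lo \<le> 0" using D1_nonpos ends by auto
qed (use ends derivs D2_neg nonzero in auto)

interpretation generatrix_arc f1 D1 D2 D3 lo hi by (rule arc)

text \<open>Analyticity gives \<open>f'''\<close> a finite order at \<open>e\<close>, from which
  \<open>curvature_order\<close> derives the exponent \<open>\<kappa>\<close>. The filter
  \<open>F\<close> approaches \<open>e\<close> from inside the arc. On the window the support
  function is \<open>m * H (n / m^2)\<close>.\<close>

lemma arc_bound:
  fixes e \<epsilon> :: real
  assumes e: "e = lo \<or> e = hi" and \<epsilon>: "0 < \<epsilon>"
  obtains K where "0 \<le> K" "\<And>U1 U2 R M. u lo < U1 \<Longrightarrow> U1 < U2 \<Longrightarrow> U2 < u hi \<Longrightarrow> U2 - U1 \<le> (u hi - u lo) / 4 \<Longrightarrow>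
     (\<And>v. U1 \<le> v \<Longrightarrow> v \<le> U2 \<Longrightarrow> U2 - U1 \<le> \<bar>v - u e\<bar> \<and> \<bar>v - u e\<bar> \<le> 2 * (U2 - U1)) \<Longrightarrow>
     1 < R \<Longrightarrow> 0 < M \<Longrightarrow> 2 * M \<le> R powr (5/8) \<Longrightarrow>
     norm (exp_sum (body_of_rotation rinf f1 f2) R U1 U2 M) \<le> K * M\<^sup>2 * R powr (3/8 + \<epsilon>)"
proof -
  define F where "F = (if e = lo then at_right lo else at_left hi)"
  have eF: "e = lo \<and> F = at_right lo \<or> e = hi \<and> F = at_left hi" using e by (auto simp: F_def)
  have F: "F = at_left e \<or> F = at_right e" using eF by auto
  have e_in: "e \<in> {0..<rinf}" using e ends by auto
  have F_le: "F \<le> at e within {0..<rinf}"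
    using eF
  proof (elim disjE conjE)
    assume "e = lo" "F = at_right lo"
    then show ?thesis using at_right_le_at_within_Ico[OF e_in] by simp
  next
    assume *: "e = hi" "F = at_left hi"
    have "hi \<in> {0<..<rinf}" using ends by auto
    then show ?thesis unfolding * by (rule at_left_le_at_within_Ico)
  qed
  have ev: "eventually (\<lambda>x. lo < x \<and> x < hi) F"
    using eF eventually_at_right_real[OF ends(2)] eventually_at_left_real[OF ends(2)]
    by (elim disjE conjE) (simp_all add: greaterThanLessThan_iff)
  obtain k l where kl: "l \<noteq> 0" "((\<lambda>x. D3 x / (x - e) ^ k) \<longlongrightarrow> l) (at e within {0..<rinf})"
    by (rule analytic_leading_term[OF analytic_D(3) e_in finite_zeros], rule that)
  obtain \<kappa> where \<kappa>: "-2 \<le> \<kappa>" "0 < \<kappa> \<Longrightarrow> D2 e \<noteq> 0"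
    "(\<lambda>x. D3 x / (4 * D1 x * D2 x ^ 3)) \<in> \<Theta>[F](\<lambda>x. \<bar>(D1 x)\<^sup>2 - (D1 e)\<^sup>2\<bar> powr \<kappa>)"
  proof (rule curvature_order[OF F, of D1 D2 D3 k l])
    show "(D1 \<longlongrightarrow> D1 e) F" "(D2 \<longlongrightarrow> D2 e) F"
      using continuous_D(1,2) e_in by (auto simp: continuous_on_def intro: tendsto_mono[OF F_le])
    show "eventually (\<lambda>x. (D1 has_real_derivative D2 x) (at x)) F" "eventually (\<lambda>x. (D2 has_real_derivative D3 x) (at x)) F"
      using ev by (eventually_elim, use ends derivs in auto)+
    show "((\<lambda>x. D3 x / (x - e) ^ k) \<longlongrightarrow> l) F" by (rule tendsto_mono[OF F_le kl(2)])
    show "l \<noteq> 0" by (rule kl(1))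
    fix \<kappa> assume *: "-2 \<le> \<kappa>" "0 < \<kappa> \<Longrightarrow> D2 e \<noteq> 0"
      "(\<lambda>x. D3 x / (4 * D1 x * D2 x ^ 3)) \<in> \<Theta>[F](\<lambda>x. \<bar>(D1 x)\<^sup>2 - (D1 e)\<^sup>2\<bar> powr \<kappa>)"
    show thesis by (rule that[OF *])
  qed
  obtain c C s where "endpoint_phase H \<phi> G G1 (u lo) (u hi) (u e) \<kappa> c C s"
    by (rule endpoint_phase_exists[OF eF \<kappa>(1) _ \<kappa>(3)]) (erule \<kappa>(2), rule that)
  then interpret E: endpoint_phase H \<phi> G G1 "u lo" "u hi" "u e" \<kappa> c C s .
  \<comment> \<open>Halved because \<open>weighted_sum_bound\<close> loses twice its parameter in
    the exponent.\<close>
  have \<epsilon>2: "0 < \<epsilon> / 2" using \<epsilon> by simp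
  obtain K where K: "0 \<le> K" "\<And>U1 U2 R M. E.endpoint_window U1 U2 \<Longrightarrow> 1 < R \<Longrightarrow> 0 < M \<Longrightarrow> 2 * M \<le> R powr (5/8) \<Longrightarrow>
    norm (\<Sum>(n, m)\<in>E.index U1 U2 M. of_nat (r2 n) * e_fun (R * (real m * H (real n / (real m)\<^sup>2)))) \<le> K * M\<^sup>2 * R powr (3/8 + 2 * (\<epsilon> / 2))"
    using E.weighted_sum_bound[OF \<epsilon>2] by blast
  show ?thesis
  proof (rule that[OF K(1)])
    fix U1 U2 R M :: real
    assume U: "u lo < U1" "U1 < U2" "U2 < u hi" "U2 - U1 \<le> (u hi - u lo) / 4"
      "\<And>v. U1 \<le> v \<Longrightarrow> v \<le> U2 \<Longrightarrow> U2 - U1 \<le> \<bar>v - u e\<bar> \<and> \<bar>v - u e\<bar> \<le> 2 * (U2 - U1)"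
      and R: "1 < R" "0 < M" "2 * M \<le> R powr (5/8)"
    have win: "E.endpoint_window U1 U2" using U by (auto simp: E.endpoint_window_def)
    have "exp_sum (body_of_rotation rinf f1 f2) R U1 U2 M
      = (\<Sum>(n, m)\<in>E.index U1 U2 M. of_nat (r2 n) * e_fun (R * (real m * H (real n / (real m)\<^sup>2))))"
      unfolding exp_sum_def E.index_def
    proof (rule sum.cong[OF refl], clarify)
      fix n m :: nat
      assume nm: "0 < n" "0 < m" "U1 \<le> real n / (real m)\<^sup>2" "real n / (real m)\<^sup>2 < U2" "M \<le> real m" "real m < 2 * M"
      define v where "v = real n / (real m)\<^sup>2"
      have v: "u lo < v" "v < u hi" using nm U by (auto simp: v_def)
      have x: "0 < \<rho> v" "\<rho> v < rinf" using \<rho>[OF v] ends by auto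
      have "(f1 has_real_derivative - sqrt v) (at (\<rho> v))" using derivs(1)[OF x] unfolding D1_\<rho>[OF v] .
      then have "h_fun (body_of_rotation rinf f1 f2) (real n) (real m) = real m * (sqrt v * \<rho> v + f1 (\<rho> v))"
        by (rule h_fun_eq[OF f21 conv x]) (use nm in \<open>auto simp: v_def\<close>)
      then show "of_nat (r2 n) * e_fun (R * h_fun (body_of_rotation rinf f1 f2) (real n) (real m))
        = of_nat (r2 n) * e_fun (R * (real m * H (real n / (real m)\<^sup>2)))"
        by (simp add: H_def v_def[symmetric])
    qed
    then show "norm (exp_sum (body_of_rotation rinf f1 f2) R U1 U2 M) \<le> K * M\<^sup>2 * R powr (3/8 + \<epsilon>)"
      using K(2)[OF win R] by simp
  qed
qed

lemma arc_ends_bound: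
  fixes \<epsilon> :: real
  assumes \<epsilon>: "0 < \<epsilon>"
  shows "\<exists>C. \<forall>R M U. R > 1 \<and> M > 0 \<and> 2 * M \<le> R powr (5/8) \<and> 0 < U \<and> U \<le> ((D1 hi)\<^sup>2 - (D1 lo)\<^sup>2) / 4 \<longrightarrow>
           norm (exp_sum (body_of_rotation rinf f1 f2) R ((D1 hi)\<^sup>2 - 2 * U) ((D1 hi)\<^sup>2 - U) M)
             + norm (exp_sum (body_of_rotation rinf f1 f2) R ((D1 lo)\<^sup>2 + U) ((D1 lo)\<^sup>2 + 2 * U) M)
           \<le> C * M\<^sup>2 * R powr (3/8 + \<epsilon>)"
proof -
  obtain K1 where K1: "0 \<le> K1" "\<And>U1 U2 R M. u lo < U1 \<Longrightarrow> U1 < U2 \<Longrightarrow> U2 < u hi \<Longrightarrow> U2 - U1 \<le> (u hi - u lo) / 4 \<Longrightarrow>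
     (\<And>v. U1 \<le> v \<Longrightarrow> v \<le> U2 \<Longrightarrow> U2 - U1 \<le> \<bar>v - u lo\<bar> \<and> \<bar>v - u lo\<bar> \<le> 2 * (U2 - U1)) \<Longrightarrow>
     1 < R \<Longrightarrow> 0 < M \<Longrightarrow> 2 * M \<le> R powr (5/8) \<Longrightarrow>
     norm (exp_sum (body_of_rotation rinf f1 f2) R U1 U2 M) \<le> K1 * M\<^sup>2 * R powr (3/8 + \<epsilon>)"
    by (rule arc_bound[OF disjI1[OF refl] \<epsilon>], rule that, assumption) blast
  obtain K2 where K2: "0 \<le> K2" "\<And>U1 U2 R M. u lo < U1 \<Longrightarrow> U1 < U2 \<Longrightarrow> U2 < u hi \<Longrightarrow> U2 - U1 \<le> (u hi - u lo) / 4 \<Longrightarrow>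
     (\<And>v. U1 \<le> v \<Longrightarrow> v \<le> U2 \<Longrightarrow> U2 - U1 \<le> \<bar>v - u hi\<bar> \<and> \<bar>v - u hi\<bar> \<le> 2 * (U2 - U1)) \<Longrightarrow>
     1 < R \<Longrightarrow> 0 < M \<Longrightarrow> 2 * M \<le> R powr (5/8) \<Longrightarrow>
     norm (exp_sum (body_of_rotation rinf f1 f2) R U1 U2 M) \<le> K2 * M\<^sup>2 * R powr (3/8 + \<epsilon>)"
    by (rule arc_bound[OF disjI2[OF refl] \<epsilon>], rule that, assumption) blast
  show ?thesis
  proof (intro exI[of _ "K2 + K1"] allI impI, elim conjE)
    fix R M U :: real
    assume R: "1 < R" "0 < M" "2 * M \<le> R powr (5/8)" and U: "0 < U" "U \<le> ((D1 hi)\<^sup>2 - (D1 lo)\<^sup>2) / 4"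
    \<comment> \<open>Four times \<open>U\<close> fits into the arc, so each window, of length
      \<open>U\<close>, takes up at most a quarter of it and stays away from the opposite
      end.\<close>
    have U': "4 * U \<le> u hi - u lo" using U by (simp add: u_def)
    have "norm (exp_sum (body_of_rotation rinf f1 f2) R (u hi - 2 * U) (u hi - U) M) \<le> K2 * M\<^sup>2 * R powr (3/8 + \<epsilon>)"
      by (rule K2(2)[OF _ _ _ _ _ R]) (use U(1) U' in auto)
    moreover have "norm (exp_sum (body_of_rotation rinf f1 f2) R (u lo + U) (u lo + 2 * U) M) \<le> K1 * M\<^sup>2 * R powr (3/8 + \<epsilon>)"
      by (rule K1(2)[OF _ _ _ _ _ R]) (use U(1) U' in auto)
    ultimately show "norm (exp_sum (body_of_rotation rinf f1 f2) R ((D1 hi)\<^sup>2 - 2 * U) ((D1 hi)\<^sup>2 - U) M)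
             + norm (exp_sum (body_of_rotation rinf f1 f2) R ((D1 lo)\<^sup>2 + U) ((D1 lo)\<^sup>2 + 2 * U) M)
           \<le> (K2 + K1) * M\<^sup>2 * R powr (3/8 + \<epsilon>)"
      by (simp add: u_def distrib_right)
  qed
qed

end

theorem theorem2:
  fixes rinf \<epsilon> :: real and f1 f2 :: "real \<Rightarrow> real" and r u :: "nat \<Rightarrow> real" and j0 j :: nat
    and \<E> :: "(real^3) set"
  assumes "rinf > 0"
    and "\<forall>x\<in>{0..rinf}. f2 x \<le> f1 x"
    and "\<E> = body_of_rotation rinf f1 f2"
    and "smooth_convex_body \<E>"
    and "real_analytic_on {0..<rinf} f1" and "real_analytic_on {0..<rinf} f2"
    and "0 < j0" and "r 0 = 0" and "strict_mono_on {..j0} r"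
    and "r ` {..<j0} = {x \<in> {0..<rinf}. (deriv_within {0..<rinf} ^^ 3) f1 x = 0}"
    and "r j0 < rinf"
    and "\<forall>i\<le>j0. u i = (deriv_within {0..<rinf} f1 (r i))\<^sup>2"
    and "\<epsilon> > 0" and "j < j0"
  shows "\<exists>C. \<forall>R M U. R > 1 \<and> M > 0 \<and> 2 * M \<le> R powr (5/8) \<and> 0 < U \<and> U \<le> (u (j + 1) - u j) / 4 \<longrightarrow>
           norm (exp_sum \<E> R (u (j + 1) - 2 * U) (u (j + 1) - U) M)
             + norm (exp_sum \<E> R (u j + U) (u j + 2 * U) M)
           \<le> C * M\<^sup>2 * R powr (3/8 + \<epsilon>)"
proof -
  define D1 D2 D3 where "D1 = deriv_within {0..<rinf} f1" and "D2 = deriv_within {0..<rinf} D1"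
    and "D3 = deriv_within {0..<rinf} D2"
  have D3: "(deriv_within {0..<rinf} ^^ 3) f1 = D3"
    by (simp add: D1_def D2_def D3_def eval_nat_numeral)
  have zeros: "r ` {..<j0} = {x \<in> {0..<rinf}. D3 x = 0}" using assms(10) unfolding D3 .
  have mono: "r i < r k" if "i < k" "k \<le> j0" for i k
    using assms(9) that by (auto simp: strict_mono_on_def)
  have conv: "convex (body_of_rotation rinf f1 f2)" using assms(3,4) by (simp add: smooth_convex_body_def)
  have lo: "0 \<le> r j" using mono[of 0 j] assms(8,14) by (cases "j = 0") auto
  have hi: "r (j + 1) < rinf" using mono[of "j + 1" j0] assms(11,14) by (cases "j + 1 = j0") auto
  have "finite {x \<in> {0..<rinf}. D3 x = 0}" unfolding zeros[symmetric] by simp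
  moreover have "D3 x \<noteq> 0" if x: "r j < x" "x < r (j + 1)" for x
  proof
    assume "D3 x = 0"
    then have "x \<in> r ` {..<j0}" unfolding zeros using x lo hi by simp
    then obtain i where i: "i < j0" "x = r i" by blast
    \<comment> \<open>All zeros of \<open>f'''\<close> are values of \<open>r\<close>, hence none
      lies strictly between consecutive values. This covers \<open>j + 1 = j0\<close> too, where the
      right end need not be a zero.\<close>
    have "i \<le> j \<or> j + 1 \<le> i" by linarith
    then show False
    proof
      assume "i \<le> j"
      then have "r i \<le> r j" using mono[of i j] assms(14) by (cases "i = j") auto
      then show False using x i by simp
    next
      assume "j + 1 \<le> i"
      then have "r (j + 1) \<le> r i" using mono[of "j + 1" i] i by (cases "i = j + 1") auto
      then show False using x i by simp
    qed
  qed
  moreover have "u (j + 1) = (D1 (r (j + 1)))\<^sup>2" "u j = (D1 (r j))\<^sup>2" using assms(12,14) by (simp_all add: D1_def)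
  moreover have "r j < r (j + 1)" using mono[of j "j + 1"] assms(14) by simp
  ultimately show ?thesis
    using arc_ends_bound[OF assms(2) conv assms(5) D1_def D2_def D3_def lo _ hi _ _ assms(13)] assms(3) by simp
qed

end
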